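(* Let $G$ be a finitely generated group that has the $b_2/b_1$ property with respect to some prime $p$. Suppose that $$\sup \{ b_1(G_i; \mathbb{F}_p) : G_i \text{ is a finite index subgroup of } G \} = \infty.$$ Then there is a constant $k > 0$ such that $$s_n(G) \geq s_n^{\triangleleft\triangleleft}(G) = \Omega( p^{n^k}).$$
   Context: For a prime $p$, $\mathbb{F}_p$ is the field of order $p$, and for $r=1,2$, $b_r(G;\mathbb{F}_p)$ denotes the dimension over $\mathbb{F}_p$ of the group homology $H_r(G;\mathbb{F}_p)$. A group $G$ has the $b_2/b_1$ property with respect to the prime $p$ if there is a uniform upper bound on $\dfrac{b_2(G_i;\mathbb{F}_p)}{b_1(G_i;\mathbb{F}_p)+1}$ as $G_i$ ranges over all finite index subgroups of $G$. $s_n(G)$ is the number of subgroups of $G$ with index at most $n$. A subgroup $K$ of $G$ is subnormal if there is a finite sequence of subgroups $G=G_1\geq G_2\geq\dots\geq G_r=K$ such that each $G_i$ is normal in $G_{i-1}$. $s_n^{\triangleleft\triangleleft}(G)$ is the number of subnormal subgroups of $G$ with index at most $n$. For sequences $f_n$ and $g_n$, $f_n=\Omega(g_n)$ means that $f_n/g_n\to\infty$ as $n\to\infty$. *)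

theory Defs
  imports
    "HOL-Algebra.Generated_Groups"
    "HOL-Number_Theory.Residues"
    "HOL-Library.Extended_Real"
    "Jordan_Normal_Form.Missing_VectorSpace"
begin

section \<open>Group homology with trivial coefficients\<close>

text \<open>
  \<open>H\<^sub>n(G; R)\<close>, with trivial action of \<open>G\<close> on the coefficient ring \<open>R\<close>, is the homology of the
  complex \<open>R \<otimes>\<^bsub>\<int>G\<^esub> B\<close>, where \<open>B\<close> is the (unnormalised) bar resolution of \<open>\<int>\<close> over \<open>\<int>G\<close>.
  In degree \<open>n\<close> this complex is the free \<open>R\<close>-module on the symbols \<open>[g\<^sub>1|...|g\<^sub>n]\<close>, and its boundary
  map sends such a symbol to
  \<open>[g\<^sub>2|...|g\<^sub>n] + (\<Sum>0<i<n. (-1)^i [g\<^sub>1|...|g\<^sub>i g\<^sub>i\<^sub>+\<^sub>1|...|g\<^sub>n]) + (-1)^n [g\<^sub>1|...|g\<^sub>n\<^sub>-\<^sub>1]\<close>.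
  A symbol is represented by a list, and a chain by its finitely supported coefficient function.
\<close>

text \<open>The multiplicative components of a \<open>module\<close> record play no role, hence \<open>undefined\<close>.\<close>

definition bar_chains ::
  "('c, 'r) ring_scheme \<Rightarrow> ('a, 'g) monoid_scheme \<Rightarrow> nat \<Rightarrow> ('c, 'a list \<Rightarrow> 'c) module" where
  "bar_chains R G n =
    \<lparr>carrier = {c. (\<forall>xs. c xs \<in> carrier R) \<and> finite {xs. c xs \<noteq> \<zero>\<^bsub>R\<^esub>} \<and>
                   (\<forall>xs. c xs \<noteq> \<zero>\<^bsub>R\<^esub> \<longrightarrow> length xs = n \<and> set xs \<subseteq> carrier G)},
     monoid.mult = undefined,
     monoid.one = undefined,
     ring.zero = (\<lambda>xs. \<zero>\<^bsub>R\<^esub>),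
     ring.add = (\<lambda>c d xs. c xs \<oplus>\<^bsub>R\<^esub> d xs),
     smult = (\<lambda>a c xs. a \<otimes>\<^bsub>R\<^esub> c xs)\<rparr>"

definition bar_face :: "('a, 'g) monoid_scheme \<Rightarrow> nat \<Rightarrow> 'a list \<Rightarrow> 'a list" where
  "bar_face G i xs =
    (if i = 0 then tl xs
     else if i < length xs
       then take (i - 1) xs @ (xs ! (i - 1) \<otimes>\<^bsub>G\<^esub> xs ! i) # drop (i + 1) xs
     else butlast xs)"

definition bar_boundary ::
  "('c, 'r) ring_scheme \<Rightarrow> ('a, 'g) monoid_scheme \<Rightarrow> nat \<Rightarrow> ('a list \<Rightarrow> 'c) \<Rightarrow> ('a list \<Rightarrow> 'c)" where
  "bar_boundary R G n c =
    (if n = 0 then (\<lambda>ys. \<zero>\<^bsub>R\<^esub>)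
     else (\<lambda>ys. \<Oplus>\<^bsub>R\<^esub>xs\<in>{xs. c xs \<noteq> \<zero>\<^bsub>R\<^esub>}.
                  \<Oplus>\<^bsub>R\<^esub>i\<in>{i. i \<le> n \<and> bar_face G i xs = ys}.
                    (if even i then c xs else \<ominus>\<^bsub>R\<^esub> c xs)))"

definition bar_cycles ::
  "('c, 'r) ring_scheme \<Rightarrow> ('a, 'g) monoid_scheme \<Rightarrow> nat \<Rightarrow> ('c, 'a list \<Rightarrow> 'c) module" where
  "bar_cycles R G n =
    (bar_chains R G n)
      \<lparr>carrier := {c \<in> carrier (bar_chains R G n). bar_boundary R G n c = (\<lambda>ys. \<zero>\<^bsub>R\<^esub>)}\<rparr>"

definition bar_boundaries ::
  "('c, 'r) ring_scheme \<Rightarrow> ('a, 'g) monoid_scheme \<Rightarrow> nat \<Rightarrow> ('a list \<Rightarrow> 'c) set" where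
  "bar_boundaries R G n = bar_boundary R G (Suc n) ` carrier (bar_chains R G (Suc n))"

definition quotient_module ::
  "('c, 'm, 'x) module_scheme \<Rightarrow> 'm set \<Rightarrow> ('c, 'm set) module" where
  "quotient_module M N =
    \<lparr>carrier = a_rcosets\<^bsub>M\<^esub> N,
     monoid.mult = undefined,
     monoid.one = undefined,
     ring.zero = N,
     ring.add = (\<lambda>U W. U <+>\<^bsub>M\<^esub> W),
     smult = (\<lambda>a U. \<Union>x\<in>U. N +>\<^bsub>M\<^esub> (a \<odot>\<^bsub>M\<^esub> x))\<rparr>"

definition group_homology ::
  "('c, 'r) ring_scheme \<Rightarrow> ('a, 'g) monoid_scheme \<Rightarrow> nat \<Rightarrow> ('c, ('a list \<Rightarrow> 'c) set) module" where
  "group_homology R G n = quotient_module (bar_cycles R G n) (bar_boundaries R G n)"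

text \<open>The value is in \<^typ>\<open>enat\<close> since \<^const>\<open>vectorspace.dim\<close> is meaningless in infinite dimension.\<close>

definition betti :: "nat \<Rightarrow> nat \<Rightarrow> ('a, 'g) monoid_scheme \<Rightarrow> enat" where
  "betti p r G =
    (let K = residue_ring (int p); V = group_homology K G r
     in if vectorspace.fin_dim K V then enat (vectorspace.dim K V) else \<infinity>)"


section \<open>Finite index subgroups and subgroup growth\<close>

definition finitely_generated_group :: "('a, 'g) monoid_scheme \<Rightarrow> bool" where
  "finitely_generated_group G \<longleftrightarrow>
    group G \<and> (\<exists>S. finite S \<and> S \<subseteq> carrier G \<and> generate G S = carrier G)"

definition finite_index_subgroup :: "'a set \<Rightarrow> ('a, 'g) monoid_scheme \<Rightarrow> bool" where
  "finite_index_subgroup H G \<longleftrightarrow> subgroup H G \<and> finite (rcosets\<^bsub>G\<^esub> H)"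

text \<open>
  If \<open>b\<^sub>2\<close> is infinite and \<open>b\<^sub>1\<close> is finite, the quotient is \<open>\<infinity>\<close> and the bound fails. The quotient
  \<open>\<infinity> / \<infinity> = 0\<close> in \<^typ>\<open>ereal\<close> does not occur for finitely generated \<open>G\<close>, as then \<open>b\<^sub>1\<close> is always finite.
\<close>

definition b2_b1_property :: "nat \<Rightarrow> ('a, 'g) monoid_scheme \<Rightarrow> bool" where
  "b2_b1_property p G \<longleftrightarrow>
    (\<exists>C::real. \<forall>H. finite_index_subgroup H G \<longrightarrow>
      ereal_of_enat (betti p 2 (G\<lparr>carrier := H\<rparr>)) / (ereal_of_enat (betti p 1 (G\<lparr>carrier := H\<rparr>)) + 1)
        \<le> ereal C)"

definition subnormal :: "'a set \<Rightarrow> ('a, 'g) monoid_scheme \<Rightarrow> bool" where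
  "subnormal K G \<longleftrightarrow>
    (\<exists>(r::nat) S. S 0 = carrier G \<and> S r = K \<and> (\<forall>i\<le>r. subgroup (S i) G) \<and>
       (\<forall>i<r. S (Suc i) \<lhd> G\<lparr>carrier := S i\<rparr>))"

text \<open>A finitely generated group has only finitely many subgroups of index at most \<open>n\<close>, so for such
  groups the following cardinalities are those of finite sets.\<close>

definition subgroup_count :: "('a, 'g) monoid_scheme \<Rightarrow> nat \<Rightarrow> nat" where
  "subgroup_count G n =
    card {H. finite_index_subgroup H G \<and> card (rcosets\<^bsub>G\<^esub> H) \<le> n}"

definition subnormal_subgroup_count :: "('a, 'g) monoid_scheme \<Rightarrow> nat \<Rightarrow> nat" where
  "subnormal_subgroup_count G n =
    card {H. finite_index_subgroup H G \<and> subnormal H G \<and> card (rcosets\<^bsub>G\<^esub> H) \<le> n}"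

text \<open>The relation \<open>f\<^sub>n = \<Omega>(g\<^sub>n)\<close> in the sense \<open>f\<^sub>n / g\<^sub>n \<rightarrow> \<infinity>\<close>, which is not Landau's \<open>\<Omega>\<close>
  (\<open>f\<close> bounded below by a multiple of \<open>g\<close>).\<close>

definition Omega_growth :: "(nat \<Rightarrow> real) \<Rightarrow> (nat \<Rightarrow> real) \<Rightarrow> bool" where
  "Omega_growth f g \<longleftrightarrow> filterlim (\<lambda>n. f n / g n) at_top sequentially"

end

theory Submission
  imports Defs
begin

text \<open>
  Write \<open>d(H)\<close> for the dimension of \<open>Hom(H, F\<^sub>p)\<close>, which is \<open>b\<^sub>1(H; F\<^sub>p)\<close>. Everything rests on a lower
  bound for \<open>d\<close> of a subgroup of \<open>p\<close>-power index (lemma \<open>residue_rank_kernel\<close>). Choose a basis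
  \<open>\<chi>\<^sub>0, ..., \<chi>\<^bsub>d-1\<^esub>\<close> of \<open>Hom(H, F\<^sub>p)\<close> and let \<open>L\<close> be the common kernel of \<open>\<chi>\<^sub>j\<close> for \<open>j < l\<close>. Suppose
  that a combination of the cup products \<open>\<chi>\<^sub>j \<union> \<chi>\<^sub>i\<close>, where \<open>j < l \<le> i\<close>, is the coboundary of a
  function \<open>f\<close> on \<open>H\<close>. Since all \<open>\<chi>\<^sub>j\<close> vanish on \<open>L\<close>, the restriction of \<open>f\<close> to \<open>L\<close> is a homomorphism,
  and different combinations have different restrictions. There are \<open>l (d - l)\<close> products, and the
  classes of their combinations live in \<open>H\<^sup>2(H; F\<^sub>p)\<close>, of dimension \<open>b\<^sub>2(H; F\<^sub>p)\<close>. Hence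
  \<open>d(L) \<ge> l (d - l) - b\<^sub>2(H; F\<^sub>p)\<close>.

  If \<open>b\<^sub>2 \<le> C (b\<^sub>1 + 1)\<close> for all subgroups of finite index, then for \<open>l = C + 3\<close> and large \<open>d\<close> the right
  hand side is at least \<open>2 d\<close>, whereas the index of \<open>L\<close> in \<open>H\<close> is at most \<open>p\<^sup>l\<close>. Starting from one
  subgroup \<open>H\<close> of large \<open>b\<^sub>1\<close>, iteration gives \<open>H = H\<^sub>0 \<ge> H\<^sub>1 \<ge> ...\<close> such that \<open>d(H\<^sub>i)\<close> grows at least like
  a fixed positive power of the index (lemmas \<open>rank_doubling\<close> and \<open>rank_tower\<close>).

  The subgroup \<open>H\<close> need not be subnormal in \<open>G\<close>, but it contains a normal subgroup \<open>N\<close> of finite index.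
  The groups \<open>N \<inter> H\<^sub>i\<close> are subnormal, and so are the intersections of \<open>N\<close> with the kernels of the
  homomorphisms \<open>H\<^sub>i \<rightarrow> F\<^sub>p\<close>. As the index of \<open>N\<close> does not depend on \<open>i\<close>, a bounded number of
  homomorphisms share the same intersection, so that up to a constant factor there are at least
  \<open>p\<^bsup>d(H\<^sub>i)\<^esup>\<close> different ones (lemma \<open>subnormal_count_ge\<close>). This gives the growth along the sequence of indices
  of the tower, and lemma \<open>growth_from_geometric_subsequence\<close> fills the gaps.

  The Betti numbers of the bar complex enter through two lemmas. Lemma
  \<open>homology_1_dim_le\<close> bounds \<open>b\<^sub>1\<close> by the number of elements needed to detect all homomorphisms, and lemma
  \<open>cohomologous_if_pairings_agree\<close> bounds the classes of cocycles by \<open>b\<^sub>2\<close>. Both come down to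
  the extension of linear functionals to spaces of arbitrary dimension.
\<close>

section \<open>Linear functionals\<close>

text \<open>The field carries no scalar multiplication as a record, so functionals are not an instance of
  \<open>module_hom\<close>.\<close>

definition functional :: "('k, 'r) ring_scheme \<Rightarrow> ('k, 'v, 'w) module_scheme \<Rightarrow> ('v \<Rightarrow> 'k) set" where
  "functional K V = {f \<in> carrier V \<rightarrow> carrier K.
     (\<forall>u\<in>carrier V. \<forall>v\<in>carrier V. f (u \<oplus>\<^bsub>V\<^esub> v) = f u \<oplus>\<^bsub>K\<^esub> f v) \<and>
     (\<forall>a\<in>carrier K. \<forall>v\<in>carrier V. f (a \<odot>\<^bsub>V\<^esub> v) = a \<otimes>\<^bsub>K\<^esub> f v)}"

lemma functionalD:
  assumes "f \<in> functional K V"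
  shows "v \<in> carrier V \<Longrightarrow> f v \<in> carrier K"
    and "u \<in> carrier V \<Longrightarrow> v \<in> carrier V \<Longrightarrow> f (u \<oplus>\<^bsub>V\<^esub> v) = f u \<oplus>\<^bsub>K\<^esub> f v"
    and "a \<in> carrier K \<Longrightarrow> v \<in> carrier V \<Longrightarrow> f (a \<odot>\<^bsub>V\<^esub> v) = a \<otimes>\<^bsub>K\<^esub> f v"
  using assms by (auto simp: functional_def)

lemma (in vectorspace) functional_zero:
  assumes "f \<in> functional K V"
  shows "f \<zero>\<^bsub>V\<^esub> = \<zero>\<^bsub>K\<^esub>"
proof -
  have "f (\<zero>\<^bsub>K\<^esub> \<odot>\<^bsub>V\<^esub> \<zero>\<^bsub>V\<^esub>) = \<zero>\<^bsub>K\<^esub> \<otimes>\<^bsub>K\<^esub> f \<zero>\<^bsub>V\<^esub>"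
    by (rule functionalD(3)[OF assms]) auto
  with functionalD(1)[OF assms, of "\<zero>\<^bsub>V\<^esub>"] show ?thesis by simp
qed

lemma (in vectorspace) submodule_line_sum:
  assumes M: "submodule K M V" and v: "v \<in> carrier V"
  shows "submodule K {m \<oplus>\<^bsub>V\<^esub> c \<odot>\<^bsub>V\<^esub> v | m c. m \<in> M \<and> c \<in> carrier K} V"
proof (rule submodule.intro)
  interpret M: submodule K M V by (rule M)
  note sub = subsetD[OF M.subset]
  show "module K V" by unfold_locales
  show "{m \<oplus>\<^bsub>V\<^esub> c \<odot>\<^bsub>V\<^esub> v | m c. m \<in> M \<and> c \<in> carrier K} \<subseteq> carrier V"
    using v sub by auto
  have "\<zero>\<^bsub>V\<^esub> = \<zero>\<^bsub>V\<^esub> \<oplus>\<^bsub>V\<^esub> \<zero>\<^bsub>K\<^esub> \<odot>\<^bsub>V\<^esub> v" using v by simp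
  then show "\<zero>\<^bsub>V\<^esub> \<in> {m \<oplus>\<^bsub>V\<^esub> c \<odot>\<^bsub>V\<^esub> v | m c. m \<in> M \<and> c \<in> carrier K}"
    using M.zero_closed by blast
  fix x y
  assume "x \<in> {m \<oplus>\<^bsub>V\<^esub> c \<odot>\<^bsub>V\<^esub> v | m c. m \<in> M \<and> c \<in> carrier K}"
  then obtain m c where x: "x = m \<oplus>\<^bsub>V\<^esub> c \<odot>\<^bsub>V\<^esub> v" "m \<in> M" "c \<in> carrier K" by blast
  { assume "y \<in> {m \<oplus>\<^bsub>V\<^esub> c \<odot>\<^bsub>V\<^esub> v | m c. m \<in> M \<and> c \<in> carrier K}"
    then obtain m' c' where y: "y = m' \<oplus>\<^bsub>V\<^esub> c' \<odot>\<^bsub>V\<^esub> v" "m' \<in> M" "c' \<in> carrier K" by blast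
    have "x \<oplus>\<^bsub>V\<^esub> y = (m \<oplus>\<^bsub>V\<^esub> m') \<oplus>\<^bsub>V\<^esub> (c \<oplus>\<^bsub>K\<^esub> c') \<odot>\<^bsub>V\<^esub> v"
      using x y v sub by (simp add: smult_l_distr M.a_ac)
    then show "x \<oplus>\<^bsub>V\<^esub> y \<in> {m \<oplus>\<^bsub>V\<^esub> c \<odot>\<^bsub>V\<^esub> v | m c. m \<in> M \<and> c \<in> carrier K}"
      using x y M.m_closed R.a_closed by blast }
  { fix a assume a: "a \<in> carrier K"
    have "a \<odot>\<^bsub>V\<^esub> x = a \<odot>\<^bsub>V\<^esub> m \<oplus>\<^bsub>V\<^esub> (a \<otimes>\<^bsub>K\<^esub> c) \<odot>\<^bsub>V\<^esub> v"
      using x v a sub by (simp add: smult_r_distr smult_assoc1)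
    then show "a \<odot>\<^bsub>V\<^esub> x \<in> {m \<oplus>\<^bsub>V\<^esub> c \<odot>\<^bsub>V\<^esub> v | m c. m \<in> M \<and> c \<in> carrier K}"
      using x a M.smult_closed R.m_closed by blast }
qed

lemma (in vectorspace) submodule_minus:
  assumes "submodule K M V" "m \<in> M"
  shows "\<ominus>\<^bsub>V\<^esub> m \<in> M"
proof -
  interpret M: submodule K M V by (rule assms)
  have "\<ominus>\<^bsub>V\<^esub> m = (\<ominus>\<^bsub>K\<^esub> \<one>\<^bsub>K\<^esub>) \<odot>\<^bsub>V\<^esub> m"
    using subsetD[OF M.subset assms(2)] by (simp add: smult_l_minus)
  then show ?thesis using assms(2) by simp
qed

text \<open>Zorn's lemma applies, since the union of a chain of submodules avoiding \<open>x\<close> avoids \<open>x\<close>.\<close>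

lemma (in vectorspace) maximal_submodule_avoiding:
  assumes W: "submodule K W V" and x: "x \<notin> W"
  obtains M where "submodule K M V" "W \<subseteq> M" "x \<notin> M"
    "\<And>M'. submodule K M' V \<Longrightarrow> M \<subseteq> M' \<Longrightarrow> x \<notin> M' \<Longrightarrow> M' = M"
proof -
  let ?S = "{M. submodule K M V \<and> W \<subseteq> M \<and> x \<notin> M}"
  have "\<exists>M\<in>?S. \<forall>X\<in>?S. M \<subseteq> X \<longrightarrow> X = M"
  proof (rule subset_Zorn_nonempty)
    show "?S \<noteq> {}" using W x by blast
    fix C assume C: "C \<noteq> {}" "subset.chain ?S C"
    then have CS: "C \<subseteq> ?S" by (auto simp: subset.chain_def)
    have tot: "X \<subseteq> Y \<or> Y \<subseteq> X" if "X \<in> C" "Y \<in> C" for X Y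
      using C that by (auto simp: subset.chain_def)
    have "submodule K (\<Union>C) V"
    proof (rule submodule.intro)
      show "module K V" by unfold_locales
      show "\<Union>C \<subseteq> carrier V" using CS by (auto dest: LinearCombinations.submodule.subset)
      show "\<zero>\<^bsub>V\<^esub> \<in> \<Union>C" using C(1) CS by (auto dest: LinearCombinations.submodule.zero_closed)
      fix v w assume "v \<in> \<Union>C"
      then obtain X where X: "X \<in> C" "v \<in> X" by blast
      { assume "w \<in> \<Union>C"
        then obtain Y where Y: "Y \<in> C" "w \<in> Y" by blast
        obtain Z where Z: "Z \<in> C" "v \<in> Z" "w \<in> Z" using tot[OF X(1) Y(1)] X Y by blast
        then interpret Z: submodule K Z V using CS by blast
        show "v \<oplus>\<^bsub>V\<^esub> w \<in> \<Union>C" using Z by blast }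
      { interpret X: submodule K X V using CS X by blast
        fix c assume "c \<in> carrier K"
        then show "c \<odot>\<^bsub>V\<^esub> v \<in> \<Union>C" using X by blast }
    qed
    then show "\<Union>C \<in> ?S" using C(1) CS by blast
  qed
  then obtain M where "M \<in> ?S" and "\<forall>X\<in>?S. M \<subseteq> X \<longrightarrow> X = M" by blast
  then show ?thesis by (intro that[of M]) auto
qed

text \<open>A submodule \<open>M\<close> that is maximal among those containing \<open>W\<close> and avoiding \<open>x\<close> is a complement of the
  line through \<open>x\<close>: for \<open>v\<close> outside \<open>M\<close>, maximality puts \<open>x\<close> into the sum of \<open>M\<close> and the line through \<open>v\<close>,
  and the equation can be solved for \<open>v\<close>. The functional is the coefficient of \<open>x\<close>.\<close>

lemma (in vectorspace) functional_separating:
  assumes W: "submodule K W V" and x: "x \<in> carrier V" "x \<notin> W"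
  shows "\<exists>f\<in>functional K V. (\<forall>w\<in>W. f w = \<zero>\<^bsub>K\<^esub>) \<and> f x = \<one>\<^bsub>K\<^esub>"
proof -
  obtain M where M: "submodule K M V" "W \<subseteq> M" "x \<notin> M"
    and max: "\<And>M'. submodule K M' V \<Longrightarrow> M \<subseteq> M' \<Longrightarrow> x \<notin> M' \<Longrightarrow> M' = M"
    using maximal_submodule_avoiding[OF W x(2)] by metis
  interpret M: submodule K M V by (rule M)
  note sub = subsetD[OF M.subset]
  define P where "P v c \<longleftrightarrow> c \<in> carrier K \<and> (\<exists>m\<in>M. v = m \<oplus>\<^bsub>V\<^esub> c \<odot>\<^bsub>V\<^esub> x)" for v c
  have ex: "\<exists>c. P v c" if v: "v \<in> carrier V" for v
  proof (cases "v \<in> M")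
    case True
    then have "P v \<zero>\<^bsub>K\<^esub>" using v x by (auto simp: P_def intro!: bexI[of _ v])
    then show ?thesis ..
  next
    case False
    let ?M' = "{m \<oplus>\<^bsub>V\<^esub> c \<odot>\<^bsub>V\<^esub> v | m c. m \<in> M \<and> c \<in> carrier K}"
    have "M \<subseteq> ?M'"
    proof
      fix m assume m: "m \<in> M"
      then have "m = m \<oplus>\<^bsub>V\<^esub> \<zero>\<^bsub>K\<^esub> \<odot>\<^bsub>V\<^esub> v" using v sub by simp
      then show "m \<in> ?M'" using m by blast
    qed
    moreover have "v \<in> ?M'"
    proof -
      have "v = \<zero>\<^bsub>V\<^esub> \<oplus>\<^bsub>V\<^esub> \<one>\<^bsub>K\<^esub> \<odot>\<^bsub>V\<^esub> v" using v by simp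
      then show ?thesis using M.zero_closed R.one_closed by blast
    qed
    ultimately have "x \<in> ?M'" using max[OF submodule_line_sum[OF M(1) v]] False by blast
    then obtain m c where mc: "x = m \<oplus>\<^bsub>V\<^esub> c \<odot>\<^bsub>V\<^esub> v" "m \<in> M" "c \<in> carrier K" by blast
    have "c \<noteq> \<zero>\<^bsub>K\<^esub>" using mc M(3) v sub by auto
    then have c: "inv\<^bsub>K\<^esub> c \<in> carrier K" "inv\<^bsub>K\<^esub> c \<otimes>\<^bsub>K\<^esub> c = \<one>\<^bsub>K\<^esub>"
      using mc(3) field_Units by auto
    have "inv\<^bsub>K\<^esub> c \<odot>\<^bsub>V\<^esub> x = inv\<^bsub>K\<^esub> c \<odot>\<^bsub>V\<^esub> m \<oplus>\<^bsub>V\<^esub> v"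
      using mc c v sub by (simp add: smult_r_distr flip: smult_assoc1)
    then have "v = \<ominus>\<^bsub>V\<^esub> (inv\<^bsub>K\<^esub> c \<odot>\<^bsub>V\<^esub> m) \<oplus>\<^bsub>V\<^esub> inv\<^bsub>K\<^esub> c \<odot>\<^bsub>V\<^esub> x"
      using mc c v sub by (simp add: M.r_neg1)
    then have "P v (inv\<^bsub>K\<^esub> c)"
      using c mc submodule_minus[OF M(1)] by (auto simp: P_def)
    then show ?thesis ..
  qed
  have uniq: "c = d" if "P v c" "P v d" for v c d
  proof (rule ccontr)
    assume "c \<noteq> d"
    from that obtain m m' where m: "m \<in> M" "m' \<in> M" "c \<in> carrier K" "d \<in> carrier K"
      "m \<oplus>\<^bsub>V\<^esub> c \<odot>\<^bsub>V\<^esub> x = m' \<oplus>\<^bsub>V\<^esub> d \<odot>\<^bsub>V\<^esub> x" by (auto simp: P_def)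
    let ?e = "c \<ominus>\<^bsub>K\<^esub> d"
    have e0: "?e \<noteq> \<zero>\<^bsub>K\<^esub>" using m \<open>c \<noteq> d\<close> by (simp add: R.r_right_minus_eq)
    have e: "?e \<in> carrier K" using m by simp
    have inv: "inv\<^bsub>K\<^esub> ?e \<in> carrier K" "inv\<^bsub>K\<^esub> ?e \<otimes>\<^bsub>K\<^esub> ?e = \<one>\<^bsub>K\<^esub>"
      using e e0 field_Units by auto
    have "?e \<odot>\<^bsub>V\<^esub> x = c \<odot>\<^bsub>V\<^esub> x \<ominus>\<^bsub>V\<^esub> d \<odot>\<^bsub>V\<^esub> x"
      using m x by (simp add: R.minus_eq M.minus_eq smult_l_distr smult_l_minus)
    also have "\<dots> = \<ominus>\<^bsub>V\<^esub> m \<oplus>\<^bsub>V\<^esub> (m \<oplus>\<^bsub>V\<^esub> c \<odot>\<^bsub>V\<^esub> x) \<ominus>\<^bsub>V\<^esub> d \<odot>\<^bsub>V\<^esub> x"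
      using m(1,3,4) x sub by (simp add: M.r_neg1)
    also have "\<dots> = \<ominus>\<^bsub>V\<^esub> m \<oplus>\<^bsub>V\<^esub> m'"
      unfolding m(5) using m(1-4) x sub by (simp add: M.minus_eq M.a_assoc M.r_neg)
    finally have "?e \<odot>\<^bsub>V\<^esub> x \<in> M" using m submodule_minus[OF M(1)] by simp
    then have "inv\<^bsub>K\<^esub> ?e \<odot>\<^bsub>V\<^esub> (?e \<odot>\<^bsub>V\<^esub> x) \<in> M" using inv by blast
    then show False using inv e x M(3) by (simp flip: smult_assoc1)
  qed
  define f where "f v = (THE c. P v c)" for v
  have f: "P v (f v)" if "v \<in> carrier V" for v
    unfolding f_def using ex[OF that] uniq by (metis theI')
  have feq: "f v = c" if "P v c" for v c
    unfolding f_def using that uniq by blast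
  have "f \<in> functional K V"
  proof -
    have "f (u \<oplus>\<^bsub>V\<^esub> v) = f u \<oplus>\<^bsub>K\<^esub> f v" if uv: "u \<in> carrier V" "v \<in> carrier V" for u v
    proof (rule feq)
      obtain m m' where m: "m \<in> M" "f u \<in> carrier K" "m' \<in> M" "f v \<in> carrier K"
        and uv_eq: "u = m \<oplus>\<^bsub>V\<^esub> f u \<odot>\<^bsub>V\<^esub> x" "v = m' \<oplus>\<^bsub>V\<^esub> f v \<odot>\<^bsub>V\<^esub> x"
        using f[OF uv(1)] f[OF uv(2)] by (auto simp: P_def)
      have "(m \<oplus>\<^bsub>V\<^esub> f u \<odot>\<^bsub>V\<^esub> x) \<oplus>\<^bsub>V\<^esub> (m' \<oplus>\<^bsub>V\<^esub> f v \<odot>\<^bsub>V\<^esub> x) =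
          (m \<oplus>\<^bsub>V\<^esub> m') \<oplus>\<^bsub>V\<^esub> (f u \<oplus>\<^bsub>K\<^esub> f v) \<odot>\<^bsub>V\<^esub> x"
        using m x sub by (simp add: smult_l_distr M.a_ac)
      then show "P (u \<oplus>\<^bsub>V\<^esub> v) (f u \<oplus>\<^bsub>K\<^esub> f v)"
        unfolding P_def using m by (subst uv_eq(1), subst uv_eq(2)) auto
    qed
    moreover have "f (a \<odot>\<^bsub>V\<^esub> v) = a \<otimes>\<^bsub>K\<^esub> f v" if a: "a \<in> carrier K" "v \<in> carrier V" for a v
    proof (rule feq)
      obtain m where m: "m \<in> M" "f v \<in> carrier K" and v_eq: "v = m \<oplus>\<^bsub>V\<^esub> f v \<odot>\<^bsub>V\<^esub> x"
        using f[OF a(2)] by (auto simp: P_def)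
      have "a \<odot>\<^bsub>V\<^esub> (m \<oplus>\<^bsub>V\<^esub> f v \<odot>\<^bsub>V\<^esub> x) = a \<odot>\<^bsub>V\<^esub> m \<oplus>\<^bsub>V\<^esub> (a \<otimes>\<^bsub>K\<^esub> f v) \<odot>\<^bsub>V\<^esub> x"
        using m x a sub by (simp add: smult_r_distr smult_assoc1)
      then show "P (a \<odot>\<^bsub>V\<^esub> v) (a \<otimes>\<^bsub>K\<^esub> f v)"
        unfolding P_def using m a by (subst v_eq) auto
    qed
    ultimately show ?thesis using f by (auto simp: functional_def P_def)
  qed
  moreover have "f w = \<zero>\<^bsub>K\<^esub>" if "w \<in> W" for w
    using that M(2) sub x by (intro feq) (auto simp: P_def intro!: bexI[of _ w])
  moreover have "f x = \<one>\<^bsub>K\<^esub>"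
    using x by (intro feq) (auto simp: P_def intro!: bexI[of _ "\<zero>\<^bsub>V\<^esub>"])
  ultimately show ?thesis by blast
qed

text \<open>This is where functionals on chains of an infinite group get extended. If \<open>f u\<^sub>1 = 1\<close>, then \<open>T u\<^sub>1\<close>
  is outside the image of the kernel of \<open>f\<close>, because \<open>f\<close> vanishes on the kernel of \<open>T\<close>. A functional
  separating the two agrees with \<open>f\<close> along \<open>T\<close>, on \<open>u\<^sub>1\<close> and on the kernel of \<open>f\<close>, hence everywhere.\<close>

lemma functional_factors:
  assumes U: "vectorspace K U" and V: "vectorspace K V"
    and T: "T \<in> module_hom K U V" and f: "f \<in> functional K U"
    and ker: "\<And>u. u \<in> carrier U \<Longrightarrow> T u = \<zero>\<^bsub>V\<^esub> \<Longrightarrow> f u = \<zero>\<^bsub>K\<^esub>"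
  shows "\<exists>h\<in>functional K V. \<forall>u\<in>carrier U. h (T u) = f u"
proof -
  interpret U: vectorspace K U by (rule U)
  interpret V: vectorspace K V by (rule V)
  interpret T: mod_hom K U V T by (unfold_locales) (rule T)
  note fD = functionalD[OF f]
  show ?thesis
  proof (cases "\<forall>u\<in>carrier U. f u = \<zero>\<^bsub>K\<^esub>")
    case True
    have "(\<lambda>v. \<zero>\<^bsub>K\<^esub>) \<in> functional K V" by (auto simp: functional_def)
    then show ?thesis using True by (metis (no_types, lifting))
  next
    case False
    then obtain u0 where u0: "u0 \<in> carrier U" "f u0 \<noteq> \<zero>\<^bsub>K\<^esub>" by blast
    define u1 where "u1 = inv\<^bsub>K\<^esub> f u0 \<odot>\<^bsub>U\<^esub> u0"
    have inv: "inv\<^bsub>K\<^esub> f u0 \<in> carrier K" "inv\<^bsub>K\<^esub> f u0 \<otimes>\<^bsub>K\<^esub> f u0 = \<one>\<^bsub>K\<^esub>"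
      using fD(1)[OF u0(1)] u0(2) U.field_Units by auto
    have u1: "u1 \<in> carrier U" "f u1 = \<one>\<^bsub>K\<^esub>"
      using u0 inv by (auto simp: u1_def fD)
    let ?N = "{u \<in> carrier U. f u = \<zero>\<^bsub>K\<^esub>}"
    let ?W = "T ` ?N"
    have W: "submodule K ?W V"
    proof (rule submodule.intro)
      show "module K V" by unfold_locales
      show "?W \<subseteq> carrier V" by auto
      have "T \<zero>\<^bsub>U\<^esub> \<in> ?W" using U.functional_zero[OF f] by (intro imageI) auto
      then show "\<zero>\<^bsub>V\<^esub> \<in> ?W" by simp
      fix v w assume "v \<in> ?W"
      then obtain a where a: "a \<in> carrier U" "f a = \<zero>\<^bsub>K\<^esub>" "v = T a" by blast
      { assume "w \<in> ?W"
        then obtain b where b: "b \<in> carrier U" "f b = \<zero>\<^bsub>K\<^esub>" "w = T b" by blast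
        have "T (a \<oplus>\<^bsub>U\<^esub> b) \<in> ?W" using a b by (intro imageI) (auto simp: fD)
        then show "v \<oplus>\<^bsub>V\<^esub> w \<in> ?W" using a b by simp }
      { fix c assume c: "c \<in> carrier K"
        have "T (c \<odot>\<^bsub>U\<^esub> a) \<in> ?W" using a c by (intro imageI) (auto simp: fD)
        then show "c \<odot>\<^bsub>V\<^esub> v \<in> ?W" using a c by simp }
    qed
    have min: "f (u \<ominus>\<^bsub>U\<^esub> v) = f u \<ominus>\<^bsub>K\<^esub> f v" if "u \<in> carrier U" "v \<in> carrier U" for u v
    proof -
      have "f (u \<ominus>\<^bsub>U\<^esub> v) = f (u \<oplus>\<^bsub>U\<^esub> (\<ominus>\<^bsub>K\<^esub> \<one>\<^bsub>K\<^esub>) \<odot>\<^bsub>U\<^esub> v)"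
        using that by (simp add: U.M.minus_eq U.smult_l_minus)
      also have "\<dots> = f u \<ominus>\<^bsub>K\<^esub> f v"
        using that fD(1) by (simp add: fD U.R.minus_eq U.R.l_minus)
      finally show ?thesis .
    qed
    have "T u1 \<notin> ?W"
    proof
      assume "T u1 \<in> ?W"
      then obtain a where a: "a \<in> carrier U" "f a = \<zero>\<^bsub>K\<^esub>" "T u1 = T a" by blast
      have "T (u1 \<ominus>\<^bsub>U\<^esub> a) = \<zero>\<^bsub>V\<^esub>" using a u1 T.f_im by (simp add: V.M.minus_eq V.M.r_neg)
      then have "f (u1 \<ominus>\<^bsub>U\<^esub> a) = \<zero>\<^bsub>K\<^esub>" using u1 a by (intro ker) auto
      then show False using a u1 by (simp add: min U.R.minus_eq)
    qed
    then obtain h where h: "h \<in> functional K V" "\<forall>w\<in>?W. h w = \<zero>\<^bsub>K\<^esub>" "h (T u1) = \<one>\<^bsub>K\<^esub>"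
      using V.functional_separating[OF W T.f_im[OF u1(1)]] by blast
    have "h (T u) = f u" if u: "u \<in> carrier U" for u
    proof -
      let ?w = "u \<ominus>\<^bsub>U\<^esub> f u \<odot>\<^bsub>U\<^esub> u1"
      have w: "?w \<in> carrier U" using u u1 fD by simp
      have "f ?w = \<zero>\<^bsub>K\<^esub>" using u u1 fD by (simp add: min U.R.minus_eq U.R.r_neg)
      then have "h (T ?w) = \<zero>\<^bsub>K\<^esub>" using w h by blast
      moreover have "u = ?w \<oplus>\<^bsub>U\<^esub> f u \<odot>\<^bsub>U\<^esub> u1"
        using u u1 fD by (simp add: U.M.minus_eq U.M.a_assoc U.M.l_neg)
      then have Tu: "T u = T ?w \<oplus>\<^bsub>V\<^esub> f u \<odot>\<^bsub>V\<^esub> T u1"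
        using u u1 w fD by (metis T.f_add T.f_smult U.smult_closed)
      have "h (T u) = h (T ?w) \<oplus>\<^bsub>K\<^esub> f u \<otimes>\<^bsub>K\<^esub> h (T u1)"
        unfolding Tu using T.f_im u u1 w fD
        by (subst functionalD(2)[OF h(1)]) (auto simp: functionalD(3)[OF h(1)])
      ultimately show ?thesis using u fD h(3) by simp
    qed
    then show ?thesis using h by blast
  qed
qed


section \<open>Quotient spaces\<close>

lemma vectorspace_surjective_image:
  assumes M: "vectorspace K M" and car: "carrier Q = \<pi> ` carrier M" and zero: "\<zero>\<^bsub>Q\<^esub> = \<pi> \<zero>\<^bsub>M\<^esub>"
    and add: "\<And>x y. x \<in> carrier M \<Longrightarrow> y \<in> carrier M \<Longrightarrow> \<pi> x \<oplus>\<^bsub>Q\<^esub> \<pi> y = \<pi> (x \<oplus>\<^bsub>M\<^esub> y)"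
    and smult: "\<And>a x. a \<in> carrier K \<Longrightarrow> x \<in> carrier M \<Longrightarrow> a \<odot>\<^bsub>Q\<^esub> \<pi> x = \<pi> (a \<odot>\<^bsub>M\<^esub> x)"
  shows "vectorspace K Q"
proof -
  interpret M: vectorspace K M by (rule M)
  have neg: "\<exists>w\<in>carrier Q. v \<oplus>\<^bsub>Q\<^esub> w = \<zero>\<^bsub>Q\<^esub>" if "v \<in> carrier Q" for v
  proof -
    from that obtain x where x: "x \<in> carrier M" "v = \<pi> x" by (auto simp: car)
    then have "v \<oplus>\<^bsub>Q\<^esub> \<pi> (\<ominus>\<^bsub>M\<^esub> x) = \<zero>\<^bsub>Q\<^esub>" by (simp add: add zero M.M.r_neg)
    then show ?thesis using x by (auto simp: car)
  qed
  show ?thesis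
    by (rule vs_criteria[OF M.field_axioms])
      (use neg in \<open>auto simp: car zero add smult M.M.a_ac M.smult_assoc1 M.smult_l_distr M.smult_r_distr\<close>)
qed

context
  fixes K M N
  assumes M: "vectorspace K M" and N: "submodule K N M"
begin

interpretation M: vectorspace K M by (rule M)
interpretation N: submodule K N M by (rule N)

lemma submodule_abelian_subgroup: "abelian_subgroup N M"
proof (rule abelian_subgroupI3)
  show "abelian_group M" by unfold_locales
  have "inv\<^bsub>add_monoid M\<^esub> x \<in> N" if "x \<in> N" for x
    using M.submodule_minus[OF N that] by (simp add: a_inv_def)
  then show "additive_subgroup N M"
    by (auto simp: additive_subgroup_def subgroup_def intro: subsetD[OF N.subset])
qed

interpretation N: abelian_subgroup N M by (rule submodule_abelian_subgroup)

lemma quotient_module_carrier: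
  "carrier (quotient_module M N) = (\<lambda>x. N +>\<^bsub>M\<^esub> x) ` carrier M"
  by (auto simp: quotient_module_def A_RCOSETS_def')

lemma quotient_module_add:
  "x \<in> carrier M \<Longrightarrow> y \<in> carrier M \<Longrightarrow>
    (N +>\<^bsub>M\<^esub> x) \<oplus>\<^bsub>quotient_module M N\<^esub> (N +>\<^bsub>M\<^esub> y) = N +>\<^bsub>M\<^esub> (x \<oplus>\<^bsub>M\<^esub> y)"
  by (simp add: quotient_module_def N.a_rcos_sum)

text \<open>Scaling maps a coset into a coset, so the union by which scalar multiplication is defined has only
  one member.\<close>

lemma quotient_module_smult:
  assumes a: "a \<in> carrier K" and x: "x \<in> carrier M"
  shows "a \<odot>\<^bsub>quotient_module M N\<^esub> (N +>\<^bsub>M\<^esub> x) = N +>\<^bsub>M\<^esub> (a \<odot>\<^bsub>M\<^esub> x)"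
proof -
  have "N +>\<^bsub>M\<^esub> (a \<odot>\<^bsub>M\<^esub> y) = N +>\<^bsub>M\<^esub> (a \<odot>\<^bsub>M\<^esub> x)" if "y \<in> N +>\<^bsub>M\<^esub> x" for y
  proof -
    from that obtain n where n: "n \<in> N" "y = n \<oplus>\<^bsub>M\<^esub> x" by (auto simp: a_r_coset_def')
    have "n \<in> carrier M" using n(1) N.subset by blast
    then have "a \<odot>\<^bsub>M\<^esub> y = a \<odot>\<^bsub>M\<^esub> n \<oplus>\<^bsub>M\<^esub> a \<odot>\<^bsub>M\<^esub> x"
      using a x n(2) by (simp add: M.smult_r_distr)
    then have "a \<odot>\<^bsub>M\<^esub> y \<in> N +>\<^bsub>M\<^esub> (a \<odot>\<^bsub>M\<^esub> x)"
      using n a by (auto simp: a_r_coset_def')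
    from N.a_repr_independence'[OF this M.smult_closed[OF a x]] show ?thesis by simp
  qed
  moreover have "x \<in> N +>\<^bsub>M\<^esub> x" using N.a_rcos_self x by blast
  ultimately have "(\<Union>y\<in>N +>\<^bsub>M\<^esub> x. N +>\<^bsub>M\<^esub> (a \<odot>\<^bsub>M\<^esub> y)) = N +>\<^bsub>M\<^esub> (a \<odot>\<^bsub>M\<^esub> x)" by blast
  then show ?thesis by (simp add: quotient_module_def)
qed

lemma quotient_module_zero: "\<zero>\<^bsub>quotient_module M N\<^esub> = N"
  by (simp add: quotient_module_def)

lemma quotient_module_vectorspace: "vectorspace K (quotient_module M N)"
proof (rule vectorspace_surjective_image[OF M quotient_module_carrier])
  show "\<zero>\<^bsub>quotient_module M N\<^esub> = N +>\<^bsub>M\<^esub> \<zero>\<^bsub>M\<^esub>"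
    using N.a_rcos_const[of "\<zero>\<^bsub>M\<^esub>"] by (simp add: quotient_module_zero)
qed (auto simp: quotient_module_add quotient_module_smult)

lemma quotient_module_hom: "(\<lambda>x. N +>\<^bsub>M\<^esub> x) \<in> module_hom K M (quotient_module M N)"
  by (auto simp: module_hom_def quotient_module_carrier quotient_module_add quotient_module_smult)

lemma quotient_module_eq_zero_iff:
  assumes "x \<in> carrier M"
  shows "N +>\<^bsub>M\<^esub> x = \<zero>\<^bsub>quotient_module M N\<^esub> \<longleftrightarrow> x \<in> N"
  using N.a_rcos_const[of x] N.a_rcos_self[OF assms] by (auto simp: quotient_module_zero)

end

lemma functional_comp_hom:
  assumes "T \<in> module_hom K U V" "f \<in> functional K V"
  shows "(\<lambda>u. f (T u)) \<in> functional K U"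
  using assms by (auto simp: functional_def module_hom_def Pi_def)

lemma (in vectorspace) functional_finsum:
  assumes f: "f \<in> functional K V" and "finite A" "v \<in> A \<rightarrow> carrier V"
  shows "f (finsum V v A) = (\<Oplus>\<^bsub>K\<^esub>i\<in>A. f (v i))"
  using assms(2,3)
proof (induction A)
  case empty
  then show ?case by (simp add: functional_zero[OF f])
next
  case (insert i A)
  then have "finsum V v (insert i A) = v i \<oplus>\<^bsub>V\<^esub> finsum V v A"
    by (intro M.finsum_insert) auto
  moreover have "finsum K (\<lambda>i. f (v i)) (insert i A) = f (v i) \<oplus>\<^bsub>K\<^esub> finsum K (\<lambda>i. f (v i)) A"
    using insert functionalD(1)[OF f] by (intro R.finsum_insert) auto
  moreover have "v i \<in> carrier V" "finsum V v A \<in> carrier V" using insert by auto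
  ultimately show ?case using insert by (simp add: functionalD(2)[OF f])
qed

lemma (in vectorspace) functional_minus:
  assumes "f \<in> functional K V" "g \<in> functional K V"
  shows "(\<lambda>v. f v \<ominus>\<^bsub>K\<^esub> g v) \<in> functional K V"
  using functionalD[OF assms(1)] functionalD[OF assms(2)]
  by (auto simp: functional_def R.minus_eq R.minus_add R.a_ac R.r_distr R.r_minus)


section \<open>The bar complex\<close>

definition bar_symbol :: "('c, 'r) ring_scheme \<Rightarrow> 'a list \<Rightarrow> 'a list \<Rightarrow> 'c" where
  "bar_symbol R xs = (\<lambda>ys. if ys = xs then \<one>\<^bsub>R\<^esub> else \<zero>\<^bsub>R\<^esub>)"

text \<open>The value at the chain \<open>c\<close> of the functional that takes the value \<open>\<phi> xs\<close> at the symbol \<open>xs\<close>.\<close>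

definition bar_pairing :: "('c, 'r) ring_scheme \<Rightarrow> ('a list \<Rightarrow> 'c) \<Rightarrow> ('a list \<Rightarrow> 'c) \<Rightarrow> 'c" where
  "bar_pairing R \<phi> c = (\<Oplus>\<^bsub>R\<^esub>xs\<in>{xs. c xs \<noteq> \<zero>\<^bsub>R\<^esub>}. c xs \<otimes>\<^bsub>R\<^esub> \<phi> xs)"

definition bar_sign :: "('c, 'r) ring_scheme \<Rightarrow> nat \<Rightarrow> 'c" where
  "bar_sign R i = (if even i then \<one>\<^bsub>R\<^esub> else \<ominus>\<^bsub>R\<^esub> \<one>\<^bsub>R\<^esub>)"

lemma bar_chains_carrier:
  "c \<in> carrier (bar_chains R G n) \<longleftrightarrow> (\<forall>xs. c xs \<in> carrier R) \<and> finite {xs. c xs \<noteq> \<zero>\<^bsub>R\<^esub>} \<and>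
     (\<forall>xs. c xs \<noteq> \<zero>\<^bsub>R\<^esub> \<longrightarrow> length xs = n \<and> set xs \<subseteq> carrier G)"
  by (simp add: bar_chains_def)

lemma bar_chains_ops:
  "\<zero>\<^bsub>bar_chains R G n\<^esub> = (\<lambda>xs. \<zero>\<^bsub>R\<^esub>)"
  "c \<oplus>\<^bsub>bar_chains R G n\<^esub> d = (\<lambda>xs. c xs \<oplus>\<^bsub>R\<^esub> d xs)"
  "a \<odot>\<^bsub>bar_chains R G n\<^esub> c = (\<lambda>xs. a \<otimes>\<^bsub>R\<^esub> c xs)"
  by (simp_all add: bar_chains_def)

context field
begin

lemma bar_chains_vectorspace: "vectorspace R (bar_chains R G n)"
proof (rule vs_criteria)
  show "field R" by unfold_locales
  show "\<zero>\<^bsub>bar_chains R G n\<^esub> \<in> carrier (bar_chains R G n)"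
    by (simp add: bar_chains_carrier bar_chains_ops)
  have "c \<oplus>\<^bsub>bar_chains R G n\<^esub> d \<in> carrier (bar_chains R G n)"
    if c: "c \<in> carrier (bar_chains R G n)" and d: "d \<in> carrier (bar_chains R G n)" for c d
  proof -
    have "{xs. c xs \<oplus> d xs \<noteq> \<zero>} \<subseteq> {xs. c xs \<noteq> \<zero>} \<union> {xs. d xs \<noteq> \<zero>}" by auto
    moreover have "finite ({xs. c xs \<noteq> \<zero>} \<union> {xs. d xs \<noteq> \<zero>})"
      using c d by (simp add: bar_chains_carrier)
    ultimately have "finite {xs. c xs \<oplus> d xs \<noteq> \<zero>}" by (rule finite_subset)
    then show ?thesis
      using c d unfolding bar_chains_carrier bar_chains_ops by (metis a_closed l_zero zero_closed)
  qed
  then show "\<forall>c d. c \<in> carrier (bar_chains R G n) \<and> d \<in> carrier (bar_chains R G n) \<longrightarrow>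
      c \<oplus>\<^bsub>bar_chains R G n\<^esub> d \<in> carrier (bar_chains R G n)" by blast
  have smult: "a \<odot>\<^bsub>bar_chains R G n\<^esub> c \<in> carrier (bar_chains R G n)"
    if a: "a \<in> carrier R" and c: "c \<in> carrier (bar_chains R G n)" for a c
  proof -
    have "{xs. a \<otimes> c xs \<noteq> \<zero>} \<subseteq> {xs. c xs \<noteq> \<zero>}" using a by auto
    then have "finite {xs. a \<otimes> c xs \<noteq> \<zero>}" by (rule finite_subset) (use c in \<open>simp add: bar_chains_carrier\<close>)
    then show ?thesis
      using a c unfolding bar_chains_carrier bar_chains_ops by (metis m_closed r_null)
  qed
  then show "\<forall>a c. a \<in> carrier R \<and> c \<in> carrier (bar_chains R G n) \<longrightarrow>
      a \<odot>\<^bsub>bar_chains R G n\<^esub> c \<in> carrier (bar_chains R G n)" by blast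
  show "\<forall>c\<in>carrier (bar_chains R G n). \<exists>d\<in>carrier (bar_chains R G n).
      c \<oplus>\<^bsub>bar_chains R G n\<^esub> d = \<zero>\<^bsub>bar_chains R G n\<^esub>"
  proof
    fix c assume c: "c \<in> carrier (bar_chains R G n)"
    have "c \<oplus>\<^bsub>bar_chains R G n\<^esub> (\<ominus> \<one>) \<odot>\<^bsub>bar_chains R G n\<^esub> c = \<zero>\<^bsub>bar_chains R G n\<^esub>"
      using c by (auto simp: bar_chains_carrier bar_chains_ops l_minus r_neg)
    then show "\<exists>d\<in>carrier (bar_chains R G n).
        c \<oplus>\<^bsub>bar_chains R G n\<^esub> d = \<zero>\<^bsub>bar_chains R G n\<^esub>" using smult c by blast
  qed
qed (auto simp: bar_chains_carrier bar_chains_ops a_ac m_ac l_distr r_distr)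

lemma bar_symbol_closed:
  "length xs = n \<Longrightarrow> set xs \<subseteq> carrier G \<Longrightarrow> bar_symbol R xs \<in> carrier (bar_chains R G n)"
  by (auto simp: bar_chains_carrier bar_symbol_def)

lemma bar_pairing_superset:
  assumes "c \<in> carrier (bar_chains R G n)" "\<And>xs. \<phi> xs \<in> carrier R"
    and "finite S" "{xs. c xs \<noteq> \<zero>} \<subseteq> S"
  shows "bar_pairing R \<phi> c = (\<Oplus>xs\<in>S. c xs \<otimes> \<phi> xs)"
  unfolding bar_pairing_def using assms
  by (intro add.finprod_mono_neutral_cong_left) (auto simp: bar_chains_carrier)

lemma bar_pairing_functional:
  assumes \<phi>: "\<And>xs. \<phi> xs \<in> carrier R"
  shows "bar_pairing R \<phi> \<in> functional R (bar_chains R G n)"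
proof -
  interpret C: vectorspace R "bar_chains R G n" by (rule bar_chains_vectorspace)
  have "bar_pairing R \<phi> c \<in> carrier R" if "c \<in> carrier (bar_chains R G n)" for c
    using that \<phi> unfolding bar_pairing_def by (intro finsum_closed) (auto simp: bar_chains_carrier)
  moreover have "bar_pairing R \<phi> (c \<oplus>\<^bsub>bar_chains R G n\<^esub> d) = bar_pairing R \<phi> c \<oplus> bar_pairing R \<phi> d"
    if c: "c \<in> carrier (bar_chains R G n)" and d: "d \<in> carrier (bar_chains R G n)" for c d
  proof -
    let ?S = "{xs. c xs \<noteq> \<zero>} \<union> {xs. d xs \<noteq> \<zero>}"
    have S: "finite ?S" using c d by (simp add: bar_chains_carrier)
    have car: "c xs \<in> carrier R" "d xs \<in> carrier R" for xs
      using c d by (auto simp: bar_chains_carrier)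
    have "bar_pairing R \<phi> (c \<oplus>\<^bsub>bar_chains R G n\<^esub> d) = (\<Oplus>xs\<in>?S. (c xs \<oplus> d xs) \<otimes> \<phi> xs)"
    proof (rule trans[OF bar_pairing_superset[OF C.M.a_closed[OF c d], of \<phi> ?S]])
      show "{xs. (c \<oplus>\<^bsub>bar_chains R G n\<^esub> d) xs \<noteq> \<zero>} \<subseteq> ?S"
        by (auto simp: bar_chains_ops)
    qed (use S \<phi> in \<open>auto simp: bar_chains_ops\<close>)
    also have "\<dots> = (\<Oplus>xs\<in>?S. c xs \<otimes> \<phi> xs \<oplus> d xs \<otimes> \<phi> xs)"
      using car \<phi> by (intro finsum_cong') (auto simp: l_distr)
    also have "\<dots> = (\<Oplus>xs\<in>?S. c xs \<otimes> \<phi> xs) \<oplus> (\<Oplus>xs\<in>?S. d xs \<otimes> \<phi> xs)"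
      using car \<phi> by (intro finsum_addf) auto
    also have "\<dots> = bar_pairing R \<phi> c \<oplus> bar_pairing R \<phi> d"
      using bar_pairing_superset[OF c \<phi> S] bar_pairing_superset[OF d \<phi> S] by simp
    finally show ?thesis .
  qed
  moreover have "bar_pairing R \<phi> (a \<odot>\<^bsub>bar_chains R G n\<^esub> c) = a \<otimes> bar_pairing R \<phi> c"
    if a: "a \<in> carrier R" and c: "c \<in> carrier (bar_chains R G n)" for a c
  proof -
    let ?S = "{xs. c xs \<noteq> \<zero>}"
    have S: "finite ?S" using c by (simp add: bar_chains_carrier)
    have car: "c xs \<in> carrier R" for xs using c by (auto simp: bar_chains_carrier)
    have "bar_pairing R \<phi> (a \<odot>\<^bsub>bar_chains R G n\<^esub> c) = (\<Oplus>xs\<in>?S. (a \<otimes> c xs) \<otimes> \<phi> xs)"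
    proof (rule trans[OF bar_pairing_superset[OF C.smult_closed[OF a c], of \<phi> ?S]])
      show "{xs. (a \<odot>\<^bsub>bar_chains R G n\<^esub> c) xs \<noteq> \<zero>} \<subseteq> ?S"
        using a by (auto simp: bar_chains_ops)
    qed (use S \<phi> in \<open>auto simp: bar_chains_ops\<close>)
    also have "\<dots> = (\<Oplus>xs\<in>?S. a \<otimes> (c xs \<otimes> \<phi> xs))"
      using car \<phi> a by (intro finsum_cong') (auto simp: m_assoc)
    also have "\<dots> = a \<otimes> bar_pairing R \<phi> c"
      unfolding bar_pairing_def using S a car \<phi> by (intro finsum_rdistr[symmetric]) auto
    finally show ?thesis .
  qed
  ultimately show ?thesis by (auto simp: functional_def)
qed

lemma bar_pairing_symbol:
  assumes "\<And>xs. \<phi> xs \<in> carrier R"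
  shows "bar_pairing R \<phi> (bar_symbol R xs) = \<phi> xs"
proof -
  have "{ys. bar_symbol R xs ys \<noteq> \<zero>} = {xs}" by (auto simp: bar_symbol_def)
  then have "bar_pairing R \<phi> (bar_symbol R xs) = bar_symbol R xs xs \<otimes> \<phi> xs"
    unfolding bar_pairing_def using assms by (simp add: bar_symbol_def)
  then show ?thesis using assms by (simp add: bar_symbol_def)
qed

text \<open>The symbols span the space of chains; the induction is on the support.\<close>

lemma functional_eq_on_symbols:
  assumes f: "f \<in> functional R (bar_chains R G n)" and g: "g \<in> functional R (bar_chains R G n)"
    and eq: "\<And>xs. length xs = n \<Longrightarrow> set xs \<subseteq> carrier G \<Longrightarrow> f (bar_symbol R xs) = g (bar_symbol R xs)"
    and c: "c \<in> carrier (bar_chains R G n)"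
  shows "f c = g c"
proof -
  interpret C: vectorspace R "bar_chains R G n" by (rule bar_chains_vectorspace)
  have "finite {xs. c xs \<noteq> \<zero>}" using c by (simp add: bar_chains_carrier)
  then have "\<forall>c\<in>carrier (bar_chains R G n). {xs. c xs \<noteq> \<zero>} \<subseteq> S \<longrightarrow> f c = g c"
    if "S = {xs. c xs \<noteq> \<zero>}" for S
    unfolding that
  proof (induction rule: finite_induct)
    case empty
    show ?case
    proof (intro ballI impI)
      fix c assume "c \<in> carrier (bar_chains R G n)" "{xs. c xs \<noteq> \<zero>} \<subseteq> {}"
      then have "c = \<zero>\<^bsub>bar_chains R G n\<^esub>" by (auto simp: bar_chains_ops)
      then show "f c = g c" using C.functional_zero[OF f] C.functional_zero[OF g] by simp
    qed
  next
    case (insert xs S)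
    show ?case
    proof (intro ballI impI)
      fix c assume c: "c \<in> carrier (bar_chains R G n)" and sub: "{xs. c xs \<noteq> \<zero>} \<subseteq> insert xs S"
      show "f c = g c"
      proof (cases "c xs = \<zero>")
        case True
        then have "{xs. c xs \<noteq> \<zero>} \<subseteq> S" using sub by auto
        then show ?thesis using insert c by blast
      next
        case False
        let ?d = "c(xs := \<zero>)"
        have xs: "length xs = n" "set xs \<subseteq> carrier G" and cx: "c xs \<in> carrier R"
          using c False by (auto simp: bar_chains_carrier)
        have "finite {ys. ?d ys \<noteq> \<zero>}"
          by (rule finite_subset[of _ "{ys. c ys \<noteq> \<zero>}"]) (use c in \<open>auto simp: bar_chains_carrier\<close>)
        then have d: "?d \<in> carrier (bar_chains R G n)" using c by (simp add: bar_chains_carrier)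
        have "{ys. ?d ys \<noteq> \<zero>} \<subseteq> S" using sub by auto
        then have "f ?d = g ?d" using insert d by blast
        moreover have "c = ?d \<oplus>\<^bsub>bar_chains R G n\<^esub> c xs \<odot>\<^bsub>bar_chains R G n\<^esub> bar_symbol R xs"
          using c by (auto simp: bar_chains_ops bar_symbol_def bar_chains_carrier)
        ultimately show ?thesis
          using functionalD[OF f] functionalD[OF g] d cx eq[OF xs] bar_symbol_closed[OF xs]
          by (metis C.smult_closed)
      qed
    qed
  qed
  then show ?thesis using c by blast
qed

lemma bar_sign_closed: "bar_sign R i \<in> carrier R"
  by (simp add: bar_sign_def)

text \<open>Every coefficient of the boundary is a functional of the chain, from which linearity follows.\<close>

lemma bar_boundary_as_pairing:
  assumes c: "c \<in> carrier (bar_chains R G (Suc n))"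
  shows "bar_boundary R G (Suc n) c ys =
    bar_pairing R (\<lambda>xs. \<Oplus>i\<in>{i. i \<le> Suc n \<and> bar_face G i xs = ys}. bar_sign R i) c"
proof -
  have car: "c xs \<in> carrier R" for xs using c by (auto simp: bar_chains_carrier)
  have "(\<Oplus>i\<in>{i. i \<le> Suc n \<and> bar_face G i xs = ys}. if even i then c xs else \<ominus> c xs) =
      c xs \<otimes> (\<Oplus>i\<in>{i. i \<le> Suc n \<and> bar_face G i xs = ys}. bar_sign R i)" for xs
  proof -
    have "c xs \<otimes> (\<Oplus>i\<in>{i. i \<le> Suc n \<and> bar_face G i xs = ys}. bar_sign R i) =
        (\<Oplus>i\<in>{i. i \<le> Suc n \<and> bar_face G i xs = ys}. c xs \<otimes> bar_sign R i)"
      using car bar_sign_closed by (intro finsum_rdistr) auto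
    also have "\<dots> = (\<Oplus>i\<in>{i. i \<le> Suc n \<and> bar_face G i xs = ys}. if even i then c xs else \<ominus> c xs)"
      using car by (intro finsum_cong') (auto simp: bar_sign_def r_minus)
    finally show ?thesis by simp
  qed
  then show ?thesis by (simp add: bar_boundary_def bar_pairing_def)
qed

lemma bar_sign_sum_closed: "(\<Oplus>i\<in>I. bar_sign R i) \<in> carrier R"
  by (rule finsum_closed) (simp add: bar_sign_closed)

lemma evaluation_functional: "(\<lambda>c. c ys) \<in> functional R (bar_chains R G n)"
  by (auto simp: functional_def bar_chains_carrier bar_chains_ops)

end

context group
begin

lemma length_bar_face: "i \<le> Suc n \<Longrightarrow> length xs = Suc n \<Longrightarrow> length (bar_face G i xs) = n"
  by (auto simp: bar_face_def)

lemma set_bar_face: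
  assumes "set xs \<subseteq> carrier G"
  shows "set (bar_face G i xs) \<subseteq> carrier G"
proof -
  have "xs ! (i - 1) \<otimes> xs ! i \<in> carrier G" if "i < length xs"
    using that assms by (intro m_closed) (auto simp: subset_iff)
  then show ?thesis
    using assms unfolding bar_face_def
    by (auto dest: in_set_takeD in_set_dropD in_set_butlastD list.set_sel(2) simp: subset_iff)
qed

end

lemma list_length_cases:
  "length xs = 1 \<Longrightarrow> \<exists>x. xs = [x]"
  "length xs = 2 \<Longrightarrow> \<exists>x y. xs = [x, y]"
  "length xs = 3 \<Longrightarrow> \<exists>x y z. xs = [x, y, z]"
  by (auto simp: length_Suc_conv numeral_2_eq_2 numeral_3_eq_3)

context field
begin

lemma bar_boundary_closed:
  assumes "group G" and c: "c \<in> carrier (bar_chains R G (Suc n))"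
  shows "bar_boundary R G (Suc n) c \<in> carrier (bar_chains R G n)"
proof -
  interpret G: group G by (rule assms)
  let ?e = "\<lambda>ys xs. \<Oplus>i\<in>{i. i \<le> Suc n \<and> bar_face G i xs = ys}. bar_sign R i"
  have car: "bar_boundary R G (Suc n) c ys \<in> carrier R" for ys
    unfolding bar_boundary_as_pairing[OF c]
    by (rule functionalD(1)[OF bar_pairing_functional c]) (rule bar_sign_sum_closed)
  have face: "\<exists>i xs. i \<le> Suc n \<and> c xs \<noteq> \<zero> \<and> bar_face G i xs = ys"
    if "bar_boundary R G (Suc n) c ys \<noteq> \<zero>" for ys
  proof (rule ccontr)
    assume no: "\<not> ?thesis"
    have "c xs \<otimes> ?e ys xs = \<zero>" if "c xs \<noteq> \<zero>" for xs
    proof -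
      have none: "{i. i \<le> Suc n \<and> bar_face G i xs = ys} = {}" using no that by auto
      have "c xs \<in> carrier R" using c by (simp add: bar_chains_carrier)
      then show ?thesis unfolding none by simp
    qed
    then have "bar_boundary R G (Suc n) c ys = \<zero>"
      unfolding bar_boundary_as_pairing[OF c] bar_pairing_def
      by (intro add.finprod_one_eqI) auto
    with that show False by simp
  qed
  have "{ys. bar_boundary R G (Suc n) c ys \<noteq> \<zero>} \<subseteq>
      (\<Union>i\<in>{..Suc n}. bar_face G i ` {xs. c xs \<noteq> \<zero>})"
    using face by fastforce
  moreover have "finite (\<Union>i\<in>{..Suc n}. bar_face G i ` {xs. c xs \<noteq> \<zero>})"
    using c by (simp add: bar_chains_carrier)
  ultimately have "finite {ys. bar_boundary R G (Suc n) c ys \<noteq> \<zero>}" by (rule finite_subset)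
  moreover have "length ys = n \<and> set ys \<subseteq> carrier G" if nz: "bar_boundary R G (Suc n) c ys \<noteq> \<zero>" for ys
  proof -
    obtain i xs where "i \<le> Suc n" "c xs \<noteq> \<zero>" "bar_face G i xs = ys" using face[OF nz] by blast
    moreover from this have "length xs = Suc n" "set xs \<subseteq> carrier G"
      using c by (auto simp: bar_chains_carrier)
    ultimately show ?thesis using G.length_bar_face G.set_bar_face by blast
  qed
  ultimately show ?thesis using car by (simp add: bar_chains_carrier)
qed

lemma bar_boundary_hom:
  assumes "group G"
  shows "bar_boundary R G (Suc n) \<in> module_hom R (bar_chains R G (Suc n)) (bar_chains R G n)"
proof -
  interpret C: vectorspace R "bar_chains R G (Suc n)" by (rule bar_chains_vectorspace)
  let ?e = "\<lambda>ys xs. \<Oplus>i\<in>{i. i \<le> Suc n \<and> bar_face G i xs = ys}. bar_sign R i"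
  have fn: "bar_pairing R (?e ys) \<in> functional R (bar_chains R G (Suc n))" for ys
    by (rule bar_pairing_functional) (rule bar_sign_sum_closed)
  show ?thesis
    unfolding module_hom_def
  proof (intro CollectI conjI allI impI)
    show "bar_boundary R G (Suc n) \<in> carrier (bar_chains R G (Suc n)) \<rightarrow> carrier (bar_chains R G n)"
      using bar_boundary_closed[OF assms] by blast
    fix c d assume cd: "c \<in> carrier (bar_chains R G (Suc n)) \<and> d \<in> carrier (bar_chains R G (Suc n))"
    then have "bar_boundary R G (Suc n) (c \<oplus>\<^bsub>bar_chains R G (Suc n)\<^esub> d) ys =
        bar_boundary R G (Suc n) c ys \<oplus> bar_boundary R G (Suc n) d ys" for ys
      using functionalD(2)[OF fn[of ys]] by (simp add: bar_boundary_as_pairing)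
    then show "bar_boundary R G (Suc n) (c \<oplus>\<^bsub>bar_chains R G (Suc n)\<^esub> d) =
        bar_boundary R G (Suc n) c \<oplus>\<^bsub>bar_chains R G n\<^esub> bar_boundary R G (Suc n) d"
      unfolding bar_chains_ops(2)[of R G n] by blast
  next
    fix a c assume ac: "a \<in> carrier R \<and> c \<in> carrier (bar_chains R G (Suc n))"
    then have "bar_boundary R G (Suc n) (a \<odot>\<^bsub>bar_chains R G (Suc n)\<^esub> c) ys =
        a \<otimes> bar_boundary R G (Suc n) c ys" for ys
      using functionalD(3)[OF fn[of ys]] by (simp add: bar_boundary_as_pairing)
    then show "bar_boundary R G (Suc n) (a \<odot>\<^bsub>bar_chains R G (Suc n)\<^esub> c) =
        a \<odot>\<^bsub>bar_chains R G n\<^esub> bar_boundary R G (Suc n) c"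
      unfolding bar_chains_ops(3)[of R G n] by blast
  qed
qed

lemma bar_boundary_symbol:
  assumes "group G" and xs: "length xs = Suc n" "set xs \<subseteq> carrier G"
  shows "bar_boundary R G (Suc n) (bar_symbol R xs) =
    finsum (bar_chains R G n) (\<lambda>i. bar_sign R i \<odot>\<^bsub>bar_chains R G n\<^esub> bar_symbol R (bar_face G i xs)) {..Suc n}"
    (is "_ = finsum _ ?v _")
proof
  fix ys
  interpret G: group G by (rule assms)
  interpret C: vectorspace R "bar_chains R G n" by (rule bar_chains_vectorspace)
  have v: "?v \<in> {..Suc n} \<rightarrow> carrier (bar_chains R G n)"
    using xs by (auto intro!: C.smult_closed bar_symbol_closed bar_sign_closed G.length_bar_face
        dest: subsetD[OF G.set_bar_face])
  have "bar_boundary R G (Suc n) (bar_symbol R xs) ys =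
      (\<Oplus>i\<in>{i. i \<le> Suc n \<and> bar_face G i xs = ys}. bar_sign R i)"
    using xs by (simp add: bar_boundary_as_pairing[OF bar_symbol_closed] bar_pairing_symbol bar_sign_sum_closed)
  also have "\<dots> = (\<Oplus>i\<in>{..Suc n}. ?v i ys)"
    by (intro add.finprod_mono_neutral_cong_left)
      (auto simp: bar_chains_ops bar_symbol_def bar_sign_closed)
  also have "\<dots> = finsum (bar_chains R G n) ?v {..Suc n} ys"
    using C.functional_finsum[OF evaluation_functional _ v] by simp
  finally show "bar_boundary R G (Suc n) (bar_symbol R xs) ys = finsum (bar_chains R G n) ?v {..Suc n} ys" .
qed

lemma functional_boundary_symbol:
  assumes "group G" and xs: "length xs = Suc n" "set xs \<subseteq> carrier G"
    and f: "f \<in> functional R (bar_chains R G n)"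
  shows "f (bar_boundary R G (Suc n) (bar_symbol R xs)) =
    (\<Oplus>i\<in>{..Suc n}. bar_sign R i \<otimes> f (bar_symbol R (bar_face G i xs)))"
proof -
  interpret G: group G by (rule assms)
  interpret C: vectorspace R "bar_chains R G n" by (rule bar_chains_vectorspace)
  have sym: "bar_symbol R (bar_face G i xs) \<in> carrier (bar_chains R G n)" if "i \<le> Suc n" for i
    using that xs by (intro bar_symbol_closed G.length_bar_face G.set_bar_face)
  have "f (bar_boundary R G (Suc n) (bar_symbol R xs)) =
      (\<Oplus>i\<in>{..Suc n}. f (bar_sign R i \<odot>\<^bsub>bar_chains R G n\<^esub> bar_symbol R (bar_face G i xs)))"
    unfolding bar_boundary_symbol[OF assms(1) xs]
    using sym by (intro C.functional_finsum[OF f]) (auto intro!: C.smult_closed bar_sign_closed)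
  also have "\<dots> = (\<Oplus>i\<in>{..Suc n}. bar_sign R i \<otimes> f (bar_symbol R (bar_face G i xs)))"
    using sym functionalD[OF f] bar_sign_closed by (intro finsum_cong') auto
  finally show ?thesis .
qed

lemma functional_boundary_1:
  assumes "group G" "x \<in> carrier G" and f: "f \<in> functional R (bar_chains R G 0)"
  shows "f (bar_boundary R G 1 (bar_symbol R [x])) = \<zero>"
proof -
  have car: "f (bar_symbol R []) \<in> carrier R"
    by (rule functionalD(1)[OF f]) (rule bar_symbol_closed, auto)
  show ?thesis
    using functional_boundary_symbol[OF assms(1), of "[x]" 0 f] assms car
    by (simp add: bar_face_def bar_sign_def atMost_Suc finsum_insert Pi_def l_minus l_neg)
qed

lemma functional_boundary_2:
  assumes "group G" and xy: "x \<in> carrier G" "y \<in> carrier G"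
    and f: "f \<in> functional R (bar_chains R G 1)"
  shows "f (bar_boundary R G 2 (bar_symbol R [x, y])) =
    f (bar_symbol R [y]) \<ominus> f (bar_symbol R [x \<otimes>\<^bsub>G\<^esub> y]) \<oplus> f (bar_symbol R [x])"
proof -
  interpret G: group G by (rule assms)
  have car: "f (bar_symbol R [z]) \<in> carrier R" if "z \<in> carrier G" for z
    by (rule functionalD(1)[OF f]) (rule bar_symbol_closed, use that in auto)
  show ?thesis
    using functional_boundary_symbol[OF assms(1), of "[x, y]" 1 f] f xy car
    by (simp add: bar_face_def bar_sign_def atMost_Suc finsum_insert Pi_def l_minus minus_eq
        numeral_2_eq_2 a_ac)
qed

lemma functional_boundary_3:
  assumes "group G" and xyz: "x \<in> carrier G" "y \<in> carrier G" "z \<in> carrier G"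
    and f: "f \<in> functional R (bar_chains R G 2)"
  shows "f (bar_boundary R G 3 (bar_symbol R [x, y, z])) =
    f (bar_symbol R [y, z]) \<ominus> f (bar_symbol R [x \<otimes>\<^bsub>G\<^esub> y, z]) \<oplus> f (bar_symbol R [x, y \<otimes>\<^bsub>G\<^esub> z])
      \<ominus> f (bar_symbol R [x, y])"
proof -
  interpret G: group G by (rule assms)
  have car: "f (bar_symbol R [u, v]) \<in> carrier R" if "u \<in> carrier G" "v \<in> carrier G" for u v
    by (rule functionalD(1)[OF f]) (rule bar_symbol_closed, use that in auto)
  have sgn: "bar_sign R 0 = \<one>" "bar_sign R (Suc 0) = \<ominus> \<one>" "bar_sign R (Suc (Suc 0)) = \<one>"
    "bar_sign R (Suc (Suc (Suc 0))) = \<ominus> \<one>"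
    by (simp_all add: bar_sign_def)
  show ?thesis
    using functional_boundary_symbol[OF assms(1), of "[x, y, z]" 2 f] f xyz car
    by (simp add: bar_face_def sgn atMost_Suc finsum_insert Pi_def l_minus minus_eq
        numeral_3_eq_3 numeral_2_eq_2 a_ac)
qed

lemma zero_functional: "(\<lambda>c. \<zero>) \<in> functional R V"
  by (auto simp: functional_def)

lemma bar_boundary_boundary_1:
  assumes G: "group G" and c: "c \<in> carrier (bar_chains R G 1)"
  shows "bar_boundary R G 1 c = (\<lambda>ys. \<zero>)"
proof
  fix ys
  have hom: "bar_boundary R G 1 \<in> module_hom R (bar_chains R G 1) (bar_chains R G 0)"
    using bar_boundary_hom[OF G, of 0] by simp
  have "(\<lambda>c. bar_boundary R G 1 c ys) c = (\<lambda>c. \<zero>) c"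
  proof (rule functional_eq_on_symbols[OF functional_comp_hom[OF hom evaluation_functional] zero_functional _ c])
    fix xs :: "'c list" assume "length xs = 1" "set xs \<subseteq> carrier G"
    then obtain x where "xs = [x]" "x \<in> carrier G" using list_length_cases(1)[of xs] by auto
    then show "bar_boundary R G 1 (bar_symbol R xs) ys = \<zero>"
      using functional_boundary_1[OF G _ evaluation_functional] by blast
  qed
  then show "bar_boundary R G 1 c ys = \<zero>" by simp
qed

text \<open>Coefficientwise this compares two functionals on chains, so symbols suffice. There the
  faces cancel in pairs, two of them by associativity.\<close>

lemma bar_boundary_boundary_2:
  assumes G: "group G" and c: "c \<in> carrier (bar_chains R G 3)"
  shows "bar_boundary R G 2 (bar_boundary R G 3 c) = (\<lambda>ys. \<zero>)"
proof
  fix ys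
  interpret G: group G by (rule G)
  have hom2: "bar_boundary R G 2 \<in> module_hom R (bar_chains R G 2) (bar_chains R G 1)"
    using bar_boundary_hom[OF G, of 1] by (simp add: numeral_2_eq_2)
  have hom3: "bar_boundary R G 3 \<in> module_hom R (bar_chains R G 3) (bar_chains R G 2)"
    using bar_boundary_hom[OF G, of 2] by (simp add: numeral_3_eq_3 numeral_2_eq_2)
  have h: "(\<lambda>d. bar_boundary R G 2 d ys) \<in> functional R (bar_chains R G 2)"
    by (rule functional_comp_hom[OF hom2 evaluation_functional])
  have "(\<lambda>c. bar_boundary R G 2 (bar_boundary R G 3 c) ys) c = (\<lambda>c. \<zero>) c"
  proof (rule functional_eq_on_symbols[OF functional_comp_hom[OF hom3 h] zero_functional _ c])
    fix xs :: "'c list" assume "length xs = 3" "set xs \<subseteq> carrier G"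
    then obtain x y z where xyz: "xs = [x, y, z]" "x \<in> carrier G" "y \<in> carrier G" "z \<in> carrier G"
      by (auto dest!: list_length_cases)
    have car: "bar_symbol R [z] ys \<in> carrier R" for z by (simp add: bar_symbol_def)
    have "bar_boundary R G 2 (bar_symbol R [u, v]) ys =
        bar_symbol R [v] ys \<ominus> bar_symbol R [u \<otimes>\<^bsub>G\<^esub> v] ys \<oplus> bar_symbol R [u] ys"
      if "u \<in> carrier G" "v \<in> carrier G" for u v
      using functional_boundary_2[OF G that evaluation_functional] .
    then show "bar_boundary R G 2 (bar_boundary R G 3 (bar_symbol R xs)) ys = \<zero>"
      using functional_boundary_3[OF G xyz(2-4) h] xyz car
      by (simp add: G.m_assoc) algebra
  qed
  then show "bar_boundary R G 2 (bar_boundary R G 3 c) ys = \<zero>" by simp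
qed

lemma bar_cycles_subspace:
  assumes "group G"
  shows "submodule R (carrier (bar_cycles R G (Suc n))) (bar_chains R G (Suc n))"
proof -
  interpret U: vectorspace R "bar_chains R G (Suc n)" by (rule bar_chains_vectorspace)
  interpret V: vectorspace R "bar_chains R G n" by (rule bar_chains_vectorspace)
  interpret T: mod_hom R "bar_chains R G (Suc n)" "bar_chains R G n" "bar_boundary R G (Suc n)"
    by unfold_locales (rule bar_boundary_hom[OF assms])
  have "carrier (bar_cycles R G (Suc n)) = T.ker"
    by (auto simp: bar_cycles_def T.ker_def bar_chains_ops)
  then show ?thesis using T.ker_is_submodule by simp
qed

lemma bar_cycles_eq: "bar_cycles R G n = bar_chains R G n\<lparr>carrier := carrier (bar_cycles R G n)\<rparr>"
  by (simp add: bar_cycles_def)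

lemma bar_cycles_vectorspace:
  assumes "group G"
  shows "vectorspace R (bar_cycles R G (Suc n))"
proof -
  interpret U: vectorspace R "bar_chains R G (Suc n)" by (rule bar_chains_vectorspace)
  have "subspace R (carrier (bar_cycles R G (Suc n))) (bar_chains R G (Suc n))"
    by (rule subspace.intro) (rule U.vectorspace_axioms, rule bar_cycles_subspace[OF assms])
  from U.subspace_is_vs[OF this] show ?thesis by (simp flip: bar_cycles_eq)
qed

lemma bar_boundaries_subspace:
  assumes G: "group G"
    and zero: "\<And>c. c \<in> carrier (bar_chains R G (Suc (Suc n))) \<Longrightarrow>
      bar_boundary R G (Suc n) (bar_boundary R G (Suc (Suc n)) c) = (\<lambda>ys. \<zero>)"
  shows "submodule R (bar_boundaries R G (Suc n)) (bar_cycles R G (Suc n))"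
proof -
  interpret U: vectorspace R "bar_chains R G (Suc (Suc n))" by (rule bar_chains_vectorspace)
  interpret V: vectorspace R "bar_chains R G (Suc n)" by (rule bar_chains_vectorspace)
  interpret T: mod_hom R "bar_chains R G (Suc (Suc n))" "bar_chains R G (Suc n)" "bar_boundary R G (Suc (Suc n))"
    by unfold_locales (rule bar_boundary_hom[OF assms(1)])
  have im: "bar_boundaries R G (Suc n) = T.im" by (simp add: bar_boundaries_def T.im_def)
  interpret I: submodule R T.im "bar_chains R G (Suc n)" by (rule T.im_is_submodule)
  have "T.im \<subseteq> carrier (bar_cycles R G (Suc n))"
    using zero T.f_im by (auto simp: T.im_def bar_cycles_def)
  moreover have "module R (bar_cycles R G (Suc n))"
    using bar_cycles_vectorspace[OF G] by (simp add: vectorspace_def)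
  ultimately show ?thesis
    unfolding im using I.m_closed I.zero_closed I.smult_closed
    by (intro submodule.intro) (simp_all add: bar_cycles_def)
qed

lemma functional_cycles:
  "f \<in> functional R (bar_chains R G n) \<Longrightarrow> f \<in> functional R (bar_cycles R G n)"
  by (auto simp: functional_def bar_cycles_def)

end

lemma (in vectorspace) functional_kernel_submodule:
  assumes f: "f \<in> functional K V"
  shows "submodule K {v \<in> carrier V. f v = \<zero>\<^bsub>K\<^esub>} V"
proof (rule submodule.intro)
  show "module K V" by unfold_locales
qed (use functionalD[OF f] functional_zero[OF f] in auto)


section \<open>Two-cocycles and the first two homology groups\<close>

text \<open>Values in \<open>R\<close> are demanded at all arguments, because \<open>bar_pairing\<close> takes functions on arbitrary
  lists.\<close>

definition two_cocycle :: "('c, 'r) ring_scheme \<Rightarrow> ('a, 'g) monoid_scheme \<Rightarrow> ('a \<Rightarrow> 'a \<Rightarrow> 'c) \<Rightarrow> bool" where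
  "two_cocycle R G \<phi> \<longleftrightarrow> (\<forall>x y. \<phi> x y \<in> carrier R) \<and>
    (\<forall>x\<in>carrier G. \<forall>y\<in>carrier G. \<forall>z\<in>carrier G.
      \<phi> y z \<ominus>\<^bsub>R\<^esub> \<phi> (x \<otimes>\<^bsub>G\<^esub> y) z \<oplus>\<^bsub>R\<^esub> \<phi> x (y \<otimes>\<^bsub>G\<^esub> z) \<ominus>\<^bsub>R\<^esub> \<phi> x y = \<zero>\<^bsub>R\<^esub>)"

text \<open>The entries \<open>xs ! 0\<close> and \<open>xs ! 1\<close> are meaningful on the support of a 2-chain.\<close>

definition cocycle_pairing :: "('c, 'r) ring_scheme \<Rightarrow> ('a \<Rightarrow> 'a \<Rightarrow> 'c) \<Rightarrow> ('a list \<Rightarrow> 'c) \<Rightarrow> 'c" where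
  "cocycle_pairing R \<phi> = bar_pairing R (\<lambda>xs. \<phi> (xs ! 0) (xs ! 1))"

context field
begin

lemma cocycle_pairing_functional:
  "two_cocycle R G \<phi> \<Longrightarrow> cocycle_pairing R \<phi> \<in> functional R (bar_chains R H n)"
  unfolding cocycle_pairing_def by (rule bar_pairing_functional) (simp add: two_cocycle_def)

lemma cocycle_pairing_symbol:
  "two_cocycle R G \<phi> \<Longrightarrow> cocycle_pairing R \<phi> (bar_symbol R [x, y]) = \<phi> x y"
  unfolding cocycle_pairing_def
  by (subst bar_pairing_symbol) (simp_all add: two_cocycle_def)

lemma cocycle_pairing_boundary:
  assumes G: "group G" and \<phi>: "two_cocycle R G \<phi>" and c: "c \<in> carrier (bar_chains R G 3)"
  shows "cocycle_pairing R \<phi> (bar_boundary R G 3 c) = \<zero>"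
proof -
  have hom3: "bar_boundary R G 3 \<in> module_hom R (bar_chains R G 3) (bar_chains R G 2)"
    using bar_boundary_hom[OF G, of 2] by (simp add: numeral_3_eq_3 numeral_2_eq_2)
  note f = cocycle_pairing_functional[OF \<phi>, of G 2]
  have "(\<lambda>c. cocycle_pairing R \<phi> (bar_boundary R G 3 c)) c = (\<lambda>c. \<zero>) c"
  proof (rule functional_eq_on_symbols[OF functional_comp_hom[OF hom3 f] zero_functional _ c])
    fix xs :: "'c list" assume "length xs = 3" "set xs \<subseteq> carrier G"
    then obtain x y z where xyz: "xs = [x, y, z]" "x \<in> carrier G" "y \<in> carrier G" "z \<in> carrier G"
      by (auto dest!: list_length_cases)
    show "cocycle_pairing R \<phi> (bar_boundary R G 3 (bar_symbol R xs)) = \<zero>"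
      unfolding xyz(1) functional_boundary_3[OF G xyz(2-4) f] cocycle_pairing_symbol[OF \<phi>]
      using \<phi> xyz by (simp add: two_cocycle_def)
  qed
  then show ?thesis by simp
qed

lemma group_homology_2_vectorspace:
  assumes G: "group G"
  shows "vectorspace R (bar_cycles R G 2)"
    and "submodule R (bar_boundaries R G 2) (bar_cycles R G 2)"
    and "vectorspace R (group_homology R G 2)"
proof -
  show 1: "vectorspace R (bar_cycles R G 2)"
    using bar_cycles_vectorspace[OF G, of 1] by (simp add: numeral_2_eq_2)
  show 2: "submodule R (bar_boundaries R G 2) (bar_cycles R G 2)"
    using bar_boundaries_subspace[OF G, of 1] bar_boundary_boundary_2[OF G]
    by (simp add: numeral_2_eq_2 numeral_3_eq_3)
  show "vectorspace R (group_homology R G 2)"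
    unfolding group_homology_def by (rule quotient_module_vectorspace[OF 1 2])
qed

lemma group_homology_1_vectorspace:
  assumes G: "group G"
  shows "vectorspace R (bar_cycles R G 1)"
    and "submodule R (bar_boundaries R G 1) (bar_cycles R G 1)"
    and "vectorspace R (group_homology R G 1)"
proof -
  show 1: "vectorspace R (bar_cycles R G 1)"
    using bar_cycles_vectorspace[OF G, of 0] by simp
  have "bar_boundary R G (Suc 0) (bar_boundary R G (Suc (Suc 0)) c) = (\<lambda>ys. \<zero>)"
    if "c \<in> carrier (bar_chains R G (Suc (Suc 0)))" for c
    using bar_boundary_boundary_1[OF G, of "bar_boundary R G (Suc (Suc 0)) c"]
      bar_boundary_closed[OF G that] by simp
  then show 2: "submodule R (bar_boundaries R G 1) (bar_cycles R G 1)"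
    using bar_boundaries_subspace[OF G, of 0] by simp
  show "vectorspace R (group_homology R G 1)"
    unfolding group_homology_def by (rule quotient_module_vectorspace[OF 1 2])
qed

text \<open>In concrete terms, \<open>H\<^sup>2\<close> is no larger than the dual of \<open>H\<^sub>2\<close>. The difference of the two cocycles induces
  a functional on \<open>H\<^sub>2\<close>, which vanishes if it does so on representatives \<open>Z\<close> of a spanning set. Then the
  difference vanishes on all cycles and therefore factors through the boundary map. The factor, read
  on symbols, is the cochain \<open>h\<close>.\<close>

lemma cohomologous_if_pairings_agree:
  assumes G: "group G" and fd: "vectorspace.fin_dim R (group_homology R G 2)"
  obtains Z where "finite Z" "card Z \<le> vectorspace.dim R (group_homology R G 2)"
    "Z \<subseteq> carrier (bar_cycles R G 2)"
    "\<And>\<phi> \<psi>. two_cocycle R G \<phi> \<Longrightarrow> two_cocycle R G \<psi> \<Longrightarrow>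
       (\<And>z. z \<in> Z \<Longrightarrow> cocycle_pairing R \<phi> z = cocycle_pairing R \<psi> z) \<Longrightarrow>
       \<exists>h\<in>carrier G \<rightarrow> carrier R. \<forall>x\<in>carrier G. \<forall>y\<in>carrier G.
         \<phi> x y \<ominus> \<psi> x y = h y \<ominus> h (x \<otimes>\<^bsub>G\<^esub> y) \<oplus> h x"
proof -
  note vs = group_homology_2_vectorspace[OF G]
  let ?B = "bar_boundaries R G 2" let ?Z = "bar_cycles R G 2" let ?H = "group_homology R G 2"
  interpret Z: vectorspace R ?Z by (rule vs(1))
  interpret H: vectorspace R ?H by (rule vs(3))
  let ?\<pi> = "\<lambda>z. ?B +>\<^bsub>?Z\<^esub> z"
  have hom: "?\<pi> \<in> module_hom R ?Z ?H"
    unfolding group_homology_def by (rule quotient_module_hom[OF vs(1,2)])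
  have car: "carrier ?H = ?\<pi> ` carrier ?Z"
    unfolding group_homology_def by (rule quotient_module_carrier[OF vs(1,2)])
  have ker: "z \<in> carrier ?Z \<Longrightarrow> ?\<pi> z = \<zero>\<^bsub>?H\<^esub> \<longleftrightarrow> z \<in> ?B" for z
    unfolding group_homology_def by (rule quotient_module_eq_zero_iff[OF vs(1,2)])
  have "\<exists>A. finite A \<and> card A = H.dim \<and> A \<subseteq> carrier ?H \<and> H.span A = carrier ?H"
  proof -
    from fd obtain A0 where "finite A0 \<and> card A0 = card A0 \<and> A0 \<subseteq> carrier ?H \<and> H.span A0 = carrier ?H"
      unfolding H.fin_dim_def by blast
    then have "\<exists>n A. finite A \<and> card A = n \<and> A \<subseteq> carrier ?H \<and> H.span A = carrier ?H" by blast
    then show ?thesis unfolding H.dim_def by (rule LeastI_ex)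
  qed
  then obtain A where A: "finite A" "card A = H.dim" "A \<subseteq> carrier ?H" "H.span A = carrier ?H" by blast
  define rep where "rep X = (SOME z. z \<in> carrier ?Z \<and> ?\<pi> z = X)" for X
  have rep: "rep X \<in> carrier ?Z \<and> ?\<pi> (rep X) = X" if "X \<in> A" for X
  proof -
    have "X \<in> ?\<pi> ` carrier ?Z" using that A(3) car by auto
    then show ?thesis unfolding rep_def by (intro someI_ex[of "\<lambda>z. z \<in> carrier ?Z \<and> ?\<pi> z = X"]) auto
  qed
  show ?thesis
  proof (rule that[of "rep ` A"])
    show "finite (rep ` A)" using A by simp
    show "card (rep ` A) \<le> H.dim" using A card_image_le by metis
    show "rep ` A \<subseteq> carrier ?Z" using rep by blast
    fix \<phi> \<psi> :: "'c \<Rightarrow> 'c \<Rightarrow> 'a"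
    assume \<phi>: "two_cocycle R G \<phi>" and \<psi>: "two_cocycle R G \<psi>"
      and agree: "\<And>z. z \<in> rep ` A \<Longrightarrow> cocycle_pairing R \<phi> z = cocycle_pairing R \<psi> z"
    interpret C2: vectorspace R "bar_chains R G 2" by (rule bar_chains_vectorspace)
    define f where "f = (\<lambda>c. cocycle_pairing R \<phi> c \<ominus> cocycle_pairing R \<psi> c)"
    note \<phi>f = cocycle_pairing_functional[OF \<phi>, of G 2]
    note \<psi>f = cocycle_pairing_functional[OF \<psi>, of G 2]
    have f: "f \<in> functional R (bar_chains R G 2)"
      unfolding f_def by (rule C2.functional_minus[OF \<phi>f \<psi>f])
    have fZ: "f \<in> functional R ?Z" by (rule functional_cycles[OF f])
    have "f u = \<zero>" if "u \<in> carrier ?Z" "?\<pi> u = \<zero>\<^bsub>?H\<^esub>" for u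
    proof -
      have "u \<in> ?B" using ker that by simp
      then obtain c where c: "c \<in> carrier (bar_chains R G 3)" "u = bar_boundary R G 3 c"
        by (auto simp: bar_boundaries_def numeral_3_eq_3 numeral_2_eq_2)
      then show ?thesis by (simp add: f_def cocycle_pairing_boundary[OF G] \<phi> \<psi> minus_eq)
    qed
    then obtain k where k: "k \<in> functional R ?H" "\<And>u. u \<in> carrier ?Z \<Longrightarrow> k (?\<pi> u) = f u"
      using functional_factors[OF vs(1,3) hom fZ] by blast
    have kA: "A \<subseteq> {X \<in> carrier ?H. k X = \<zero>}"
    proof
      fix X assume X: "X \<in> A"
      have "k X = f (rep X)" using k(2)[of "rep X"] rep[OF X] by simp
      also have "\<dots> = \<zero>"
        using agree[of "rep X"] X functionalD(1)[OF \<psi>f] rep[OF X]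
        by (simp add: f_def minus_eq r_neg bar_cycles_def)
      finally show "X \<in> {X \<in> carrier ?H. k X = \<zero>}" using X A(3) by blast
    qed
    have kH: "k X = \<zero>" if "X \<in> carrier ?H" for X
      using H.span_is_subset[OF kA H.functional_kernel_submodule[OF k(1)]] that A(4) by blast
    have fcyc: "f z = \<zero>" if "z \<in> carrier ?Z" for z
      using k(2)[OF that] kH[of "?\<pi> z"] car that by auto
    have hom2: "bar_boundary R G 2 \<in> module_hom R (bar_chains R G 2) (bar_chains R G 1)"
      using bar_boundary_hom[OF G, of 1] by (simp add: numeral_2_eq_2)
    have "f u = \<zero>" if "u \<in> carrier (bar_chains R G 2)" "bar_boundary R G 2 u = \<zero>\<^bsub>bar_chains R G 1\<^esub>" for u
      using that by (intro fcyc) (simp add: bar_cycles_def bar_chains_ops)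
    then obtain h where h: "h \<in> functional R (bar_chains R G 1)"
      "\<And>u. u \<in> carrier (bar_chains R G 2) \<Longrightarrow> h (bar_boundary R G 2 u) = f u"
      using functional_factors[OF bar_chains_vectorspace bar_chains_vectorspace hom2 f] by blast
    show "\<exists>h\<in>carrier G \<rightarrow> carrier R. \<forall>x\<in>carrier G. \<forall>y\<in>carrier G.
        \<phi> x y \<ominus> \<psi> x y = h y \<ominus> h (x \<otimes>\<^bsub>G\<^esub> y) \<oplus> h x"
    proof (intro bexI[of _ "\<lambda>x. h (bar_symbol R [x])"] ballI)
      fix x y assume xy: "x \<in> carrier G" "y \<in> carrier G"
      have "f (bar_symbol R [x, y]) = h (bar_boundary R G 2 (bar_symbol R [x, y]))"
        using xy by (intro h(2)[symmetric] bar_symbol_closed) auto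
      then show "\<phi> x y \<ominus> \<psi> x y =
          h (bar_symbol R [y]) \<ominus> h (bar_symbol R [x \<otimes>\<^bsub>G\<^esub> y]) \<oplus> h (bar_symbol R [x])"
        by (simp add: functional_boundary_2[OF G xy h(1)] f_def cocycle_pairing_symbol[OF \<phi>]
            cocycle_pairing_symbol[OF \<psi>])
    qed (auto intro!: functionalD(1)[OF h(1)] bar_symbol_closed)
  qed
qed

text \<open>If the classes of the symbols \<open>[s]\<close> with \<open>s \<in> S\<close> did not span \<open>H\<^sub>1\<close>, some nonzero functional on \<open>H\<^sub>1\<close>
  would vanish on them. As \<open>[y] - [x y] + [x]\<close> is a boundary, its values on symbols \<open>[x]\<close> form a
  homomorphism, which \<open>S\<close> fails to detect.\<close>

lemma homology_1_dim_le:
  assumes G: "group G" and S: "finite S" "S \<subseteq> carrier G"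
    and sep: "\<forall>f\<in>carrier G \<rightarrow> carrier R.
      (\<forall>x\<in>carrier G. \<forall>y\<in>carrier G. f (x \<otimes>\<^bsub>G\<^esub> y) = f x \<oplus> f y) \<longrightarrow>
      (\<forall>s\<in>S. f s = \<zero>) \<longrightarrow> (\<forall>x\<in>carrier G. f x = \<zero>)"
  shows "vectorspace.fin_dim R (group_homology R G 1)"
    and "vectorspace.dim R (group_homology R G 1) \<le> card S"
proof -
  note vs = group_homology_1_vectorspace[OF G]
  let ?B = "bar_boundaries R G 1" let ?Z = "bar_cycles R G 1" let ?H = "group_homology R G 1"
  interpret G: group G by (rule G)
  interpret Z: vectorspace R ?Z by (rule vs(1))
  interpret H: vectorspace R ?H by (rule vs(3))
  let ?\<pi> = "\<lambda>z. ?B +>\<^bsub>?Z\<^esub> z"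
  have hom: "?\<pi> \<in> module_hom R ?Z ?H"
    unfolding group_homology_def by (rule quotient_module_hom[OF vs(1,2)])
  have car: "carrier ?H = ?\<pi> ` carrier ?Z"
    unfolding group_homology_def by (rule quotient_module_carrier[OF vs(1,2)])
  have ker: "z \<in> carrier ?Z \<Longrightarrow> ?\<pi> z = \<zero>\<^bsub>?H\<^esub> \<longleftrightarrow> z \<in> ?B" for z
    unfolding group_homology_def by (rule quotient_module_eq_zero_iff[OF vs(1,2)])
  have cyc: "carrier ?Z = carrier (bar_chains R G 1)"
    using bar_boundary_boundary_1[OF G] by (auto simp: bar_cycles_def)
  let ?A = "(\<lambda>s. ?\<pi> (bar_symbol R [s])) ` S"
  have sym: "bar_symbol R [x] \<in> carrier ?Z" if "x \<in> carrier G" for x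
    unfolding cyc using that by (intro bar_symbol_closed) auto
  have A: "?A \<subseteq> carrier ?H" using S sym unfolding car by blast
  have span: "H.span ?A = carrier ?H"
  proof (rule ccontr)
    assume "H.span ?A \<noteq> carrier ?H"
    then obtain X where X: "X \<in> carrier ?H" "X \<notin> H.span ?A"
      using H.span_is_subset2[OF A] by blast
    obtain h where h: "h \<in> functional R ?H" "\<And>Y. Y \<in> H.span ?A \<Longrightarrow> h Y = \<zero>" "h X = \<one>"
      using H.functional_separating[OF H.span_is_submodule[OF A] X] by blast
    have F: "(\<lambda>z. h (?\<pi> z)) \<in> functional R ?Z" by (rule functional_comp_hom[OF hom h(1)])
    then have F': "(\<lambda>z. h (?\<pi> z)) \<in> functional R (bar_chains R G 1)"
    proof -
      have "?Z = bar_chains R G 1" by (rule trans[OF bar_cycles_eq]) (simp add: cyc del: One_nat_def)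
      with F show ?thesis by simp
    qed
    define f where "f x = h (?\<pi> (bar_symbol R [x]))" for x
    have f: "f \<in> carrier G \<rightarrow> carrier R"
      unfolding f_def using functionalD(1)[OF F] sym by blast
    have "f s = \<zero>" if "s \<in> S" for s
      unfolding f_def using H.in_own_span[OF A] that by (intro h(2)) blast
    moreover have "\<forall>x\<in>carrier G. \<forall>y\<in>carrier G. f (x \<otimes>\<^bsub>G\<^esub> y) = f x \<oplus> f y"
    proof (intro ballI)
      fix x y assume xy: "x \<in> carrier G" "y \<in> carrier G"
      let ?b = "bar_boundary R G 2 (bar_symbol R [x, y])"
      have "bar_symbol R [x, y] \<in> carrier (bar_chains R G 2)" using xy by (intro bar_symbol_closed) auto
      then have b: "?b \<in> ?B" by (auto simp: bar_boundaries_def numeral_2_eq_2)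
      then have "?\<pi> ?b = \<zero>\<^bsub>?H\<^esub>"
        using ker subsetD[OF LinearCombinations.submodule.subset[OF vs(2)] b] by blast
      then have "h (?\<pi> ?b) = \<zero>" using H.functional_zero[OF h(1)] by simp
      then have "f y \<ominus> f (x \<otimes>\<^bsub>G\<^esub> y) \<oplus> f x = \<zero>"
        using functional_boundary_2[OF G xy F'] by (simp add: f_def)
      moreover have "f x \<in> carrier R" "f y \<in> carrier R" "f (x \<otimes>\<^bsub>G\<^esub> y) \<in> carrier R"
        using f xy by auto
      ultimately have "f (x \<otimes>\<^bsub>G\<^esub> y) = f (x \<otimes>\<^bsub>G\<^esub> y) \<oplus> (f y \<ominus> f (x \<otimes>\<^bsub>G\<^esub> y) \<oplus> f x)" by simp
      also have "\<dots> = f x \<oplus> f y"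
        using \<open>f x \<in> carrier R\<close> \<open>f y \<in> carrier R\<close> \<open>f (x \<otimes>\<^bsub>G\<^esub> y) \<in> carrier R\<close> by algebra
      finally show "f (x \<otimes>\<^bsub>G\<^esub> y) = f x \<oplus> f y" .
    qed
    ultimately have "\<forall>x\<in>carrier G. f x = \<zero>" using sep f by blast
    then have "h (?\<pi> z) = \<zero>" if "z \<in> carrier (bar_chains R G 1)" for z
      using functional_eq_on_symbols[OF F' zero_functional _ that]
      by (metis (no_types, lifting) f_def list.set_intros(1) list_length_cases(1) subsetD)
    then show False using X(1) h(3) car cyc by auto
  qed
  have finA: "finite ?A" using S by simp
  then show "H.fin_dim" unfolding H.fin_dim_def using A span by blast
  from span have "H.dim \<le> card ?A" by (rule H.gen_ge_dim[OF finA A])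
  also have "card ?A \<le> card S" by (rule card_image_le[OF S(1)])
  finally show "H.dim \<le> card S" .
qed

end


section \<open>Cosets, finite index and subnormality\<close>

context group
begin

lemma mult_inv_mem_if_rcos_eq:
  assumes "subgroup A G" "x \<in> carrier G" "y \<in> carrier G" "A #> x = A #> y"
  shows "x \<otimes> inv y \<in> A"
proof -
  have "x \<in> A #> y" using rcos_self[OF assms(2,1)] assms(4) by simp
  then obtain a where "a \<in> A" "x = a \<otimes> y" by (auto simp: r_coset_def)
  then show ?thesis using assms by (simp add: inv_solve_right' subgroup.mem_carrier m_assoc)
qed

lemma rcos_eq_if_mult_inv_mem:
  assumes "subgroup A G" "x \<in> carrier G" "y \<in> carrier G" "x \<otimes> inv y \<in> A"
  shows "A #> x = A #> y"
proof -
  have "x = (x \<otimes> inv y) \<otimes> y" using assms by (simp add: m_assoc)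
  then have "x \<in> A #> y" using assms(4) unfolding r_coset_def by blast
  then show ?thesis using repr_independence[OF _ assms(3,1)] by simp
qed

text \<open>Equal values of \<open>F\<close> force equal cosets, so there are at most as many cosets as values. All index
  estimates below are obtained in this way.\<close>

lemma index_le_card:
  assumes U: "subgroup U G" and X: "finite X" and F: "F \<in> carrier G \<rightarrow> X"
    and sep: "\<And>x y. x \<in> carrier G \<Longrightarrow> y \<in> carrier G \<Longrightarrow> F x = F y \<Longrightarrow> x \<otimes> inv y \<in> U"
  shows "finite (rcosets U)" "card (rcosets U) \<le> card X"
proof -
  define h where "h v = U #> (SOME x. x \<in> carrier G \<and> F x = v)" for v
  have "rcosets U \<subseteq> h ` X"
  proof
    fix C assume "C \<in> rcosets U"
    then obtain x where x: "x \<in> carrier G" "C = U #> x" by (auto simp: RCOSETS_def)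
    let ?y = "SOME y. y \<in> carrier G \<and> F y = F x"
    have "?y \<in> carrier G \<and> F ?y = F x" by (rule someI[of _ x]) (use x in auto)
    then have "C = h (F x)" unfolding h_def x(2) using x by (intro rcos_eq_if_mult_inv_mem[OF U] sep) auto
    then show "C \<in> h ` X" using F x by blast
  qed
  then show "finite (rcosets U)" "card (rcosets U) \<le> card X"
    using X surj_card_le by (blast intro: finite_subset)+
qed

lemma index_Int_le:
  assumes A: "subgroup A G" "finite (rcosets A)" and B: "subgroup B G" "finite (rcosets B)"
  shows "finite (rcosets (A \<inter> B))" "card (rcosets (A \<inter> B)) \<le> card (rcosets A) * card (rcosets B)"
proof -
  have 1: "subgroup (A \<inter> B) G" using A B by (intro subgroups_Inter_pair)
  have 2: "finite ((rcosets A) \<times> (rcosets B))" using A B by simp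
  have 3: "(\<lambda>x. (A #> x, B #> x)) \<in> carrier G \<rightarrow> (rcosets A) \<times> (rcosets B)"
    using A B by (auto intro!: rcosetsI subgroup.subset)
  have 4: "x \<otimes> inv y \<in> A \<inter> B"
    if "x \<in> carrier G" "y \<in> carrier G" "(A #> x, B #> x) = (A #> y, B #> y)" for x y
    using that A B mult_inv_mem_if_rcos_eq by blast
  show "finite (rcosets (A \<inter> B))" "card (rcosets (A \<inter> B)) \<le> card (rcosets A) * card (rcosets B)"
    using index_le_card[OF 1 2 3 4] by (auto simp: card_cartesian_product)
qed

lemma rcoset_mult_closed:
  assumes "subgroup H G" "C \<in> rcosets H" "g \<in> carrier G"
  shows "C #> g \<in> rcosets H"
proof -
  obtain x where "x \<in> carrier G" "C = H #> x" using assms by (auto simp: RCOSETS_def)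
  moreover have "H \<subseteq> carrier G" using assms(1) by (rule subgroup.subset)
  ultimately show ?thesis using assms(3) by (auto simp: coset_mult_assoc intro!: rcosetsI)
qed

lemma rcosets_subset_carrier: "subgroup H G \<Longrightarrow> C \<in> rcosets H \<Longrightarrow> C \<subseteq> carrier G"
  using subgroup.rcosets_carrier is_group by blast

lemma subgroup_mem_rcosets: "subgroup H G \<Longrightarrow> H \<in> rcosets H"
  using subgroup.subgroup_in_rcosets is_group by blast

lemma rcoset_mult_one: "subgroup H G \<Longrightarrow> C \<in> rcosets H \<Longrightarrow> C #> \<one> = C"
  by (simp add: rcosets_subset_carrier)

lemma rcoset_mult_mult:
  "subgroup H G \<Longrightarrow> C \<in> rcosets H \<Longrightarrow> g \<in> carrier G \<Longrightarrow> h \<in> carrier G \<Longrightarrow> C #> g #> h = C #> (g \<otimes> h)"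
  by (simp add: coset_mult_assoc rcosets_subset_carrier)

text \<open>\<open>N\<close> is the kernel of the action on the cosets of \<open>H\<close> by right multiplication. It has finite index
  because a finite set has finitely many maps to itself, and it lies in \<open>H\<close> because it fixes the coset \<open>H\<close>.\<close>

lemma normal_core:
  assumes H: "subgroup H G" "finite (rcosets H)"
  obtains N where "N \<lhd> G" "N \<subseteq> H" "finite (rcosets N)"
proof -
  define N where "N = {g \<in> carrier G. \<forall>C\<in>rcosets H. C #> g = C}"
  note mm = rcoset_mult_mult[OF H(1)] and m1 = rcoset_mult_one[OF H(1)] and mc = rcoset_mult_closed[OF H(1)]
  have inv: "C #> inv g = C" if "g \<in> N" "C \<in> rcosets H" for g C
  proof -
    have g: "g \<in> carrier G" "C #> g = C" using that by (auto simp: N_def)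
    have "C #> g #> inv g = C" using that(2) g(1) by (simp add: mm m1)
    then show ?thesis by (simp add: g(2))
  qed
  have sub: "subgroup N G"
  proof (rule subgroupI)
    show "N \<noteq> {}" using m1 by (auto simp: N_def)
    fix g h assume gh: "g \<in> N"
    show "inv g \<in> N" using gh inv by (auto simp: N_def)
    assume "h \<in> N"
    then show "g \<otimes> h \<in> N" using gh by (auto simp: N_def simp flip: mm)
  qed (auto simp: N_def)
  have "N \<lhd> G"
  proof (rule normal_invI[OF sub])
    fix x g assume x: "x \<in> carrier G" and g: "g \<in> N"
    then have gc: "g \<in> carrier G" by (simp add: N_def)
    have "C #> (x \<otimes> g \<otimes> inv x) = C" if C: "C \<in> rcosets H" for C
    proof -
      have "C #> (x \<otimes> g \<otimes> inv x) = C #> x #> g #> inv x"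
        using C x gc mc by (simp add: mm m_assoc)
      also have "C #> x #> g = C #> x" using mc[OF C x] g by (simp add: N_def)
      also have "C #> x #> inv x = C" using C x by (simp add: mm m1)
      finally show ?thesis .
    qed
    then show "x \<otimes> g \<otimes> inv x \<in> N" using x gc by (simp add: N_def)
  qed
  moreover have "N \<subseteq> H"
  proof
    fix g assume "g \<in> N"
    then have "g \<in> carrier G" "H #> g = H" using subgroup_mem_rcosets[OF H(1)] by (auto simp: N_def)
    then show "g \<in> H" by (intro coset_join1[OF _ _ H(1)])
  qed
  moreover have "finite (rcosets N)"
  proof (rule index_le_card(1)[OF sub])
    show "finite (rcosets H \<rightarrow>\<^sub>E rcosets H)" using H(2) by (simp add: finite_PiE)
    show "(\<lambda>g. \<lambda>C\<in>rcosets H. C #> g) \<in> carrier G \<rightarrow> (rcosets H \<rightarrow>\<^sub>E rcosets H)"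
      using mc by auto
    fix x y assume xy: "x \<in> carrier G" "y \<in> carrier G"
      "(\<lambda>C\<in>rcosets H. C #> x) = (\<lambda>C\<in>rcosets H. C #> y)"
    have "C #> (x \<otimes> inv y) = C" if C: "C \<in> rcosets H" for C
    proof -
      have "C #> x = C #> y" using fun_cong[OF xy(3), of C] C by simp
      then have "C #> x #> inv y = C #> y #> inv y" by simp
      then show ?thesis using C xy by (simp add: mm m1)
    qed
    then show "x \<otimes> inv y \<in> N" using xy by (simp add: N_def)
  qed
  ultimately show ?thesis by (rule that)
qed

text \<open>The elements whose right multiplication commutes with \<open>\<beta>\<close> form a subgroup, so equivariance extends
  from the generators to \<open>G\<close>. Then \<open>\<beta>\<close> carries the stabiliser of the coset \<open>H\<close>, which is \<open>H\<close>, into the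
  stabiliser of the coset \<open>H'\<close>, which is \<open>H'\<close>.\<close>

lemma equivariant_bijection_subgroups_eq:
  assumes H: "subgroup H G" and H': "subgroup H' G" and S: "S \<subseteq> carrier G" "generate G S = carrier G"
    and \<beta>: "\<And>C. C \<in> rcosets H \<Longrightarrow> \<beta> C \<in> rcosets H'" "\<beta> H = H'"
    and eq: "\<And>C s. C \<in> rcosets H \<Longrightarrow> s \<in> S \<Longrightarrow> \<beta> (C #> s) = \<beta> C #> s"
  shows "H \<subseteq> H'"
proof -
  define E where "E = {g \<in> carrier G. \<forall>C\<in>rcosets H. \<beta> (C #> g) = \<beta> C #> g}"
  have "subgroup E G"
  proof (rule subgroupI)
    show "E \<noteq> {}"
      using rcoset_mult_one[OF H] rcoset_mult_one[OF H'] \<beta> by (auto simp: E_def intro!: exI[of _ \<one>])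
    fix g h assume g: "g \<in> E"
    then have gc: "g \<in> carrier G" by (simp add: E_def)
    have "\<beta> (C #> inv g) = \<beta> C #> inv g" if C: "C \<in> rcosets H" for C
    proof -
      have Cg: "C #> inv g \<in> rcosets H" using C gc by (simp add: rcoset_mult_closed[OF H])
      have "\<beta> C = \<beta> (C #> inv g #> g)"
        using C gc by (simp add: rcoset_mult_mult[OF H] rcoset_mult_one[OF H])
      also have "\<dots> = \<beta> (C #> inv g) #> g" using Cg g by (simp add: E_def)
      finally have "\<beta> C #> inv g = \<beta> (C #> inv g) #> g #> inv g" by simp
      also have "\<dots> = \<beta> (C #> inv g)"
        using \<beta>(1)[OF Cg] gc by (simp add: rcoset_mult_mult[OF H'] rcoset_mult_one[OF H'])
      finally show ?thesis by simp
    qed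
    then show "inv g \<in> E" using gc by (simp add: E_def)
    assume h: "h \<in> E"
    then have hc: "h \<in> carrier G" by (simp add: E_def)
    have "\<beta> (C #> (g \<otimes> h)) = \<beta> C #> (g \<otimes> h)" if C: "C \<in> rcosets H" for C
    proof -
      have Cg: "C #> g \<in> rcosets H" using C gc by (simp add: rcoset_mult_closed[OF H])
      have "\<beta> (C #> (g \<otimes> h)) = \<beta> (C #> g #> h)" using C gc hc by (simp add: rcoset_mult_mult[OF H])
      also have "\<dots> = \<beta> (C #> g) #> h" using Cg h by (simp add: E_def)
      also have "\<dots> = \<beta> C #> g #> h" using C g by (simp add: E_def)
      also have "\<dots> = \<beta> C #> (g \<otimes> h)"
        using \<beta>(1)[OF C] gc hc by (simp add: rcoset_mult_mult[OF H'])
      finally show ?thesis .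
    qed
    then show "g \<otimes> h \<in> E" using gc hc by (simp add: E_def)
  qed (auto simp: E_def)
  moreover have "S \<subseteq> E" using S eq by (auto simp: E_def)
  ultimately have E: "carrier G \<subseteq> E" using generate_subgroup_incl[of S E] S(2) by simp
  show ?thesis
  proof
    fix x assume x: "x \<in> H"
    then have xc: "x \<in> carrier G" using subgroup.mem_carrier[OF H] by simp
    have Hin: "H \<in> rcosets H" using H by (simp add: subgroup_mem_rcosets)
    have "\<beta> (H #> x) = \<beta> H #> x" using E xc Hin by (auto simp: E_def)
    moreover have "H #> x = H" by (rule coset_join2[OF xc H x])
    ultimately have "H' #> x = H'" using \<beta>(2) by simp
    then show "x \<in> H'" by (rule coset_join1[OF _ xc H'])
  qed
qed

end

text \<open>Number the cosets of \<open>H\<close>. Then \<open>H\<close> can be recovered from its own number and the table by which the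
  generators act on the numbers, and there are finitely many such tables.\<close>

lemma finite_bounded_index_subgroups:
  fixes G (structure)
  assumes "finitely_generated_group G"
  shows "finite {H. finite_index_subgroup H G \<and> card (rcosets H) \<le> n}"
proof -
  interpret group G using assms by (simp add: finitely_generated_group_def)
  obtain S where S: "finite S" "S \<subseteq> carrier G" "generate G S = carrier G"
    using assms by (auto simp: finitely_generated_group_def)
  let ?HH = "{H. finite_index_subgroup H G \<and> card (rcosets H) \<le> n}"
  have "\<forall>H\<in>?HH. \<exists>e. bij_betw e (rcosets H) {0..<card (rcosets H)}"
    using ex_bij_betw_finite_nat by (auto simp: finite_index_subgroup_def)
  then obtain e where e: "\<And>H. H \<in> ?HH \<Longrightarrow> bij_betw (e H) (rcosets H) {0..<card (rcosets H)}"
    by metis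
  \<comment> \<open>the index is part of the key, so that equal keys belong to numberings with the same range\<close>
  define key where "key H = (card (rcosets H), e H H,
    {(e H C, s, e H (C #> s)) | C s. C \<in> rcosets H \<and> s \<in> S})" for H
  have le: "H \<subseteq> H'" if H: "H \<in> ?HH" and H': "H' \<in> ?HH" and k: "key H = key H'" for H H'
  proof -
    have sub: "subgroup H G" "subgroup H' G" using H H' by (auto simp: finite_index_subgroup_def)
    let ?m = "card (rcosets H)"
    have m: "card (rcosets H') = ?m" using k by (simp add: key_def)
    define \<beta> where "\<beta> C = inv_into (rcosets H') (e H') (e H C)" for C
    have im: "e H' ` (rcosets H') = {0..<?m}" using e[OF H'] m by (simp add: bij_betw_def)
    have inj: "inj_on (e H') (rcosets H')" using e[OF H'] by (simp add: bij_betw_def)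
    have eH: "e H C \<in> e H' ` (rcosets H')" if "C \<in> rcosets H" for C
      unfolding im using e[OF H] that by (auto simp: bij_betw_def)
    have b1: "\<beta> C \<in> rcosets H'" "e H' (\<beta> C) = e H C" if "C \<in> rcosets H" for C
      unfolding \<beta>_def using inv_into_into[OF eH[OF that]] f_inv_into_f[OF eH[OF that]] by auto
    have b2: "\<beta> C = C'" if "C' \<in> rcosets H'" "e H C = e H' C'" for C C'
      unfolding \<beta>_def that(2) by (rule inv_into_f_f[OF inj that(1)])
    show ?thesis
    proof (rule equivariant_bijection_subgroups_eq[OF sub S(2,3), of \<beta>])
      show "\<beta> H = H'" using k sub by (intro b2) (auto simp: key_def subgroup_mem_rcosets)
      fix C s assume C: "C \<in> rcosets H" and s: "s \<in> S"
      have "(e H C, s, e H (C #> s)) \<in> snd (snd (key H))" using C s by (auto simp: key_def)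
      then have "(e H C, s, e H (C #> s)) \<in> snd (snd (key H'))" unfolding k .
      then obtain C' where C': "C' \<in> rcosets H'" "e H C = e H' C'" "e H (C #> s) = e H' (C' #> s)"
        by (auto simp: key_def)
      have "C' #> s \<in> rcosets H'" using rcoset_mult_closed[OF sub(2) C'(1)] s S by blast
      then have "\<beta> (C #> s) = C' #> s" using C'(3) by (rule b2)
      moreover have "\<beta> C = C'" using C'(1,2) by (rule b2)
      ultimately show "\<beta> (C #> s) = \<beta> C #> s" by simp
    qed (rule b1)
  qed
  have "inj_on key ?HH"
  proof (rule inj_onI)
    fix H H' assume "H \<in> ?HH" "H' \<in> ?HH" "key H = key H'"
    then show "H = H'" using le[of H H'] le[of H' H] by (intro subset_antisym) simp_all
  qed
  moreover have "key ` ?HH \<subseteq> {..n} \<times> {..<n} \<times> Pow ({..<n} \<times> S \<times> {..<n})"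
  proof
    fix k assume "k \<in> key ` ?HH"
    then obtain H where H: "H \<in> ?HH" "k = key H" by blast
    then have sub: "subgroup H G" and m: "card (rcosets H) \<le> n" by (auto simp: finite_index_subgroup_def)
    have "e H C < n" if "C \<in> rcosets H" for C
    proof -
      have "e H C \<in> {0..<card (rcosets H)}"
        using bij_betw_apply[OF e[OF H(1)] that] .
      then show ?thesis using m by simp
    qed
    then show "k \<in> {..n} \<times> {..<n} \<times> Pow ({..<n} \<times> S \<times> {..<n})"
      using sub m rcoset_mult_closed[OF sub] S(2)
      unfolding H(2) key_def by (auto simp: subgroup_mem_rcosets subset_iff)
  qed
  moreover have "finite ({..n} \<times> {..<n} \<times> Pow ({..<n} \<times> S \<times> {..<n}))" using S by simp
  ultimately show ?thesis by (rule inj_on_finite)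
qed

lemma subnormal_normal:
  fixes G (structure)
  assumes "N \<lhd> G"
  shows "subnormal N G"
proof -
  interpret normal N G by (rule assms)
  show ?thesis
    unfolding subnormal_def
    using assms is_subgroup subgroup_self
    by (intro exI[of _ 1] exI[of _ "\<lambda>i::nat. if i = 0 then carrier G else N"]) auto
qed

lemma subnormal_step:
  assumes G: "group G" and K: "subnormal K G" and L: "L \<lhd> G\<lparr>carrier := K\<rparr>"
  shows "subnormal L G"
proof -
  interpret group G by (rule G)
  obtain r :: nat and S where S: "S 0 = carrier G" "S r = K" "\<forall>i\<le>r. subgroup (S i) G"
    "\<forall>i<r. S (Suc i) \<lhd> G\<lparr>carrier := S i\<rparr>" using K by (auto simp: subnormal_def)
  have "subgroup K G" using S by auto
  moreover have "subgroup L (G\<lparr>carrier := K\<rparr>)" using L by (simp add: normal_imp_subgroup)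
  ultimately have sub: "subgroup L G" using incl_subgroup by blast
  let ?S = "S(Suc r := L)"
  have "?S 0 = carrier G" "?S (Suc r) = L" using S by auto
  moreover have "\<forall>i\<le>Suc r. subgroup (?S i) G" using S sub by (auto simp: le_Suc_eq)
  moreover have "\<forall>i<Suc r. ?S (Suc i) \<lhd> G\<lparr>carrier := ?S i\<rparr>" using S L by (auto simp: less_Suc_eq)
  ultimately show ?thesis unfolding subnormal_def by blast
qed


section \<open>Homomorphisms to the integers modulo a prime\<close>

text \<open>Homomorphisms to \<open>F\<^sub>p\<close> are represented by integer valued functions, to be read modulo \<open>p\<close>; linear
  combinations are then ordinary sums.\<close>

definition residue_hom :: "nat \<Rightarrow> ('a, 'g) monoid_scheme \<Rightarrow> ('a \<Rightarrow> int) \<Rightarrow> bool" where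
  "residue_hom p G f \<longleftrightarrow>
    (\<forall>x\<in>carrier G. \<forall>y\<in>carrier G. [f (x \<otimes>\<^bsub>G\<^esub> y) = f x + f y] (mod int p))"

text \<open>The homomorphisms of such a system are linearly independent, and the elements \<open>g j\<close> make this
  visible: the coefficients of a linear combination are its values at them.\<close>

definition dual_system ::
  "nat \<Rightarrow> ('a, 'g) monoid_scheme \<Rightarrow> nat \<Rightarrow> (nat \<Rightarrow> 'a \<Rightarrow> int) \<Rightarrow> (nat \<Rightarrow> 'a) \<Rightarrow> bool" where
  "dual_system p G n \<chi> g \<longleftrightarrow>
    (\<forall>i<n. residue_hom p G (\<chi> i) \<and> g i \<in> carrier G) \<and>
    (\<forall>i<n. \<forall>j<n. [\<chi> i (g j) = of_bool (i = j)] (mod int p))"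

text \<open>That the dimension of \<open>Hom(G, F\<^sub>p)\<close> is at least \<open>n\<close>. A bound is used instead of the dimension itself
  because the latter can be infinite.\<close>

definition residue_rank_ge :: "nat \<Rightarrow> ('a, 'g) monoid_scheme \<Rightarrow> nat \<Rightarrow> bool" where
  "residue_rank_ge p G n \<longleftrightarrow> (\<exists>\<chi> g. dual_system p G n \<chi> g)"

lemma residue_homD:
  "residue_hom p G f \<Longrightarrow> x \<in> carrier G \<Longrightarrow> y \<in> carrier G \<Longrightarrow> [f (x \<otimes>\<^bsub>G\<^esub> y) = f x + f y] (mod int p)"
  by (simp add: residue_hom_def)

lemma residue_hom_sum:
  assumes "\<And>i. i \<in> I \<Longrightarrow> residue_hom p G (\<chi> i)"
  shows "residue_hom p G (\<lambda>x. \<Sum>i\<in>I. c i * \<chi> i x)"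
  unfolding residue_hom_def
proof (intro ballI)
  fix x y assume "x \<in> carrier G" "y \<in> carrier G"
  then have "[(\<Sum>i\<in>I. c i * \<chi> i (x \<otimes>\<^bsub>G\<^esub> y)) = (\<Sum>i\<in>I. c i * (\<chi> i x + \<chi> i y))] (mod int p)"
    using assms by (intro cong_sum cong_mult cong_refl residue_homD)
  then show "[(\<Sum>i\<in>I. c i * \<chi> i (x \<otimes>\<^bsub>G\<^esub> y)) = (\<Sum>i\<in>I. c i * \<chi> i x) + (\<Sum>i\<in>I. c i * \<chi> i y)] (mod int p)"
    by (simp add: ring_distribs sum.distrib)
qed

lemma residue_hom_lincomb:
  assumes "residue_hom p G f" "residue_hom p G h"
  shows "residue_hom p G (\<lambda>x. a * f x + b * h x)"
  unfolding residue_hom_def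
proof (intro ballI)
  fix x y assume "x \<in> carrier G" "y \<in> carrier G"
  then have "[a * f (x \<otimes>\<^bsub>G\<^esub> y) + b * h (x \<otimes>\<^bsub>G\<^esub> y) = a * (f x + f y) + b * (h x + h y)] (mod int p)"
    using assms by (intro cong_add cong_mult cong_refl residue_homD)
  then show "[a * f (x \<otimes>\<^bsub>G\<^esub> y) + b * h (x \<otimes>\<^bsub>G\<^esub> y) = a * f x + b * h x + (a * f y + b * h y)] (mod int p)"
    by (simp add: algebra_simps)
qed

lemma (in group) residue_hom_one:
  assumes "residue_hom p G f"
  shows "[f \<one> = 0] (mod int p)"
  using residue_homD[OF assms, of \<one> \<one>] by (simp add: cong_iff_dvd_diff)

lemma (in group) residue_hom_inv:
  assumes "residue_hom p G f" "x \<in> carrier G"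
  shows "[f (inv x) = - f x] (mod int p)"
proof -
  have "[0 = f x + f (inv x)] (mod int p)"
    using residue_homD[OF assms(1,2), of "inv x"] residue_hom_one[OF assms(1)] assms(2)
    by (metis cong_sym cong_trans inv_closed r_inv)
  then have "[f (inv x) + f x = 0] (mod int p)" by (simp add: cong_sym_eq add.commute)
  then show ?thesis by (simp add: cong_iff_dvd_diff)
qed

lemma (in group) residue_hom_conj:
  assumes "residue_hom p G f" "x \<in> carrier G" "y \<in> carrier G"
  shows "[f (x \<otimes> y \<otimes> inv x) = f y] (mod int p)"
proof -
  have "[f (x \<otimes> y \<otimes> inv x) = f (x \<otimes> y) + f (inv x)] (mod int p)"
    using assms by (intro residue_homD) auto
  also have "[f (x \<otimes> y) + f (inv x) = (f x + f y) + - f x] (mod int p)"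
    using assms by (intro cong_add residue_homD residue_hom_inv)
  finally show ?thesis by simp
qed

lemma dual_systemD:
  assumes "dual_system p G n \<chi> g" "i < n"
  shows "residue_hom p G (\<chi> i)" "g i \<in> carrier G"
    "j < n \<Longrightarrow> [\<chi> i (g j) = of_bool (i = j)] (mod int p)"
  using assms by (auto simp: dual_system_def)

lemma residue_rank_ge_0: "residue_rank_ge p G 0"
  by (simp add: residue_rank_ge_def dual_system_def)

lemma residue_rank_ge_mono:
  assumes "residue_rank_ge p G n" "m \<le> n"
  shows "residue_rank_ge p G m"
proof -
  obtain \<chi> g where "dual_system p G n \<chi> g"
    using assms(1) by (auto simp: residue_rank_ge_def)
  then have "dual_system p G m \<chi> g" using \<open>m \<le> n\<close> by (simp add: dual_system_def)
  then show ?thesis by (auto simp: residue_rank_ge_def)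
qed

lemma maximal_residue_rank:
  assumes "residue_rank_ge p G n" "\<not> residue_rank_ge p G m"
  obtains r where "n \<le> r" "r < m" "residue_rank_ge p G r" "\<not> residue_rank_ge p G (Suc r)"
proof -
  have "\<exists>r<m. residue_rank_ge p G r \<and> \<not> residue_rank_ge p G (Suc r)"
    using assms(2)
  proof (induction m)
    case 0
    then show ?case using residue_rank_ge_0 by blast
  next
    case (Suc m)
    then show ?case by (cases "residue_rank_ge p G m") (auto intro: less_SucI)
  qed
  then obtain r where r: "r < m" "residue_rank_ge p G r" "\<not> residue_rank_ge p G (Suc r)" by blast
  moreover have "n \<le> r"
  proof (rule ccontr)
    assume "\<not> n \<le> r"
    then show False using residue_rank_ge_mono[OF assms(1), of "Suc r"] r(3) by simp
  qed
  ultimately show ?thesis by (intro that)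
qed

text \<open>After scaling, \<open>f x = 1\<close>. Replacing \<open>\<chi> i\<close> by \<open>\<chi> i - \<chi> i x * f\<close> makes it vanish at \<open>x\<close> and does not
  change its values at the old elements, where \<open>f\<close> vanishes.\<close>

lemma dual_system_extend:
  assumes p: "prime p" and ds: "dual_system p G n \<chi> g" and f: "residue_hom p G f"
    and 0: "\<And>i. i < n \<Longrightarrow> [f (g i) = 0] (mod int p)"
    and x: "x \<in> carrier G" "\<not> [f x = 0] (mod int p)"
  shows "residue_rank_ge p G (Suc n)"
proof -
  have "\<not> int p dvd f x" using x(2) by (simp add: cong_0_iff)
  then have "coprime (f x) (int p)"
    using p by (metis coprime_commute prime_imp_coprime prime_int_nat_transfer of_nat_0_le_iff nat_int)
  then obtain u where u: "[f x * u = 1] (mod int p)" using cong_solve_coprime_int by blast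
  \<comment> \<open>the term 0 here, and the factor 1 below, bring the functions into the form of \<open>residue_hom_lincomb\<close>\<close>
  define h where "h y = u * f y + 0 * f y" for y
  have h: "residue_hom p G h" unfolding h_def by (rule residue_hom_lincomb[OF f f])
  have hx: "[h x = 1] (mod int p)" using u by (simp add: h_def mult.commute)
  have hg: "[h (g i) = 0] (mod int p)" if "i < n" for i
    using cong_mult[OF cong_refl[of u] 0[OF that]] by (simp add: h_def)
  define \<chi>' where "\<chi>' i = (if i < n then (\<lambda>y. 1 * \<chi> i y + (- \<chi> i x) * h y) else h)" for i
  have "dual_system p G (Suc n) \<chi>' (g(n := x))"
    unfolding dual_system_def
  proof (intro conjI allI impI)
    fix i assume "i < Suc n"
    show "residue_hom p G (\<chi>' i)"
    proof (cases "i < n")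
      case True
      then show ?thesis
        unfolding \<chi>'_def if_P[OF True] by (intro residue_hom_lincomb dual_systemD(1)[OF ds] h)
    qed (simp add: \<chi>'_def h)
    show "(g(n := x)) i \<in> carrier G" using \<open>i < Suc n\<close> dual_systemD(2)[OF ds] x(1) by auto
    fix j assume "j < Suc n"
    show "[\<chi>' i ((g(n := x)) j) = of_bool (i = j)] (mod int p)"
    proof (cases "i < n")
      case i: True
      show ?thesis
      proof (cases "j < n")
        case True
        have "[1 * \<chi> i (g j) + (- \<chi> i x) * h (g j) = 1 * of_bool (i = j) + (- \<chi> i x) * 0] (mod int p)"
          using True i hg dual_systemD(3)[OF ds] by (intro cong_add cong_mult cong_refl)
        then show ?thesis using True i by (simp add: \<chi>'_def)
      next
        case False
        have "[1 * \<chi> i x + (- \<chi> i x) * h x = 1 * \<chi> i x + (- \<chi> i x) * 1] (mod int p)"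
          using hx by (intro cong_add cong_mult cong_refl)
        then show ?thesis using False i \<open>j < Suc n\<close> by (simp add: \<chi>'_def less_Suc_eq)
      qed
    next
      case False
      then show ?thesis
        using \<open>i < Suc n\<close> \<open>j < Suc n\<close> hg hx by (auto simp: \<chi>'_def less_Suc_eq)
    qed
  qed
  then show ?thesis unfolding residue_rank_ge_def by blast
qed

text \<open>The difference of the two sides vanishes at all \<open>g i\<close>, so it would extend the system if it did not
  vanish everywhere.\<close>

lemma residue_hom_spanned:
  assumes p: "prime p" and ds: "dual_system p G n \<chi> g" and max: "\<not> residue_rank_ge p G (Suc n)"
    and f: "residue_hom p G f" and x: "x \<in> carrier G"
  shows "[f x = (\<Sum>i<n. f (g i) * \<chi> i x)] (mod int p)"
proof (rule ccontr)
  assume neq: "\<not> ?thesis"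
  define s where "s y = (\<Sum>i<n. f (g i) * \<chi> i y)" for y
  have s: "residue_hom p G s"
    unfolding s_def using dual_systemD(1)[OF ds] by (intro residue_hom_sum) simp
  have "[1 * f (g j) + (- 1) * s (g j) = 0] (mod int p)" if j: "j < n" for j
  proof -
    have "[s (g j) = (\<Sum>i<n. f (g i) * of_bool (i = j))] (mod int p)"
      unfolding s_def using j dual_systemD(3)[OF ds] by (intro cong_sum cong_mult cong_refl) simp
    also have "(\<Sum>i<n. f (g i) * of_bool (i = j)) = f (g j)" using j by simp
    finally show ?thesis by (simp add: cong_iff_dvd_diff dvd_diff_commute)
  qed
  moreover have "\<not> [1 * f x + (- 1) * s x = 0] (mod int p)"
    using neq by (simp add: s_def cong_iff_dvd_diff)
  ultimately show False
    using dual_system_extend[OF p ds residue_hom_lincomb[OF f s, of 1 "- 1"] _ x] max by blast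
qed

text \<open>If the largest dual system had \<open>n < m\<close> members, then each homomorphism would be determined by its
  \<open>n\<close> values at the dual elements, and there are only \<open>p\<^sup>n\<close> possibilities for these.\<close>

lemma residue_rank_from_family:
  assumes p: "prime p" and B: "finite B" "card B \<ge> p ^ m"
    and hom: "\<And>b. b \<in> B \<Longrightarrow> residue_hom p G (f b)"
    and distinct: "\<And>a b. a \<in> B \<Longrightarrow> b \<in> B \<Longrightarrow> (\<And>x. x \<in> carrier G \<Longrightarrow> [f a x = f b x] (mod int p)) \<Longrightarrow> a = b"
  shows "residue_rank_ge p G m"
proof (rule ccontr)
  assume "\<not> residue_rank_ge p G m"
  then obtain n where n: "n < m" "residue_rank_ge p G n" "\<not> residue_rank_ge p G (Suc n)"
    using maximal_residue_rank[OF residue_rank_ge_0] by metis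
  then obtain \<chi> g where ds: "dual_system p G n \<chi> g" by (auto simp: residue_rank_ge_def)
  define v where "v b = (\<lambda>i\<in>{..<n}. f b (g i) mod int p)" for b
  have "inj_on v B"
  proof (rule inj_onI)
    fix a b assume ab: "a \<in> B" "b \<in> B" "v a = v b"
    show "a = b"
    proof (rule distinct[OF ab(1,2)])
      fix x assume x: "x \<in> carrier G"
      have "[f a (g i) = f b (g i)] (mod int p)" if "i < n" for i
        using fun_cong[OF ab(3), of i] that by (simp add: v_def cong_def)
      then have "[(\<Sum>i<n. f a (g i) * \<chi> i x) = (\<Sum>i<n. f b (g i) * \<chi> i x)] (mod int p)"
        by (intro cong_sum cong_mult cong_refl) simp
      then show "[f a x = f b x] (mod int p)"
        using residue_hom_spanned[OF p ds n(3) hom[OF ab(1)] x] residue_hom_spanned[OF p ds n(3) hom[OF ab(2)] x]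
        by (metis cong_sym cong_trans)
    qed
  qed
  moreover have "v ` B \<subseteq> {..<n} \<rightarrow>\<^sub>E {0..<int p}"
    using prime_gt_0_nat[OF p] by (simp add: v_def image_subset_iff restrict_PiE_iff)
  ultimately have "card B \<le> card ({..<n} \<rightarrow>\<^sub>E {0..<int p})"
    by (intro card_inj_on_le) (auto intro: finite_PiE)
  also have "\<dots> = p ^ n" by (simp add: card_PiE)
  also have "\<dots> < p ^ m" using n(1) prime_gt_1_nat[OF p] by (rule power_strict_increasing)
  finally show False using B(2) by simp
qed

lemma residue_field:
  assumes "prime p"
  shows "field (residue_ring (int p))"
  using residues_prime.is_field[of p] assms by (simp add: residues_prime_def)

lemma residue_ring_carrier_iff: "a \<in> carrier (residue_ring (int p)) \<longleftrightarrow> 0 \<le> a \<and> a < int p"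
  by (auto simp: residue_ring_def)

text \<open>The elements of a maximal dual system detect all homomorphisms.\<close>

lemma betti_1_le:
  fixes G :: "('a, 'g) monoid_scheme"
  assumes p: "prime p" and G: "group G" and max: "\<not> residue_rank_ge p G (Suc d)"
  shows "betti p 1 G \<le> enat d"
proof -
  let ?R = "residue_ring (int p)"
  obtain n where n: "n \<le> d" "residue_rank_ge p G n" "\<not> residue_rank_ge p G (Suc n)"
    using maximal_residue_rank[OF residue_rank_ge_0 max] by (metis less_Suc_eq_le)
  then obtain \<chi> g where ds: "dual_system p G n \<chi> g" by (auto simp: residue_rank_ge_def)
  have S: "finite (g ` {..<n})" "g ` {..<n} \<subseteq> carrier G" using dual_systemD(2)[OF ds] by auto
  have "\<forall>f\<in>carrier G \<rightarrow> carrier ?R.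
      (\<forall>x\<in>carrier G. \<forall>y\<in>carrier G. f (x \<otimes>\<^bsub>G\<^esub> y) = f x \<oplus>\<^bsub>?R\<^esub> f y) \<longrightarrow>
      (\<forall>s\<in>g ` {..<n}. f s = \<zero>\<^bsub>?R\<^esub>) \<longrightarrow> (\<forall>x\<in>carrier G. f x = \<zero>\<^bsub>?R\<^esub>)"
  proof (intro ballI impI)
    fix f x assume f: "f \<in> carrier G \<rightarrow> carrier ?R"
      and add: "\<forall>x\<in>carrier G. \<forall>y\<in>carrier G. f (x \<otimes>\<^bsub>G\<^esub> y) = f x \<oplus>\<^bsub>?R\<^esub> f y"
      and 0: "\<forall>s\<in>g ` {..<n}. f s = \<zero>\<^bsub>?R\<^esub>" and x: "x \<in> carrier G"
    have "residue_hom p G f" using add by (simp add: residue_hom_def residue_ring_def cong_def)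
    from residue_hom_spanned[OF p ds n(3) this x]
    have "[f x = (\<Sum>i<n. 0 * \<chi> i x)] (mod int p)"
      using 0 by (simp add: residue_ring_def)
    moreover have "0 \<le> f x" "f x < int p"
      using funcset_mem[OF f x] by (auto simp: residue_ring_carrier_iff)
    ultimately show "f x = \<zero>\<^bsub>?R\<^esub>" by (simp add: cong_def residue_ring_def)
  qed
  note H1 = field.homology_1_dim_le[OF residue_field[OF p] G S this]
  have "vectorspace.dim ?R (group_homology ?R G 1) \<le> card (g ` {..<n})" by (rule H1(2))
  also have "\<dots> \<le> n" using card_image_le[of "{..<n}" g] by simp
  also note n(1)
  finally show ?thesis using H1(1) by (simp add: betti_def Let_def)
qed

lemma large_fibre:
  assumes A: "finite A" and V: "finite V" "F \<in> A \<rightarrow> V" and k: "card V * k \<le> card A" "V \<noteq> {}"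
  shows "\<exists>v\<in>V. k \<le> card {a \<in> A. F a = v}"
proof (rule ccontr)
  assume no: "\<not> ?thesis"
  have "card A = (\<Sum>v\<in>V. card {a \<in> A. F a = v})"
    using sum.group[OF A V(1), of F "\<lambda>_. 1 :: nat"] V(2) by (auto simp: image_subset_iff_funcset)
  also have "\<dots> < (\<Sum>v\<in>V. k)" using no V k(2) by (intro sum_strict_mono) (auto simp: not_le)
  also have "\<dots> = card V * k" by simp
  finally show False using k(1) by simp
qed

definition residue_kernel :: "nat \<Rightarrow> ('a, 'g) monoid_scheme \<Rightarrow> nat \<Rightarrow> (nat \<Rightarrow> 'a \<Rightarrow> int) \<Rightarrow> 'a set" where
  "residue_kernel p G l \<chi> = {x \<in> carrier G. \<forall>j<l. [\<chi> j x = 0] (mod int p)}"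


section \<open>Cup products and the rank of a common kernel\<close>

text \<open>The 2-cocycle \<open>\<Sum> a\<^sub>j\<^sub>i \<chi>\<^sub>j \<union> \<chi>\<^sub>i\<close>, summed over \<open>j < l \<le> i < d\<close>.\<close>

definition cup_form ::
  "nat \<Rightarrow> nat \<Rightarrow> (nat \<Rightarrow> 'a \<Rightarrow> int) \<Rightarrow> (nat \<times> nat \<Rightarrow> int) \<Rightarrow> 'a \<Rightarrow> 'a \<Rightarrow> int" where
  "cup_form l d \<chi> a x y = (\<Sum>(j, i)\<in>{..<l} \<times> {l..<d}. a (j, i) * \<chi> j x * \<chi> i y)"

lemma cup_form_cong:
  assumes "\<And>j. j < l \<Longrightarrow> [\<chi> j x = u j] (mod m)" "\<And>i. l \<le> i \<Longrightarrow> i < d \<Longrightarrow> [\<chi> i y = w i] (mod m)"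
  shows "[cup_form l d \<chi> a x y = (\<Sum>(j, i)\<in>{..<l} \<times> {l..<d}. a (j, i) * u j * w i)] (mod m)"
  unfolding cup_form_def case_prod_beta
  using assms by (intro cong_sum cong_mult cong_refl) auto

lemma cup_form_mult_left:
  assumes "\<And>i. i < d \<Longrightarrow> residue_hom p G (\<chi> i)" "l \<le> d" "x \<in> carrier G" "x' \<in> carrier G"
  shows "[cup_form l d \<chi> a (x \<otimes>\<^bsub>G\<^esub> x') y = cup_form l d \<chi> a x y + cup_form l d \<chi> a x' y] (mod int p)"
proof -
  have "[cup_form l d \<chi> a (x \<otimes>\<^bsub>G\<^esub> x') y =
      (\<Sum>(j, i)\<in>{..<l} \<times> {l..<d}. a (j, i) * (\<chi> j x + \<chi> j x') * \<chi> i y)] (mod int p)"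
    using assms by (intro cup_form_cong residue_homD) auto
  then show ?thesis
    by (simp add: cup_form_def case_prod_beta ring_distribs sum.distrib)
qed

lemma cup_form_mult_right:
  assumes "\<And>i. i < d \<Longrightarrow> residue_hom p G (\<chi> i)" "l \<le> d" "y \<in> carrier G" "y' \<in> carrier G"
  shows "[cup_form l d \<chi> a x (y \<otimes>\<^bsub>G\<^esub> y') = cup_form l d \<chi> a x y + cup_form l d \<chi> a x y'] (mod int p)"
proof -
  have "[cup_form l d \<chi> a x (y \<otimes>\<^bsub>G\<^esub> y') =
      (\<Sum>(j, i)\<in>{..<l} \<times> {l..<d}. a (j, i) * \<chi> j x * (\<chi> i y + \<chi> i y'))] (mod int p)"
    using assms by (intro cup_form_cong residue_homD) auto
  then show ?thesis
    by (simp add: cup_form_def case_prod_beta ring_distribs sum.distrib)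
qed

lemma cup_form_kernel:
  assumes "x \<in> residue_kernel p G l \<chi>"
  shows "[cup_form l d \<chi> a x y = 0] (mod int p)"
proof -
  have "[cup_form l d \<chi> a x y = (\<Sum>(j, i)\<in>{..<l} \<times> {l..<d}. a (j, i) * 0 * \<chi> i y)] (mod int p)"
    using assms by (intro cup_form_cong) (auto simp: residue_kernel_def)
  then show ?thesis by simp
qed

lemma cup_form_dual:
  assumes ds: "dual_system p G d \<chi> g" and "j < l" "l \<le> i" "i < d"
  shows "[cup_form l d \<chi> a (g j) (g i) = a (j, i)] (mod int p)"
proof -
  have "[cup_form l d \<chi> a (g j) (g i) =
      (\<Sum>(j', i')\<in>{..<l} \<times> {l..<d}. a (j', i') * of_bool (j' = j) * of_bool (i' = i))] (mod int p)"
    using assms by (intro cup_form_cong dual_systemD(3)[OF ds]) auto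
  also have "(\<Sum>(j', i')\<in>{..<l} \<times> {l..<d}. a (j', i') * of_bool (j' = j) * of_bool (i' = i)) =
      (\<Sum>q\<in>{..<l} \<times> {l..<d}. if q = (j, i) then a q else 0)"
    by (intro sum.cong) auto
  also have "\<dots> = a (j, i)" using assms by simp
  finally show ?thesis .
qed

text \<open>Biadditive functions are 2-cocycles.\<close>

lemma cup_form_two_cocycle:
  assumes p: "prime p" and \<chi>: "\<And>i. i < d \<Longrightarrow> residue_hom p G (\<chi> i)" and l: "l \<le> d"
  shows "two_cocycle (residue_ring (int p)) G (\<lambda>x y. cup_form l d \<chi> a x y mod int p)"
proof -
  let ?R = "residue_ring (int p)"
  interpret residues "int p" ?R using prime_gt_1_nat[OF p] by (simp add: residues_def)
  let ?c = "cup_form l d \<chi> a"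
  show ?thesis
    unfolding two_cocycle_def
  proof (intro conjI allI ballI)
    fix x y z assume xyz: "x \<in> carrier G" "y \<in> carrier G" "z \<in> carrier G"
    have "[?c y z - ?c (x \<otimes>\<^bsub>G\<^esub> y) z + ?c x (y \<otimes>\<^bsub>G\<^esub> z) - ?c x y =
        ?c y z - (?c x z + ?c y z) + (?c x y + ?c x z) - ?c x y] (mod int p)"
      by (intro cong_add cong_diff cong_refl cup_form_mult_left[OF \<chi> l xyz(1,2)]
          cup_form_mult_right[OF \<chi> l xyz(2,3)])
    then have "(?c y z - ?c (x \<otimes>\<^bsub>G\<^esub> y) z + ?c x (y \<otimes>\<^bsub>G\<^esub> z) - ?c x y) mod int p = 0"
      by (simp add: cong_def)
    then show "(?c y z mod int p) \<ominus>\<^bsub>?R\<^esub> (?c (x \<otimes>\<^bsub>G\<^esub> y) z mod int p) \<oplus>\<^bsub>?R\<^esub>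
        (?c x (y \<otimes>\<^bsub>G\<^esub> z) mod int p) \<ominus>\<^bsub>?R\<^esub> (?c x y mod int p) = \<zero>\<^bsub>?R\<^esub>"
      by (simp add: a_minus_def neg_cong add_cong res_zero_eq)
  qed simp
qed

text \<open>The number of coefficient families \<open>a\<close> is \<open>p\<^bsup>l (d - l)\<^esup>\<close>, and the cocycles of \<open>a\<close> have at most \<open>p\<^sup>r\<close>
  different families of pairings with generators of \<open>H\<^sub>2\<close>. So at least \<open>p\<^sup>m\<close> families \<open>a\<close> share their pairings with
  some fixed \<open>a\<^sub>0\<close>, and for them the difference of the cocycles is the coboundary of a function \<open>h a\<close>.
  On the kernel \<open>L\<close> both cocycles vanish, so that \<open>h a\<close> restricts to a homomorphism. The restriction
  determines \<open>a\<close>: if \<open>k = h a - h b\<close> vanishes on \<open>L\<close>, then the cocycle \<open>c\<close> of \<open>a - b\<close>, which is the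
  coboundary of \<open>k\<close>, vanishes at \<open>(x y x\<inverse>, x)\<close> for \<open>y \<in> L\<close>, because its first argument is in \<open>L\<close>. This
  gives \<open>k (x y) = k x\<close>, and hence \<open>c\<close> vanishes at \<open>(x, y)\<close> as well. With \<open>x = g j\<close> and \<open>y = g i\<close> the
  coefficient at \<open>(j, i)\<close> is seen to be zero.\<close>

lemma residue_rank_kernel:
  fixes G (structure)
  assumes p: "prime p" and G: "group G" and ds: "dual_system p G d \<chi> g" and l: "l \<le> d"
    and b2: "betti p 2 G = enat r" and m: "m + r \<le> l * (d - l)"
  shows "residue_rank_ge p (G\<lparr>carrier := residue_kernel p G l \<chi>\<rparr>) m"
proof -
  interpret G: group G by (rule G)
  let ?R = "residue_ring (int p)"
  let ?L = "residue_kernel p G l \<chi>"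
  interpret residues "int p" ?R using prime_gt_1_nat[OF p] by (simp add: residues_def)
  interpret field ?R by (rule residue_field[OF p])
  have fd: "vectorspace.fin_dim ?R (group_homology ?R G 2)"
    and dim: "vectorspace.dim ?R (group_homology ?R G 2) = r"
    using b2 by (auto simp: betti_def Let_def split: if_splits)
  let ?c = "\<lambda>a x y. cup_form l d \<chi> a x y"
  let ?\<phi> = "\<lambda>a x y. cup_form l d \<chi> a x y mod int p"
  have \<chi>: "residue_hom p G (\<chi> i)" if "i < d" for i by (rule dual_systemD(1)[OF ds that])
  note coc = cup_form_two_cocycle[OF p \<chi> l]
  obtain Z where Z: "finite Z" "card Z \<le> r" "Z \<subseteq> carrier (bar_cycles ?R G 2)"
    and coh: "\<And>\<phi> \<psi>. two_cocycle ?R G \<phi> \<Longrightarrow> two_cocycle ?R G \<psi> \<Longrightarrow>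
       (\<And>z. z \<in> Z \<Longrightarrow> cocycle_pairing ?R \<phi> z = cocycle_pairing ?R \<psi> z) \<Longrightarrow>
       \<exists>h\<in>carrier G \<rightarrow> carrier ?R. \<forall>x\<in>carrier G. \<forall>y\<in>carrier G.
         \<phi> x y \<ominus>\<^bsub>?R\<^esub> \<psi> x y = h y \<ominus>\<^bsub>?R\<^esub> h (x \<otimes> y) \<oplus>\<^bsub>?R\<^esub> h x"
    using cohomologous_if_pairings_agree[OF G fd] dim by metis
  let ?A = "({..<l} \<times> {l..<d}) \<rightarrow>\<^sub>E {0..<int p}"
  let ?V = "Z \<rightarrow>\<^sub>E {0..<int p}"
  define F where "F a = (\<lambda>z\<in>Z. cocycle_pairing ?R (?\<phi> a) z)" for a
  have F: "F \<in> ?A \<rightarrow> ?V"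
  proof
    fix a assume "a \<in> ?A"
    have "cocycle_pairing ?R (?\<phi> a) z \<in> carrier ?R" if "z \<in> Z" for z
      using functionalD(1)[OF cocycle_pairing_functional[OF coc, where H = G and n = 2]] Z(3) that
      by (auto simp: bar_cycles_def)
    then show "F a \<in> ?V" by (simp add: F_def residue_ring_carrier_iff restrict_PiE_iff)
  qed
  have p0: "p > 0" using p prime_gt_0_nat by blast
  have cardA: "card ?A = p ^ (l * (d - l))" by (simp add: card_PiE card_cartesian_product)
  have cardV: "card ?V = p ^ card Z" using Z(1) by (simp add: card_PiE)
  have "card ?V * p ^ m \<le> card ?A"
    unfolding cardA cardV power_add[symmetric] using Z(2) m p0 by (intro power_increasing) auto
  moreover have "?V \<noteq> {}" using p0 by (auto simp: PiE_eq_empty_iff)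
  moreover have "finite ?A" "finite ?V" using Z(1) by (auto intro: finite_PiE)
  ultimately obtain v where v: "p ^ m \<le> card {a \<in> ?A. F a = v}"
    using large_fibre[of ?A ?V F "p ^ m"] F by blast
  let ?B = "{a \<in> ?A. F a = v}"
  have finB: "finite ?B" using \<open>finite ?A\<close> by simp
  have "?B \<noteq> {}" using v p0 by (metis card.empty not_le zero_less_power)
  then obtain a0 where a0: "a0 \<in> ?B" by blast
  have "\<exists>h. \<forall>x\<in>carrier G. \<forall>y\<in>carrier G. [?c a x y - ?c a0 x y = h y - h (x \<otimes> y) + h x] (mod int p)"
    if a: "a \<in> ?B" for a
  proof -
    have agree: "cocycle_pairing ?R (?\<phi> a) z = cocycle_pairing ?R (?\<phi> a0) z" if "z \<in> Z" for z
    proof -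
      have "F a z = F a0 z" using a a0 by simp
      then show ?thesis using that by (simp add: F_def)
    qed
    obtain h where h: "h \<in> carrier G \<rightarrow> carrier ?R"
      "\<forall>x\<in>carrier G. \<forall>y\<in>carrier G. ?\<phi> a x y \<ominus>\<^bsub>?R\<^esub> ?\<phi> a0 x y = h y \<ominus>\<^bsub>?R\<^esub> h (x \<otimes> y) \<oplus>\<^bsub>?R\<^esub> h x"
      using coh[OF coc coc agree] by blast
    have "[?c a x y - ?c a0 x y = h y - h (x \<otimes> y) + h x] (mod int p)"
      if "x \<in> carrier G" "y \<in> carrier G" for x y
    proof -
      have "(?c a x y - ?c a0 x y) mod int p = ?\<phi> a x y \<ominus>\<^bsub>?R\<^esub> ?\<phi> a0 x y"
        by (simp add: a_minus_def neg_cong add_cong)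
      also have "\<dots> = h y \<ominus>\<^bsub>?R\<^esub> h (x \<otimes> y) \<oplus>\<^bsub>?R\<^esub> h x" using h(2) that by blast
      also have "\<dots> = (h y - h (x \<otimes> y) + h x) mod int p"
        by (simp add: a_minus_def res_neg_eq res_add_eq mod_simps)
      finally show ?thesis by (simp add: cong_def)
    qed
    then show ?thesis by blast
  qed
  then have "\<exists>h. \<forall>a\<in>?B. \<forall>x\<in>carrier G. \<forall>y\<in>carrier G.
      [?c a x y - ?c a0 x y = h a y - h a (x \<otimes> y) + h a x] (mod int p)"
    by (intro bchoice ballI)
  then obtain h where h: "\<And>a x y. a \<in> ?B \<Longrightarrow> x \<in> carrier G \<Longrightarrow> y \<in> carrier G \<Longrightarrow>
      [?c a x y - ?c a0 x y = h a y - h a (x \<otimes> y) + h a x] (mod int p)"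
    by blast
  have L: "x \<in> carrier G" if "x \<in> ?L" for x using that by (simp add: residue_kernel_def)
  show ?thesis
  proof (rule residue_rank_from_family[OF p finB v, of _ h])
    fix a assume a: "a \<in> ?B"
    show "residue_hom p (G\<lparr>carrier := ?L\<rparr>) (h a)"
      unfolding residue_hom_def
    proof (intro ballI)
      fix x y assume "x \<in> carrier (G\<lparr>carrier := ?L\<rparr>)" "y \<in> carrier (G\<lparr>carrier := ?L\<rparr>)"
      then have xy: "x \<in> ?L" "y \<in> ?L" by auto
      have "[0 - 0 = ?c a x y - ?c a0 x y] (mod int p)"
        using cup_form_kernel[OF xy(1)] by (intro cong_diff) (auto simp: cong_sym_eq)
      also have "[?c a x y - ?c a0 x y = h a y - h a (x \<otimes> y) + h a x] (mod int p)"
        using h[OF a L[OF xy(1)] L[OF xy(2)]] .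
      finally show "[h a (x \<otimes>\<^bsub>G\<lparr>carrier := ?L\<rparr>\<^esub> y) = h a x + h a y] (mod int p)"
        by (simp add: cong_iff_dvd_diff algebra_simps)
    qed
  next
    fix a b assume a: "a \<in> ?B" and b: "b \<in> ?B"
      and "\<And>x. x \<in> carrier (G\<lparr>carrier := ?L\<rparr>) \<Longrightarrow> [h a x = h b x] (mod int p)"
    then have eq: "[h a x = h b x] (mod int p)" if "x \<in> ?L" for x using that by simp
    define k where "k x = h a x - h b x" for x
    have k0: "[k x = 0] (mod int p)" if "x \<in> ?L" for x
      using eq[OF that] by (simp add: k_def cong_iff_dvd_diff)
    have ck: "[?c a x y - ?c b x y = k y - k (x \<otimes> y) + k x] (mod int p)"
      if "x \<in> carrier G" "y \<in> carrier G" for x y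
      using cong_diff[OF h[OF a that] h[OF b that]] by (simp add: k_def algebra_simps)
    have c0: "[?c a x y - ?c b x y = 0] (mod int p)" if x: "x \<in> carrier G" and y: "y \<in> ?L" for x y
    proof -
      let ?y = "x \<otimes> y \<otimes> inv x"
      have yc: "y \<in> carrier G" by (rule L[OF y])
      have y': "?y \<in> ?L"
        unfolding residue_kernel_def
      proof (intro CollectI conjI allI impI)
        show "?y \<in> carrier G" using x yc by simp
        fix j assume j: "j < l"
        have "[\<chi> j ?y = \<chi> j y] (mod int p)"
          using G.residue_hom_conj[OF \<chi> x yc] j l by simp
        also have "[\<chi> j y = 0] (mod int p)" using y j by (simp add: residue_kernel_def)
        finally show "[\<chi> j ?y = 0] (mod int p)" .
      qed
      have yx: "?y \<otimes> x = x \<otimes> y" using x yc by (simp add: G.m_assoc)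
      have "[k x - k (x \<otimes> y) + k ?y = ?c a ?y x - ?c b ?y x] (mod int p)"
        using ck[OF L[OF y'] x] unfolding yx by (rule cong_sym)
      also have "[?c a ?y x - ?c b ?y x = 0 - 0] (mod int p)"
        by (intro cong_diff cup_form_kernel[OF y'])
      finally have 1: "[k x - k (x \<otimes> y) + k ?y = 0] (mod int p)" by simp
      have "[?c a x y - ?c b x y = k y - k (x \<otimes> y) + k x] (mod int p)" by (rule ck[OF x yc])
      also have "k y - k (x \<otimes> y) + k x = (k x - k (x \<otimes> y) + k ?y) - k ?y + k y" by simp
      also have "[\<dots> = 0 - 0 + 0] (mod int p)"
        by (intro cong_add cong_diff 1 k0 y y')
      finally show ?thesis by simp
    qed
    have "a q = b q" if q: "q \<in> {..<l} \<times> {l..<d}" for q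
    proof -
      obtain j i where ji: "q = (j, i)" "j < l" "l \<le> i" "i < d" using q by auto
      have "g i \<in> ?L"
        unfolding residue_kernel_def
      proof (intro CollectI conjI allI impI)
        show "g i \<in> carrier G" using dual_systemD(2)[OF ds] ji by blast
        fix j' assume j': "j' < l"
        then show "[\<chi> j' (g i) = 0] (mod int p)"
          using dual_systemD(3)[OF ds, of j' i] ji l by simp
      qed
      moreover have "g j \<in> carrier G" using dual_systemD(2)[OF ds] ji by simp
      ultimately have "[?c a (g j) (g i) - ?c b (g j) (g i) = 0] (mod int p)" using c0 by blast
      moreover have "[?c a (g j) (g i) - ?c b (g j) (g i) = a (j, i) - b (j, i)] (mod int p)"
        using ji by (intro cong_diff cup_form_dual[OF ds])
      ultimately have "[a (j, i) - b (j, i) = 0] (mod int p)" by (metis cong_sym cong_trans)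
      then have "[a q = b q] (mod int p)" by (simp add: cong_iff_dvd_diff ji(1))
      moreover have "a q \<in> {0..<int p}" "b q \<in> {0..<int p}"
        using a b q by (blast intro: PiE_mem)+
      ultimately show ?thesis by (simp add: cong_def)
    qed
    then show "a = b" using a b by (blast intro: PiE_ext)
  qed
qed


section \<open>A tower of subgroups with doubling rank\<close>

lemma (in group) residue_kernel_normal:
  assumes \<chi>: "\<And>j. j < l \<Longrightarrow> residue_hom p G (\<chi> j)"
  shows "residue_kernel p G l \<chi> \<lhd> G"
proof (rule normal_invI)
  show "subgroup (residue_kernel p G l \<chi>) G"
  proof (rule subgroupI)
    show "residue_kernel p G l \<chi> \<noteq> {}"
      using residue_hom_one[OF \<chi>] by (auto simp: residue_kernel_def)
    fix x assume "x \<in> residue_kernel p G l \<chi>"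
    then have x: "x \<in> carrier G" "\<And>j. j < l \<Longrightarrow> [\<chi> j x = 0] (mod int p)"
      by (auto simp: residue_kernel_def)
    have "[\<chi> j (inv x) = 0] (mod int p)" if "j < l" for j
      using cong_trans[OF residue_hom_inv[OF \<chi>[OF that] x(1)], of 0] x(2)[OF that] by (simp add: cong_0_iff)
    then show "inv x \<in> residue_kernel p G l \<chi>" using x(1) by (simp add: residue_kernel_def)
    fix y assume "y \<in> residue_kernel p G l \<chi>"
    then have y: "y \<in> carrier G" "\<And>j. j < l \<Longrightarrow> [\<chi> j y = 0] (mod int p)"
      by (auto simp: residue_kernel_def)
    have "[\<chi> j (x \<otimes> y) = 0] (mod int p)" if "j < l" for j
      using cong_trans[OF residue_homD[OF \<chi>[OF that] x(1) y(1)] cong_add[OF x(2)[OF that] y(2)[OF that]]]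
      by simp
    then show "x \<otimes> y \<in> residue_kernel p G l \<chi>" using x(1) y(1) by (simp add: residue_kernel_def)
  qed (auto simp: residue_kernel_def)
  fix x y assume x: "x \<in> carrier G" and "y \<in> residue_kernel p G l \<chi>"
  then have y: "y \<in> carrier G" "\<And>j. j < l \<Longrightarrow> [\<chi> j y = 0] (mod int p)"
    by (auto simp: residue_kernel_def)
  have "[\<chi> j (x \<otimes> y \<otimes> inv x) = 0] (mod int p)" if "j < l" for j
    using cong_trans[OF residue_hom_conj[OF \<chi>[OF that] x y(1)] y(2)[OF that]] .
  then show "x \<otimes> y \<otimes> inv x \<in> residue_kernel p G l \<chi>"
    using x y(1) by (simp add: residue_kernel_def)
qed

text \<open>A coset of \<open>K\<close> is determined by the coset of \<open>H\<close> that contains it, together with the residues of all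
  \<open>\<chi> j\<close> at the displacement from a fixed representative of that coset.\<close>

lemma (in group) residue_kernel_index:
  assumes H: "subgroup H G" "finite (rcosets H)" and p: "p > 0"
    and \<chi>: "\<And>j. j < l \<Longrightarrow> residue_hom p (G\<lparr>carrier := H\<rparr>) (\<chi> j)"
  defines "K \<equiv> residue_kernel p (G\<lparr>carrier := H\<rparr>) l \<chi>"
  shows "K \<lhd> G\<lparr>carrier := H\<rparr>" "subgroup K G" "finite (rcosets K)"
    "card (rcosets K) \<le> card (rcosets H) * p ^ l"
proof -
  interpret H: group "G\<lparr>carrier := H\<rparr>" using subgroup_imp_group[OF H(1)] .
  show normal: "K \<lhd> G\<lparr>carrier := H\<rparr>" unfolding K_def by (rule H.residue_kernel_normal[OF \<chi>])
  show sub: "subgroup K G" using incl_subgroup[OF H(1)] normal_imp_subgroup[OF normal] by blast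
  define t where "t C = (SOME x. x \<in> C)" for C :: "'a set"
  have t: "t (H #> x) \<in> carrier G" "x \<otimes> inv (t (H #> x)) \<in> H" if x: "x \<in> carrier G" for x
  proof -
    have "t (H #> x) \<in> H #> x" unfolding t_def by (rule someI[of _ x]) (rule rcos_self[OF x H(1)])
    then obtain h where h: "h \<in> H" "t (H #> x) = h \<otimes> x" by (auto simp: r_coset_def)
    have hc: "h \<in> carrier G" using h(1) subgroup.mem_carrier[OF H(1)] by blast
    show "t (H #> x) \<in> carrier G" using h hc x by simp
    have "x \<otimes> inv (h \<otimes> x) = inv h" using hc x by (simp add: inv_mult_group m_assoc[symmetric])
    then show "x \<otimes> inv (t (H #> x)) \<in> H" unfolding h(2) using h(1) H(1) by (simp add: subgroup.m_inv_closed)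
  qed
  define F where "F x = (H #> x, \<lambda>j\<in>{..<l}. \<chi> j (x \<otimes> inv (t (H #> x))) mod int p)" for x
  let ?X = "(rcosets H) \<times> ({..<l} \<rightarrow>\<^sub>E {0..<int p})"
  have X: "finite ?X" using H(2) by (auto intro: finite_PiE)
  have FX: "F \<in> carrier G \<rightarrow> ?X"
    using p subgroup.subset[OF H(1)] by (auto simp: F_def restrict_PiE_iff intro!: rcosetsI)
  have sep: "x \<otimes> inv y \<in> K" if x: "x \<in> carrier G" and y: "y \<in> carrier G" and eq: "F x = F y" for x y
  proof -
    have coset: "H #> x = H #> y" using eq by (simp add: F_def)
    let ?t = "t (H #> x)"
    let ?u = "x \<otimes> inv ?t" and ?v = "y \<otimes> inv ?t"
    have tc: "?t \<in> carrier G" using t(1)[OF x] .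
    have u: "?u \<in> H" using t(2)[OF x] .
    have v: "?v \<in> H" using t(2)[OF y] coset by simp
    have w: "x \<otimes> inv y \<in> H" by (rule mult_inv_mem_if_rcos_eq[OF H(1) x y coset])
    have uw: "?u = (x \<otimes> inv y) \<otimes> ?v" using x y tc by (simp add: m_assoc[symmetric]) (simp add: m_assoc)
    have "[\<chi> j (x \<otimes> inv y) = 0] (mod int p)" if j: "j < l" for j
    proof -
      have "snd (F x) j = snd (F y) j" using eq by simp
      then have "[\<chi> j ?u = \<chi> j ?v] (mod int p)" using j coset by (simp add: F_def cong_def)
      moreover have "[\<chi> j ?u = \<chi> j (x \<otimes> inv y) + \<chi> j ?v] (mod int p)"
        using residue_homD[OF \<chi>[OF j], of "x \<otimes> inv y" ?v] w v uw by simp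
      ultimately have "[\<chi> j (x \<otimes> inv y) + \<chi> j ?v = 0 + \<chi> j ?v] (mod int p)"
        by (simp add: cong_def)
      then show ?thesis by (simp only: cong_add_rcancel)
    qed
    then show ?thesis using w by (simp add: K_def residue_kernel_def)
  qed
  show "finite (rcosets K)" by (rule index_le_card(1)[OF sub X FX sep])
  have "card (rcosets K) \<le> card ?X" by (rule index_le_card(2)[OF sub X FX sep])
  then show "card (rcosets K) \<le> card (rcosets H) * p ^ l"
    by (simp add: card_cartesian_product card_PiE)
qed

lemma (in group) normal_Int_restrict:
  assumes H: "subgroup H G" and N: "subgroup N G" and K: "K \<lhd> G\<lparr>carrier := H\<rparr>"
  shows "N \<inter> K \<lhd> G\<lparr>carrier := N \<inter> H\<rparr>"
proof -
  have NH: "subgroup (N \<inter> H) G" using N H by (rule subgroups_Inter_pair)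
  have K': "subgroup K (G\<lparr>carrier := H\<rparr>)" using K by (rule normal_imp_subgroup)
  have KH: "K \<subseteq> H" using subgroup.subset[OF K'] by simp
  have KG: "subgroup K G" using incl_subgroup[OF H K'] .
  interpret NH: group "G\<lparr>carrier := N \<inter> H\<rparr>" using subgroup_imp_group[OF NH] .
  show ?thesis
  proof (rule NH.normal_invI)
    show "subgroup (N \<inter> K) (G\<lparr>carrier := N \<inter> H\<rparr>)"
      using KH by (intro subgroup_incl[OF subgroups_Inter_pair[OF N KG] NH]) auto
    fix x y assume "x \<in> carrier (G\<lparr>carrier := N \<inter> H\<rparr>)" and y: "y \<in> N \<inter> K"
    then have x: "x \<in> N" "x \<in> H" by auto
    have inv: "inv\<^bsub>G\<lparr>carrier := N \<inter> H\<rparr>\<^esub> x = inv x" using x by (intro m_inv_consistent[OF NH]) auto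
    have invH: "inv\<^bsub>G\<lparr>carrier := H\<rparr>\<^esub> x = inv x" using x by (intro m_inv_consistent[OF H]) auto
    have "x \<otimes> y \<otimes> inv x \<in> N"
      using x y by (intro subgroup.m_closed[OF N] subgroup.m_inv_closed[OF N]) auto
    moreover have "x \<otimes> y \<otimes> inv x \<in> K"
      using normal.inv_op_closed2[OF K, of x y] x y invH by simp
    ultimately show "x \<otimes>\<^bsub>G\<lparr>carrier := N \<inter> H\<rparr>\<^esub> y \<otimes>\<^bsub>G\<lparr>carrier := N \<inter> H\<rparr>\<^esub> inv\<^bsub>G\<lparr>carrier := N \<inter> H\<rparr>\<^esub> x \<in> N \<inter> K"
      using inv by simp
  qed
qed

text \<open>In a dual system on \<open>H\<close>, the kernels of the \<open>\<chi> i\<close> are different from each other, since the kernel of \<open>\<chi> i\<close>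
  contains \<open>g j\<close> exactly if \<open>i \<noteq> j\<close>. They have bounded index in \<open>G\<close>, so there are finitely many of them.\<close>

lemma residue_rank_bounded:
  fixes G (structure)
  assumes fg: "finitely_generated_group G" and p: "prime p" and H: "finite_index_subgroup H G"
  shows "\<exists>n. \<not> residue_rank_ge p (G\<lparr>carrier := H\<rparr>) n"
proof -
  interpret group G using fg by (simp add: finitely_generated_group_def)
  have H': "subgroup H G" "finite (rcosets H)" using H by (auto simp: finite_index_subgroup_def)
  have p0: "p > 0" using p prime_gt_0_nat by blast
  let ?S = "{K. finite_index_subgroup K G \<and> card (rcosets K) \<le> card (rcosets H) * p}"
  have fin: "finite ?S" by (rule finite_bounded_index_subgroups[OF fg])
  have "n \<le> card ?S" if rk: "residue_rank_ge p (G\<lparr>carrier := H\<rparr>) n" for n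
  proof -
    obtain \<chi> g where ds: "dual_system p (G\<lparr>carrier := H\<rparr>) n \<chi> g"
      using rk by (auto simp: residue_rank_ge_def)
    define k where "k i = residue_kernel p (G\<lparr>carrier := H\<rparr>) 1 (\<lambda>_. \<chi> i)" for i
    have mem: "g j \<in> k i \<longleftrightarrow> i \<noteq> j" if "i < n" "j < n" for i j
    proof -
      have "[\<chi> i (g j) = 0] (mod int p) \<longleftrightarrow> [of_bool (i = j) = (0 :: int)] (mod int p)"
        using dual_systemD(3)[OF ds that] by (metis cong_sym cong_trans)
      also have "\<dots> \<longleftrightarrow> i \<noteq> j" using prime_gt_1_nat[OF p] by (auto simp: cong_0_iff)
      finally show ?thesis using dual_systemD(2)[OF ds that(2)] by (simp add: k_def residue_kernel_def)
    qed
    have "inj_on k {..<n}"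
    proof (rule inj_onI)
      fix i j assume "i \<in> {..<n}" "j \<in> {..<n}" "k i = k j"
      then show "i = j" using mem[of i j] mem[of j j] by auto
    qed
    moreover have "k ` {..<n} \<subseteq> ?S"
    proof
      fix K assume "K \<in> k ` {..<n}"
      then obtain i where i: "i < n" "K = k i" by blast
      have \<chi>i: "residue_hom p (G\<lparr>carrier := H\<rparr>) (\<chi> i)" by (rule dual_systemD(1)[OF ds i(1)])
      show "K \<in> ?S"
        using residue_kernel_index(2-4)[where l = 1 and \<chi> = "\<lambda>_. \<chi> i", OF H' p0 \<chi>i] unfolding i(2) k_def
        by (simp add: finite_index_subgroup_def)
    qed
    ultimately have "card {..<n} \<le> card ?S" using fin by (rule card_inj_on_le)
    then show ?thesis by simp
  qed
  from this[of "Suc (card ?S)"] show ?thesis by (intro exI[of _ "Suc (card ?S)"]) auto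
qed

text \<open>A bound on the rank makes \<open>b\<^sub>1\<close> finite, so the quotient in the \<open>b\<^sub>2/b\<^sub>1\<close> property has a finite
  denominator and the property becomes an inequality between natural numbers.\<close>

lemma b2_le_of_b2_b1_property:
  fixes G (structure)
  assumes G: "group G" and p: "prime p" and b2b1: "b2_b1_property p G"
  obtains C :: nat where "\<And>H n. finite_index_subgroup H G \<Longrightarrow>
    \<not> residue_rank_ge p (G\<lparr>carrier := H\<rparr>) (Suc n) \<Longrightarrow>
    \<exists>r\<le>C * (n + 1). betti p 2 (G\<lparr>carrier := H\<rparr>) = enat r"
proof -
  interpret group G by (rule G)
  obtain C0 :: real where C0: "\<And>H. finite_index_subgroup H G \<Longrightarrow>
      ereal_of_enat (betti p 2 (G\<lparr>carrier := H\<rparr>)) / (ereal_of_enat (betti p 1 (G\<lparr>carrier := H\<rparr>)) + 1) \<le> ereal C0"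
    using b2b1 by (auto simp: b2_b1_property_def)
  define C where "C = nat \<lceil>C0\<rceil>"
  have C: "C0 \<le> real C" unfolding C_def by linarith
  show ?thesis
  proof (rule that[of C])
    fix H n assume H: "finite_index_subgroup H G" and rk: "\<not> residue_rank_ge p (G\<lparr>carrier := H\<rparr>) (Suc n)"
    have "group (G\<lparr>carrier := H\<rparr>)"
      using H subgroup_imp_group by (auto simp: finite_index_subgroup_def)
    from betti_1_le[OF p this rk] obtain b where b: "betti p 1 (G\<lparr>carrier := H\<rparr>) = enat b" "b \<le> n"
      by (cases "betti p 1 (G\<lparr>carrier := H\<rparr>)") auto
    have den: "ereal_of_enat (betti p 1 (G\<lparr>carrier := H\<rparr>)) + 1 = ereal (real b + 1)"
      by (simp add: b one_ereal_def del: One_nat_def)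
    show "\<exists>r\<le>C * (n + 1). betti p 2 (G\<lparr>carrier := H\<rparr>) = enat r"
    proof (cases "betti p 2 (G\<lparr>carrier := H\<rparr>)")
      case (enat r)
      have "real r / (real b + 1) \<le> C0"
        using C0[OF H] unfolding den enat by simp
      then have "real r \<le> C0 * (real b + 1)" by (simp add: field_simps)
      also have "\<dots> \<le> real C * (real n + 1)"
        using C b(2) by (intro mult_mono) auto
      finally have "real r \<le> real (C * (n + 1))" by (simp add: algebra_simps)
      then have "r \<le> C * (n + 1)" by (simp only: of_nat_le_iff)
      then show ?thesis using enat by blast
    next
      case infinity
      then show ?thesis using C0[OF H] unfolding den infinity by simp
    qed
  qed
qed

text \<open>With \<open>d\<close> the exact rank of \<open>H\<close> and \<open>l = C + 3\<close>, the rank of the common kernel of \<open>l\<close> members of a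
  maximal dual system is at least \<open>l (d - l) - C (d + 1) = 3 d - l\<^sup>2 - C\<close>. The lower bound on \<open>n\<close> makes
  this at least \<open>2 d\<close>.\<close>

lemma rank_doubling:
  fixes G (structure)
  assumes fg: "finitely_generated_group G" and p: "prime p" and H: "finite_index_subgroup H G"
    and C: "\<And>H n. finite_index_subgroup H G \<Longrightarrow> \<not> residue_rank_ge p (G\<lparr>carrier := H\<rparr>) (Suc n) \<Longrightarrow>
      \<exists>r\<le>C * (n + 1). betti p 2 (G\<lparr>carrier := H\<rparr>) = enat r"
    and n: "residue_rank_ge p (G\<lparr>carrier := H\<rparr>) n" "C + (C + 3) * (C + 3) \<le> n"
  shows "\<exists>K. K \<lhd> G\<lparr>carrier := H\<rparr> \<and> finite_index_subgroup K G \<and>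
    card (rcosets K) \<le> card (rcosets H) * p ^ (C + 3) \<and> residue_rank_ge p (G\<lparr>carrier := K\<rparr>) (2 * n)"
proof -
  interpret group G using fg by (simp add: finitely_generated_group_def)
  have H': "subgroup H G" "finite (rcosets H)" using H by (auto simp: finite_index_subgroup_def)
  obtain d where d: "n \<le> d" "residue_rank_ge p (G\<lparr>carrier := H\<rparr>) d"
    "\<not> residue_rank_ge p (G\<lparr>carrier := H\<rparr>) (Suc d)"
    using residue_rank_bounded[OF fg p H] maximal_residue_rank[OF n(1)] by metis
  obtain \<chi> g where ds: "dual_system p (G\<lparr>carrier := H\<rparr>) d \<chi> g"
    using d(2) by (auto simp: residue_rank_ge_def)
  obtain r where r: "r \<le> C * (d + 1)" "betti p 2 (G\<lparr>carrier := H\<rparr>) = enat r" using C[OF H d(3)] by blast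
  let ?l = "C + 3"
  let ?K = "residue_kernel p (G\<lparr>carrier := H\<rparr>) ?l \<chi>"
  have dl: "C + ?l * ?l \<le> d" using n(2) d(1) by simp
  have ld: "?l \<le> d" using dl by (metis add_leD2 le_square le_trans)
  have "2 * d + r \<le> ?l * (d - ?l)"
  proof -
    have "2 * d + C * (d + 1) + ?l * ?l \<le> ?l * d" using dl by (simp add: algebra_simps)
    then show ?thesis using r(1) by (simp only: diff_mult_distrib2)
  qed
  then have "residue_rank_ge p (G\<lparr>carrier := H, carrier := ?K\<rparr>) (2 * d)"
    using residue_rank_kernel[OF p subgroup_imp_group[OF H'(1)] ds ld r(2)] by simp
  then have rk: "residue_rank_ge p (G\<lparr>carrier := ?K\<rparr>) (2 * n)"
    using residue_rank_ge_mono[of p _ "2 * d" "2 * n"] d(1) by simp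
  have p0: "p > 0" using p prime_gt_0_nat by blast
  have \<chi>: "residue_hom p (G\<lparr>carrier := H\<rparr>) (\<chi> j)" if "j < ?l" for j
    using dual_systemD(1)[OF ds] that ld by simp
  note K = residue_kernel_index[OF H' p0 \<chi>]
  show ?thesis
    using K rk by (intro exI[of _ ?K]) (simp add: finite_index_subgroup_def)
qed

text \<open>The groups of the tower may fail to be subnormal, because \<open>H\<close> may. Their intersections with \<open>N\<close> form
  a subnormal chain that starts with \<open>N\<close> itself.\<close>

lemma rank_tower:
  fixes G (structure)
  assumes fg: "finitely_generated_group G" and p: "prime p" and H: "finite_index_subgroup H G"
    and C: "\<And>H n. finite_index_subgroup H G \<Longrightarrow> \<not> residue_rank_ge p (G\<lparr>carrier := H\<rparr>) (Suc n) \<Longrightarrow>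
      \<exists>r\<le>C * (n + 1). betti p 2 (G\<lparr>carrier := H\<rparr>) = enat r"
    and n: "residue_rank_ge p (G\<lparr>carrier := H\<rparr>) n" "C + (C + 3) * (C + 3) \<le> n"
    and N: "N \<lhd> G" "N \<subseteq> H"
  shows "\<exists>K. finite_index_subgroup K G \<and> card (rcosets K) \<le> card (rcosets H) * (p ^ (C + 3)) ^ i \<and>
    residue_rank_ge p (G\<lparr>carrier := K\<rparr>) (2 ^ i * n) \<and> subnormal (N \<inter> K) G"
proof (induction i)
  case 0
  have "N \<inter> H = N" using N(2) by blast
  then show ?case using H n(1) subnormal_normal[OF N(1)] by (intro exI[of _ H]) simp
next
  case (Suc i)
  interpret group G using fg by (simp add: finitely_generated_group_def)
  obtain K where K: "finite_index_subgroup K G" "card (rcosets K) \<le> card (rcosets H) * (p ^ (C + 3)) ^ i"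
    "residue_rank_ge p (G\<lparr>carrier := K\<rparr>) (2 ^ i * n)" "subnormal (N \<inter> K) G" using Suc.IH by blast
  have "C + (C + 3) * (C + 3) \<le> 2 ^ i * n"
    using n(2) by (rule order_trans) simp
  from rank_doubling[OF fg p K(1) C K(3) this]
  obtain L where L: "L \<lhd> G\<lparr>carrier := K\<rparr>" "finite_index_subgroup L G"
    "card (rcosets L) \<le> card (rcosets K) * p ^ (C + 3)" "residue_rank_ge p (G\<lparr>carrier := L\<rparr>) (2 * (2 ^ i * n))"
    by blast
  have "card (rcosets L) \<le> card (rcosets H) * (p ^ (C + 3)) ^ i * p ^ (C + 3)"
    using L(3) K(2) by (meson le_trans mult_le_mono1)
  moreover have "subnormal (N \<inter> L) G"
    using subnormal_step[OF is_group K(4)] normal_Int_restrict[OF _ normal_imp_subgroup[OF N(1)] L(1)] K(1)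
    by (auto simp: finite_index_subgroup_def)
  ultimately show ?case using L by (intro exI[of _ L]) (simp add: mult_ac)
qed


section \<open>Counting subnormal subgroups\<close>

text \<open>The \<open>p\<^sup>n\<close> combinations \<open>f a\<close> of a dual system on \<open>H\<close> give the subgroups \<open>U a = N \<inter> ker (f a)\<close>, and it
  remains to bound how many \<open>a\<close> give the same \<open>U a = V\<close>. Elements of \<open>H\<close> with the same coset of \<open>N\<close> and the
  same residue under one such \<open>f a\<^sub>0\<close> differ by an element of \<open>V\<close>, so each of the other \<open>f a\<close> takes the
  same residue at both. Therefore \<open>f a\<close> is given by a function from \<open>[G : N] p\<close> places to residues, and
  this bound does not involve \<open>H\<close>.\<close>

lemma subnormal_count_ge:
  fixes G (structure)
  assumes fg: "finitely_generated_group G" and p: "prime p" and H: "finite_index_subgroup H G"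
    and rk: "residue_rank_ge p (G\<lparr>carrier := H\<rparr>) n"
    and N: "N \<lhd> G" "finite (rcosets N)" and sn: "subnormal (N \<inter> H) G"
    and m: "card (rcosets N) * (card (rcosets H) * p) \<le> m"
  shows "p ^ n \<le> subnormal_subgroup_count G m * p ^ (card (rcosets N) * p)"
proof -
  interpret group G using fg by (simp add: finitely_generated_group_def)
  have H': "subgroup H G" "finite (rcosets H)" using H by (auto simp: finite_index_subgroup_def)
  have N': "subgroup N G" using N(1) by (rule normal_imp_subgroup)
  have p0: "p > 0" using p prime_gt_0_nat by blast
  obtain \<chi> g where ds: "dual_system p (G\<lparr>carrier := H\<rparr>) n \<chi> g"
    using rk by (auto simp: residue_rank_ge_def)
  let ?A = "{..<n} \<rightarrow>\<^sub>E {0..<int p}"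
  define f where "f a x = (\<Sum>i\<in>{..<n}. a i * \<chi> i x)" for a x
  define U where "U a = N \<inter> residue_kernel p (G\<lparr>carrier := H\<rparr>) 1 (\<lambda>_. f a)" for a
  let ?S = "{K. finite_index_subgroup K G \<and> subnormal K G \<and> card (rcosets K) \<le> m}"
  have finS: "finite ?S"
    by (rule finite_subset[OF _ finite_bounded_index_subgroups[OF fg, of m]]) blast
  have finA: "finite ?A" by (auto intro: finite_PiE)
  have hom: "residue_hom p (G\<lparr>carrier := H\<rparr>) (f a)" for a
    unfolding f_def using dual_systemD(1)[OF ds] by (intro residue_hom_sum) simp
  have fg_eq: "[f a (g j) = a j] (mod int p)" if "j < n" for a j
  proof -
    have "[f a (g j) = (\<Sum>i\<in>{..<n}. a i * of_bool (i = j))] (mod int p)"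
      unfolding f_def using that by (intro cong_sum cong_mult cong_refl dual_systemD(3)[OF ds]) auto
    then show ?thesis using that by simp
  qed
  have US: "U a \<in> ?S" for a
  proof -
    note K = residue_kernel_index[where l = 1 and \<chi> = "\<lambda>_. f a", OF H' p0 hom]
    have "subnormal (U a) G"
      unfolding U_def using subnormal_step[OF is_group sn normal_Int_restrict[OF H'(1) N' K(1)]] .
    moreover have "finite (rcosets (U a))"
      using index_Int_le(1)[OF N' N(2) K(2,3)] unfolding U_def .
    moreover have "card (rcosets (U a)) \<le> m"
    proof -
      have "card (rcosets (U a)) \<le> card (rcosets N) * (card (rcosets H) * p ^ 1)"
        using order_trans[OF index_Int_le(2)[OF N' N(2) K(2,3)] mult_le_mono2[OF K(4)]] unfolding U_def .
      then show ?thesis using m by simp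
    qed
    moreover have "subgroup (U a) G" unfolding U_def using N' K(2) by (rule subgroups_Inter_pair)
    ultimately show ?thesis by (simp add: finite_index_subgroup_def)
  qed
  have fibre: "card {a \<in> ?A. U a = V} \<le> p ^ (card (rcosets N) * p)" for V
  proof (cases "{a \<in> ?A. U a = V} = {}")
    case False
    then obtain a0 where a0: "U a0 = V" by blast
    \<comment> \<open>\<open>F x\<close> determines the coset of \<open>V\<close> in \<open>H\<close> that contains \<open>x\<close>\<close>
    define F where "F x = (N #> x, f a0 x mod int p)" for x
    let ?T = "(rcosets N) \<times> {0..<int p}"
    have FT: "F x \<in> ?T" if "x \<in> H" for x
      using that p0 subgroup.subset[OF N'] subgroup.mem_carrier[OF H'(1)] by (auto simp: F_def intro!: rcosetsI)
    define w where "w a = (\<lambda>v\<in>?T. f a (SOME x. x \<in> H \<and> F x = v) mod int p)" for a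
    have const: "[f a x = f a y] (mod int p)"
      if a: "U a = V" and xy: "x \<in> H" "y \<in> H" "F x = F y" for a x y
    proof -
      have carr: "x \<in> carrier G" "y \<in> carrier G" using xy subgroup.mem_carrier[OF H'(1)] by auto
      have zH: "x \<otimes> inv y \<in> H"
        using xy by (intro subgroup.m_closed[OF H'(1)] subgroup.m_inv_closed[OF H'(1)])
      have zN: "x \<otimes> inv y \<in> N" using mult_inv_mem_if_rcos_eq[OF N' carr] xy(3) by (simp add: F_def)
      have xz: "x = (x \<otimes> inv y) \<otimes> y" using carr by (simp add: m_assoc)
      have split: "[f b x = f b (x \<otimes> inv y) + f b y] (mod int p)" for b
        using residue_homD[OF hom, of "x \<otimes> inv y" y b] zH xy(2) xz by simp
      have "[f a0 x = f a0 y] (mod int p)" using xy(3) by (simp add: F_def cong_def)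
      with split[of a0] have "[f a0 (x \<otimes> inv y) + f a0 y = 0 + f a0 y] (mod int p)"
        by (simp add: cong_def)
      then have "[f a0 (x \<otimes> inv y) = 0] (mod int p)" by (simp only: cong_add_rcancel)
      then have "x \<otimes> inv y \<in> U a0" using zH zN by (simp add: U_def residue_kernel_def)
      then have "x \<otimes> inv y \<in> U a" using a a0 by simp
      then have "[f a (x \<otimes> inv y) = 0] (mod int p)" by (simp add: U_def residue_kernel_def)
      from cong_add[OF this cong_refl[of "f a y"]] split[of a] show ?thesis
        by (metis add.left_neutral cong_trans)
    qed
    have "inj_on w {a \<in> ?A. U a = V}"
    proof (rule inj_onI)
      fix a b assume a: "a \<in> {a \<in> ?A. U a = V}" and b: "b \<in> {a \<in> ?A. U a = V}" and eq: "w a = w b"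
      have feq: "[f a x = f b x] (mod int p)" if x: "x \<in> H" for x
      proof -
        let ?y = "SOME y. y \<in> H \<and> F y = F x"
        have y: "?y \<in> H \<and> F ?y = F x" by (rule someI[of _ x]) (use x in simp)
        have "w a (F x) = w b (F x)" using eq by simp
        then have ab: "[f a ?y = f b ?y] (mod int p)" using FT[OF x] by (simp add: w_def cong_def)
        have y': "[f c ?y = f c x] (mod int p)" if "U c = V" for c
          by (rule const[OF that conjunct1[OF y] x conjunct2[OF y]])
        have "U a = V" "U b = V" using a b by simp_all
        then show ?thesis by (rule cong_trans[OF cong_trans[OF cong_sym[OF y'] ab] y'])
      qed
      have "a j = b j" if "j \<in> {..<n}" for j
      proof -
        have j: "j < n" using that by simp
        have "g j \<in> H" using dual_systemD(2)[OF ds j] by simp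
        have "[a j = b j] (mod int p)"
          by (rule cong_trans[OF cong_trans[OF cong_sym[OF fg_eq[OF j]] feq[OF \<open>g j \<in> H\<close>]] fg_eq[OF j]])
        moreover have "a j \<in> {0..<int p}" "b j \<in> {0..<int p}"
          using PiE_mem[of a "{..<n}" _ j] PiE_mem[of b "{..<n}" _ j] a b that by auto
        ultimately show ?thesis by (simp add: cong_def)
      qed
      then show "a = b" using a b by (intro PiE_ext[of a "{..<n}" _ b]) auto
    qed
    moreover have "w ` {a \<in> ?A. U a = V} \<subseteq> ?T \<rightarrow>\<^sub>E {0..<int p}"
      using p0 by (simp add: image_subset_iff w_def restrict_PiE_iff)
    moreover have "finite (?T \<rightarrow>\<^sub>E {0..<int p})" using N(2) by (intro finite_PiE) auto
    ultimately have "card {a \<in> ?A. U a = V} \<le> card (?T \<rightarrow>\<^sub>E {0..<int p})" by (rule card_inj_on_le)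
    also have "\<dots> = p ^ (card (rcosets N) * p)"
      using N(2) by (simp add: card_PiE card_cartesian_product)
    finally show ?thesis .
  next
    case True
    then show ?thesis by (simp only: card.empty)
  qed
  have "card ?A = p ^ n" by (simp add: card_PiE)
  moreover have "card ?A = (\<Sum>V\<in>?S. card {a \<in> ?A. U a = V})"
  proof -
    have "U ` ?A \<subseteq> ?S" using US by blast
    from sum.group[OF finA finS this, of "\<lambda>_. 1 :: nat"] show ?thesis by simp
  qed
  moreover have "\<dots> \<le> card ?S * p ^ (card (rcosets N) * p)"
    using sum_bounded_above[of ?S "\<lambda>V. card {a \<in> ?A. U a = V}" "p ^ (card (rcosets N) * p)"] fibre by simp
  ultimately show ?thesis by (simp add: subnormal_subgroup_count_def)
qed


section \<open>Growth along all indices\<close>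

lemma bracket_between_powers:
  fixes b Q n :: nat
  assumes "2 \<le> b" "1 \<le> Q" "Q \<le> n"
  shows "\<exists>i. Q * b ^ i \<le> n \<and> n < Q * b ^ Suc i"
proof -
  have "\<exists>j. n < Q * b ^ j"
  proof
    have "n < 2 ^ n" by (rule less_exp)
    also have "(2::nat) ^ n \<le> b ^ n" using assms by (intro power_mono) auto
    also have "\<dots> \<le> Q * b ^ n" using assms by simp
    finally show "n < Q * b ^ n" .
  qed
  then obtain j where j: "n < Q * b ^ j" "\<And>i. i < j \<Longrightarrow> Q * b ^ i \<le> n"
    using exists_least_iff[of "\<lambda>j. n < Q * b ^ j"] by (auto simp: not_less)
  have "j \<noteq> 0" using j(1) assms(3) by (intro notI) simp
  then show ?thesis using j by (intro exI[of _ "j - 1"]) simp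
qed

text \<open>For \<open>Q b\<^sup>i \<le> n < Q b\<^bsup>i+1\<^esup>\<close> the exponent \<open>2\<^sup>i\<close> is at least a constant times \<open>n\<close> to the power
  \<open>log\<^sub>b 2\<close>. Half of that power serves as \<open>k\<close>, which absorbs all constants.\<close>

lemma growth_from_geometric_subsequence:
  fixes s :: "nat \<Rightarrow> nat" and p b Q E :: nat
  assumes mono: "\<And>m n. m \<le> n \<Longrightarrow> s m \<le> s n" and p: "2 \<le> p" and b: "2 \<le> b" and Q: "1 \<le> Q" and E: "1 \<le> E"
    and big: "\<And>i. p ^ (2 ^ i) \<le> s (Q * b ^ i) * E"
  shows "\<exists>k::real. k > 0 \<and> filterlim (\<lambda>n. real (s n) / (real p powr (real n powr k))) at_top sequentially"
proof -
  define k where "k = log b 2 / 2"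
  have bk: "real b powr (2 * k) = 2" unfolding k_def using b by simp
  have k: "k > 0" unfolding k_def using b by simp
  define c where "c = 1 / (2 * real Q powr (2 * k))"
  have c: "c > 0" unfolding c_def using Q by simp
  let ?y = "\<lambda>n. real n powr k"
  have lower: "real p powr (?y n * (c * ?y n - 1)) / E \<le> real (s n) / (real p powr ?y n)" if n: "Q \<le> n" for n
  proof -
    obtain i where i: "Q * b ^ i \<le> n" "n < Q * b ^ Suc i"
      using bracket_between_powers[OF b Q n] by blast
    have npos: "real n > 0" using n Q by simp
    have "real n \<le> real Q * real b ^ Suc i" using i(2) by (metis less_imp_le of_nat_le_iff of_nat_mult of_nat_power)
    then have "real n powr (2 * k) \<le> (real Q * real b ^ Suc i) powr (2 * k)"
      using k npos by (intro powr_mono2) auto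
    also have "\<dots> = real Q powr (2 * k) * (real b ^ Suc i) powr (2 * k)"
      by (simp add: powr_mult)
    also have "(real b ^ Suc i) powr (2 * k) = (real b powr (2 * k)) ^ Suc i"
      using b by (simp add: powr_realpow[symmetric] powr_powr mult.commute del: power_Suc)
    also have "\<dots> = 2 ^ Suc i" by (simp only: bk)
    finally have "c * real n powr (2 * k) \<le> 2 ^ i"
      using Q by (simp add: c_def field_simps)
    then have "c * (?y n * ?y n) \<le> 2 ^ i" by (simp flip: powr_add)
    then have "real p powr (c * (?y n * ?y n)) \<le> real p powr (2 ^ i)"
      using p by (intro powr_mono) auto
    also have "real p powr (2 ^ i) = real (p ^ (2 ^ i))"
      using p powr_realpow[of "real p" "2 ^ i"] by simp
    also have "\<dots> \<le> real (s (Q * b ^ i) * E)" using big[of i] by (simp only: of_nat_le_iff)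
    also have "\<dots> \<le> real (s n * E)" using mono[OF i(1)] by (simp only: of_nat_le_iff mult_le_mono1)
    finally have "real p powr (c * (?y n * ?y n)) / E \<le> real (s n)"
      using E by (simp add: field_simps)
    then have "real p powr (c * (?y n * ?y n)) / E / (real p powr ?y n) \<le> real (s n) / (real p powr ?y n)"
      by (rule divide_right_mono) simp
    moreover have "real p powr (?y n * (c * ?y n - 1)) = real p powr (c * (?y n * ?y n)) / (real p powr ?y n)"
      by (simp add: powr_diff[symmetric] algebra_simps)
    ultimately show ?thesis by (simp add: field_simps)
  qed
  have y: "filterlim ?y at_top sequentially"
  proof (rule filterlim_at_top_mono)
    show "filterlim (\<lambda>n. exp (k * ln (real n))) at_top sequentially"
      by (rule filterlim_compose[OF exp_at_top filterlim_tendsto_pos_mult_at_top[OF tendsto_const k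
            filterlim_compose[OF ln_at_top filterlim_real_sequentially]]])
    show "\<forall>\<^sub>F n in sequentially. exp (k * ln (real n)) \<le> ?y n"
      by (rule eventually_sequentiallyI[of 1]) (simp add: powr_def)
  qed
  have "filterlim (\<lambda>n. c * ?y n) at_top sequentially"
    by (rule filterlim_tendsto_pos_mult_at_top[OF tendsto_const c y])
  then have "filterlim (\<lambda>n. c * ?y n - 1) at_top sequentially"
    using filterlim_tendsto_add_at_top[OF tendsto_const[of "- 1 :: real"]] by simp
  then have "filterlim (\<lambda>n. ?y n * (c * ?y n - 1)) at_top sequentially"
    by (rule filterlim_at_top_mult_at_top[OF y])
  then have "filterlim (\<lambda>n. ln (real p) * (?y n * (c * ?y n - 1))) at_top sequentially"
    using p by (intro filterlim_tendsto_pos_mult_at_top[OF tendsto_const]) auto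
  then have "filterlim (\<lambda>n. exp (ln (real p) * (?y n * (c * ?y n - 1)))) at_top sequentially"
    by (rule filterlim_compose[OF exp_at_top])
  then have "filterlim (\<lambda>n. (1 / real E) * exp (ln (real p) * (?y n * (c * ?y n - 1)))) at_top sequentially"
    using E by (intro filterlim_tendsto_pos_mult_at_top[OF tendsto_const]) auto
  then have "filterlim (\<lambda>n. real p powr (?y n * (c * ?y n - 1)) / E) at_top sequentially"
    using p by (simp add: powr_def mult.commute)
  moreover have "\<forall>\<^sub>F n in sequentially. real p powr (?y n * (c * ?y n - 1)) / E \<le> real (s n) / (real p powr ?y n)"
    using lower by (auto simp: eventually_sequentially)
  ultimately have "filterlim (\<lambda>n. real (s n) / (real p powr ?y n)) at_top sequentially"
    by (rule filterlim_at_top_mono)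
  then show ?thesis using k by blast
qed


lemma subnormal_subgroup_count_mono:
  assumes "finitely_generated_group G" "m \<le> n"
  shows "subnormal_subgroup_count G m \<le> subnormal_subgroup_count G n"
  unfolding subnormal_subgroup_count_def
proof (rule card_mono)
  show "finite {H. finite_index_subgroup H G \<and> subnormal H G \<and> card (rcosets\<^bsub>G\<^esub> H) \<le> n}"
    by (rule finite_subset[OF _ finite_bounded_index_subgroups[OF assms(1), of n]]) blast
qed (use assms(2) in auto)

lemma subnormal_subgroup_count_le_subgroup_count:
  assumes "finitely_generated_group G"
  shows "subnormal_subgroup_count G n \<le> subgroup_count G n"
  unfolding subnormal_subgroup_count_def subgroup_count_def
  by (rule card_mono[OF finite_bounded_index_subgroups[OF assms]]) blast

theorem theorem1p2:
  fixes G :: "('a, 'g) monoid_scheme" and p :: nat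
  assumes "finitely_generated_group G"
    and "prime p"
    and "b2_b1_property p G"
    and "(SUP H \<in> {H. finite_index_subgroup H G}. betti p 1 (G\<lparr>carrier := H\<rparr>)) = (\<infinity>::enat)"
  shows "\<exists>k::real. k > 0 \<and>
           (\<forall>n. subgroup_count G n \<ge> subnormal_subgroup_count G n) \<and>
           Omega_growth (\<lambda>n. real (subnormal_subgroup_count G n))
             (\<lambda>n. real p powr (real n powr k))"
proof -
  note fg = assms(1) and p = assms(2)
  interpret group G using fg by (simp add: finitely_generated_group_def)
  have p2: "2 \<le> p" using p by (rule prime_ge_2_nat)
  obtain C where C: "\<And>H n. finite_index_subgroup H G \<Longrightarrow>
      \<not> residue_rank_ge p (G\<lparr>carrier := H\<rparr>) (Suc n) \<Longrightarrow>
      \<exists>r\<le>C * (n + 1). betti p 2 (G\<lparr>carrier := H\<rparr>) = enat r"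
    by (rule b2_le_of_b2_b1_property[OF is_group p assms(3)]) blast
  \<comment> \<open>the rank at which \<open>rank_doubling\<close> becomes applicable\<close>
  define D where "D = C + (C + 3) * (C + 3)"
  have "enat D < (SUP H \<in> {H. finite_index_subgroup H G}. betti p 1 (G\<lparr>carrier := H\<rparr>))"
    unfolding assms(4) by simp
  then obtain H where H: "finite_index_subgroup H G" "enat D < betti p 1 (G\<lparr>carrier := H\<rparr>)"
    by (auto simp: less_SUP_iff)
  have H': "subgroup H G" "finite (rcosets\<^bsub>G\<^esub> H)" using H(1) by (auto simp: finite_index_subgroup_def)
  have rk: "residue_rank_ge p (G\<lparr>carrier := H\<rparr>) (Suc D)"
    using betti_1_le[OF p subgroup_imp_group[OF H'(1)], of D] H(2) by (auto simp: not_le[symmetric])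
  obtain N where N: "N \<lhd> G" "N \<subseteq> H" "finite (rcosets\<^bsub>G\<^esub> N)" by (rule normal_core[OF H'])
  define q where "q = card (rcosets\<^bsub>G\<^esub> N)"
  define Q where "Q = q * card (rcosets\<^bsub>G\<^esub> H) * p"
  let ?b = "p ^ (C + 3)" and ?E = "p ^ (q * p)"
  have big: "p ^ (2 ^ i) \<le> subnormal_subgroup_count G (Q * ?b ^ i) * ?E" for i
  proof -
    have D: "C + (C + 3) * (C + 3) \<le> Suc D" by (simp add: D_def)
    obtain K where K: "finite_index_subgroup K G" "card (rcosets\<^bsub>G\<^esub> K) \<le> card (rcosets\<^bsub>G\<^esub> H) * ?b ^ i"
      "residue_rank_ge p (G\<lparr>carrier := K\<rparr>) (2 ^ i * Suc D)" "subnormal (N \<inter> K) G"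
      using rank_tower[OF fg p H(1) C rk D N(1,2), of i] by blast
    have rkK: "residue_rank_ge p (G\<lparr>carrier := K\<rparr>) (2 ^ i)"
      by (rule residue_rank_ge_mono[OF K(3)]) simp
    have "q * (card (rcosets\<^bsub>G\<^esub> K) * p) \<le> q * (card (rcosets\<^bsub>G\<^esub> H) * ?b ^ i * p)"
      using K(2) by (intro mult_le_mono2 mult_le_mono1)
    also have "\<dots> = Q * ?b ^ i" by (simp add: Q_def mult_ac)
    finally show ?thesis
      unfolding q_def by (rule subnormal_count_ge[OF fg p K(1) rkK N(1,3) K(4)])
  qed
  have Q: "1 \<le> Q"
  proof -
    have "rcosets\<^bsub>G\<^esub> N \<noteq> {}" "rcosets\<^bsub>G\<^esub> H \<noteq> {}"
      using subgroup_mem_rcosets[OF normal_imp_subgroup[OF N(1)]] subgroup_mem_rcosets[OF H'(1)] by auto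
    then show ?thesis using N(3) H'(2) p2 by (simp add: Q_def q_def Suc_le_eq card_gt_0_iff)
  qed
  have b: "2 \<le> ?b" using p2 self_le_power[of p "C + 3"] by simp
  have E: "1 \<le> ?E" using p2 by simp
  obtain k :: real where "k > 0"
    "filterlim (\<lambda>n. real (subnormal_subgroup_count G n) / (real p powr (real n powr k))) at_top sequentially"
    using growth_from_geometric_subsequence[where s = "subnormal_subgroup_count G",
        OF subnormal_subgroup_count_mono[OF fg] p2 b Q E big] by blast
  then show ?thesis
    using subnormal_subgroup_count_le_subgroup_count[OF fg] by (auto simp: Omega_growth_def)
qed

end
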